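(* Let $\mu,\nu:\mathbb P\to\mathbf g$ be meromorphic maps regular along $\partial D$. Then, as operators on ${}_D\mathcal W$, $[{}_DJ^\mu,{}_DJ^\nu]-{}_DJ^{[\mu,\nu]}=0$ if either (a) both $\mu$ and $\nu$ are regular in $D'$, or (b) both $\mu$ and $\nu$ are regular in $D$. In general, $$[{}_DJ^\mu,{}_DJ^\nu]-{}_DJ^{[\mu,\nu]}=\frac1{2\pi i}\int_{\partial D}(\mu,d\nu).$$
   Context: $\mathbb P$ is a complex projective line; $D\subset\mathbb P$ is a domain biholomorphic to a disc with smooth boundary $\partial D$ oriented counterclockwise around $D$, $D'$ the complement of its closure. $\mathbf g$ is a complex Lie algebra with a nondegenerate invariant symmetric bilinear form $(\cdot,\cdot)$. $z_1,\dots,z_n$ are distinct points of $\mathbb P$ not on $\partial D$, and $W_1,\dots,W_n$ representations of $\mathbf g$. $\mathfrak g$ is the Lie algebra of meromorphic maps $\mathbb P\to\mathbf g$ (with $\mathbf g\subset\mathfrak g$ the constant maps), ${}_D\mathfrak g$ the subalgebra of maps with all poles in $D$, and ${}_D\mathcal W=U({}_D\mathfrak g)\otimes_{U\mathbf g}(W_1\otimes\cdots\otimes W_n)$. For $\nu\in\mathfrak g$ regular along $\partial D$ the operator ${}_DJ^\nu:{}_D\mathcal W\to{}_D\mathcal W$, linear in $\nu$, is defined inductively (simultaneously for all such $\nu$) by $$[{}_DJ^\nu,\alpha]={}_DJ^{[\nu,\alpha]}+\frac1{2\pi i}\int_{\partial D}(\nu,d\alpha),\qquad\alpha\in{}_D\mathfrak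 g$$ ($\alpha$ acting by left multiplication) together with: if $\nu$ is regular in $D'$, $${}_DJ^\nu(w_1\otimes\cdots\otimes w_n)=\nu\otimes_{U\mathbf g}(w_1\otimes\cdots\otimes w_n)-\sum_{z_k\in D'}w_1\otimes\cdots\otimes\nu(z_k)(w_k)\otimes\cdots\otimes w_n,$$ and if $\nu$ is regular in $D$, $${}_DJ^\nu(w_1\otimes\cdots\otimes w_n)=\sum_{z_k\in D}w_1\otimes\cdots\otimes\nu(z_k)(w_k)\otimes\cdots\otimes w_n .$$ Every $\nu$ regular along $\partial D$ is a sum of maps of these two types, unique up to constant maps, on which the two formulas agree. *)

theory Defs
  imports "HOL-Complex_Analysis.Complex_Analysis" "HOL-Library.Poly_Mapping"
begin

class complex_vector_space = ab_group_add +
  fixes scaleC :: "complex \<Rightarrow> 'a \<Rightarrow> 'a" (infixr \<open>*\<^sub>C\<close> 75)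
  assumes scaleC_add_right: "a *\<^sub>C (x + y) = a *\<^sub>C x + a *\<^sub>C y"
    and scaleC_add_left: "(a + b) *\<^sub>C x = a *\<^sub>C x + b *\<^sub>C x"
    and scaleC_scaleC: "a *\<^sub>C b *\<^sub>C x = (a * b) *\<^sub>C x"
    and scaleC_one: "1 *\<^sub>C x = x"

abbreviation cspan :: "'a::complex_vector_space set \<Rightarrow> 'a set"
  where "cspan \<equiv> module.span scaleC"

abbreviation csubspace :: "'a::complex_vector_space set \<Rightarrow> bool"
  where "csubspace \<equiv> module.subspace scaleC"

abbreviation functional :: "('a::complex_vector_space \<Rightarrow> complex) \<Rightarrow> bool"
  where "functional \<equiv> Vector_Spaces.linear scaleC (*)"

lemma vector_space_scaleC: "vector_space (scaleC :: complex \<Rightarrow> 'a \<Rightarrow> 'a::complex_vector_space)"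
  by unfold_locales (simp_all add: scaleC_add_right scaleC_add_left scaleC_scaleC scaleC_one)

instantiation poly_mapping :: (type, complex_vector_space) complex_vector_space
begin

definition "scaleC c f = Poly_Mapping.map (scaleC c) f"

lemma scaleC_zero_right: "c *\<^sub>C (0 :: 'c::complex_vector_space) = 0"
  using scaleC_add_right[of c 0 "0 :: 'c"] by simp

lemma lookup_scaleC: "Poly_Mapping.lookup (c *\<^sub>C f) x
    = c *\<^sub>C Poly_Mapping.lookup (f :: 'a \<Rightarrow>\<^sub>0 'b) x"
  by (auto simp: scaleC_poly_mapping_def Poly_Mapping.map.rep_eq when_def scaleC_zero_right)

instance
  by standard (rule poly_mapping_eqI; simp add: lookup_scaleC lookup_add
    scaleC_add_right scaleC_add_left scaleC_scaleC scaleC_one)+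

end

instantiation complex :: complex_vector_space
begin

definition scaleC_complex :: "complex \<Rightarrow> complex \<Rightarrow> complex"
  where [simp]: "scaleC_complex a x = a * x"

instance by standard (simp_all add: algebra_simps)

end

class complex_lie_algebra = complex_vector_space +
  fixes lie :: "'a \<Rightarrow> 'a \<Rightarrow> 'a"
  assumes lie_add_left: "lie (x + y) z = lie x z + lie y z"
    and lie_add_right: "lie x (y + z) = lie x y + lie x z"
    and lie_scaleC_left: "lie (c *\<^sub>C x) y = c *\<^sub>C lie x y"
    and lie_scaleC_right: "lie x (c *\<^sub>C y) = c *\<^sub>C lie x y"
    and lie_self: "lie x x = 0"
    and lie_jacobi: "lie x (lie y z) + lie y (lie z x) + lie z (lie x y) = 0"

class quadratic_lie_algebra = complex_lie_algebra +
  fixes form :: "'a \<Rightarrow> 'a \<Rightarrow> complex"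
  assumes form_add_left: "form (x + y) z = form x z + form y z"
    and form_scaleC_left: "form (c *\<^sub>C x) y = c * form x y"
    and form_commute: "form x y = form y x"
    and form_invariant: "form (lie x y) z = form x (lie y z)"
    and form_nondegenerate: "(\<forall>y. form x y = 0) \<Longrightarrow> x = 0"

definition lie_representation ::
  "'w::complex_vector_space set \<Rightarrow> ('g::complex_lie_algebra \<Rightarrow> 'w \<Rightarrow> 'w) \<Rightarrow> bool"
  where "lie_representation V \<rho> \<longleftrightarrow> csubspace V
    \<and> (\<forall>x. \<forall>v\<in>V. \<rho> x v \<in> V)
    \<and> (\<forall>x. \<forall>u\<in>V. \<forall>v\<in>V. \<rho> x (u + v) = \<rho> x u + \<rho> x v)
    \<and> (\<forall>x c. \<forall>v\<in>V. \<rho> x (c *\<^sub>C v) = c *\<^sub>C \<rho> x v)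
    \<and> (\<forall>x y. \<forall>v\<in>V. \<rho> (x + y) v = \<rho> x v + \<rho> y v)
    \<and> (\<forall>x c. \<forall>v\<in>V. \<rho> (c *\<^sub>C x) v = c *\<^sub>C \<rho> x v)
    \<and> (\<forall>x y. \<forall>v\<in>V. \<rho> (lie x y) v = \<rho> x (\<rho> y v) - \<rho> y (\<rho> x v))"

datatype cproj = Fin complex | Infty

definition inf_chart :: "complex \<Rightarrow> cproj"
  where "inf_chart w = (if w = 0 then Infty else Fin (inverse w))"

text \<open>A chart is given here by its inverse, i.e. as a parametrization of an open subset of the
  projective line.\<close>

definition charts :: "(complex \<Rightarrow> cproj) set"
  where "charts = {Fin, inf_chart}"

instantiation cproj :: topological_space
begin

definition open_cproj :: "cproj set \<Rightarrow> bool"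
  where "open_cproj S \<longleftrightarrow> (\<forall>c\<in>charts. open (c -` S))"

instance
proof
  show "open (UNIV :: cproj set)"
    by (simp add: open_cproj_def)
  show "open (S \<inter> T)" if "open S" "open T" for S T :: "cproj set"
    using that by (auto simp: open_cproj_def)
  show "open (\<Union>K)" if "\<forall>S\<in>K. open S" for K :: "cproj set set"
    using that by (auto simp: open_cproj_def vimage_Union)
qed

end

definition biholomorphic_to_disc :: "cproj set \<Rightarrow> bool"
  where "biholomorphic_to_disc D \<longleftrightarrow> (\<exists>\<phi> \<psi>.
      \<phi> ` ball 0 1 = D \<and> \<psi> ` D = ball 0 1
    \<and> (\<forall>u\<in>ball 0 1. \<psi> (\<phi> u) = u) \<and> (\<forall>p\<in>D. \<phi> (\<psi> p) = p)
    \<and> (\<forall>u\<in>ball 0 1. \<exists>c\<in>charts. \<exists>h. \<exists>e>0. h holomorphic_on ball u e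
          \<and> (\<forall>v\<in>ball u e. \<phi> v = c (h v)))
    \<and> (\<forall>c\<in>charts. (\<psi> \<circ> c) holomorphic_on (c -` D)))"

text \<open>The curve \<open>\<gamma>\<close> is a 1-periodic \<open>C\<^sup>\<infinity>\<close> immersion that parametrizes the frontier of \<open>D\<close> once;
  \<open>d k\<close> is the \<open>k\<close>-th derivative of \<open>\<gamma>\<close> in a chart. Counterclockwise orientation around \<open>D\<close> means
  that \<open>D\<close> lies to the left of \<open>\<gamma>\<close>; transition maps being holomorphic, the choice of the chart is
  immaterial. No chart is preferred: \<open>Infty\<close> may lie in \<open>D\<close>, in its exterior or on its frontier.\<close>

definition positive_smooth_boundary :: "cproj set \<Rightarrow> (real \<Rightarrow> cproj) \<Rightarrow> bool"
  where "positive_smooth_boundary D \<gamma> \<longleftrightarrow>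
      (\<forall>t. \<gamma> (t + 1) = \<gamma> t) \<and> inj_on \<gamma> {0..<1} \<and> range \<gamma> = frontier D
    \<and> (\<forall>t. \<exists>c\<in>charts. \<exists>e>0. \<exists>d :: nat \<Rightarrow> real \<Rightarrow> complex.
          (\<forall>s\<in>{t - e<..<t + e}. \<gamma> s = c (d 0 s))
        \<and> (\<forall>k. \<forall>s\<in>{t - e<..<t + e}. (d k has_vector_derivative d (Suc k) s) (at s))
        \<and> d 1 t \<noteq> 0
        \<and> (\<forall>\<^sub>F r in at_right 0. c (d 0 t + of_real r * (\<i> * d 1 t)) \<in> D))"

abbreviation (input) exterior :: "cproj set \<Rightarrow> cproj set"
  where "exterior D \<equiv> - closure D"

definition regular_at :: "(cproj \<Rightarrow> 'g::complex_vector_space) \<Rightarrow> cproj \<Rightarrow> bool"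
  where "regular_at \<nu> p \<longleftrightarrow>
    (\<forall>l. functional l \<longrightarrow> (\<forall>c\<in>charts. (l \<circ> \<nu> \<circ> c) analytic_on (c -` {p})))"

definition pole_at :: "(cproj \<Rightarrow> 'g::complex_vector_space) \<Rightarrow> cproj \<Rightarrow> bool"
  where "pole_at \<nu> p \<longleftrightarrow>
    (\<exists>l. functional l \<and> (\<exists>c\<in>charts. \<exists>u. c u = p \<and> is_pole (l \<circ> \<nu> \<circ> c) u))"

text \<open>Elements of \<open>mero_maps\<close> are total functions in normal form: at a pole the value is \<open>0\<close>, elsewhere
  it is the regular value (as for \<open>nicely_meromorphic_on\<close>), so that equality of functions is equality
  of meromorphic maps. The target has no topology and may have infinite dimension; a map is
  meromorphic if it has values in a finite-dimensional subspace and meromorphic coordinates, i.e.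
  lies in the tensor product of the target with the field of meromorphic functions.\<close>

definition mero_maps :: "(cproj \<Rightarrow> 'g::complex_vector_space) set"
  where "mero_maps = {\<nu>.
      (\<exists>B. finite B \<and> range \<nu> \<subseteq> cspan B)
    \<and> (\<forall>l. functional l \<longrightarrow> (\<forall>c\<in>charts. (l \<circ> \<nu> \<circ> c) meromorphic_on UNIV))
    \<and> (\<forall>p. regular_at \<nu> p \<or> pole_at \<nu> p \<and> \<nu> p = 0)}"

text \<open>The pointwise sum or bracket of two normal forms can have the wrong value where poles occur;
  \<open>fill_in\<close> restores the normal form.\<close>

definition weak_limit :: "(cproj \<Rightarrow> 'g::complex_vector_space) \<Rightarrow> cproj \<Rightarrow> 'g \<Rightarrow> bool"
  where "weak_limit \<nu> p v \<longleftrightarrow> (\<forall>l. functional l \<longrightarrow> ((\<lambda>q. l (\<nu> q)) \<longlongrightarrow> l v) (at p))"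

definition fill_in :: "(cproj \<Rightarrow> 'g::complex_vector_space) \<Rightarrow> cproj \<Rightarrow> 'g"
  where "fill_in \<nu> p = (if \<exists>v. weak_limit \<nu> p v then THE v. weak_limit \<nu> p v else 0)"

definition madd :: "(cproj \<Rightarrow> 'g::complex_vector_space) \<Rightarrow> (cproj \<Rightarrow> 'g) \<Rightarrow> cproj \<Rightarrow> 'g"
  where "madd \<mu> \<nu> = fill_in (\<lambda>p. \<mu> p + \<nu> p)"

definition mscale :: "complex \<Rightarrow> (cproj \<Rightarrow> 'g::complex_vector_space) \<Rightarrow> cproj \<Rightarrow> 'g"
  where "mscale c \<nu> = (\<lambda>p. c *\<^sub>C \<nu> p)"

definition mlie :: "(cproj \<Rightarrow> 'g::complex_lie_algebra) \<Rightarrow> (cproj \<Rightarrow> 'g) \<Rightarrow> cproj \<Rightarrow> 'g"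
  where "mlie \<mu> \<nu> = fill_in (\<lambda>p. lie (\<mu> p) (\<nu> p))"

definition maps_regular_on :: "cproj set \<Rightarrow> (cproj \<Rightarrow> 'g::complex_vector_space) set"
  where "maps_regular_on S = {\<nu> \<in> mero_maps. \<forall>p\<in>S. regular_at \<nu> p}"

abbreviation (input) maps_poles_in :: "cproj set \<Rightarrow> (cproj \<Rightarrow> 'g::complex_vector_space) set"
  where "maps_poles_in D \<equiv> maps_regular_on (- D)"

text \<open>The form \<open>(\<nu>, d\<alpha>)\<close> pulled back along \<open>\<gamma>\<close>; only \<open>\<alpha>\<close> is differentiated, whence the two
  parameters \<open>s\<close> and \<open>t\<close>.\<close>

definition boundary_pairing ::
  "(real \<Rightarrow> cproj) \<Rightarrow> (cproj \<Rightarrow> 'g::quadratic_lie_algebra) \<Rightarrow> (cproj \<Rightarrow> 'g) \<Rightarrow> complex"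
  where "boundary_pairing \<gamma> \<nu> \<alpha> = 1 / (2 * of_real pi * \<i>) *
    integral {0..1} (\<lambda>t. vector_derivative (\<lambda>s. form (\<nu> (\<gamma> t)) (\<alpha> (\<gamma> s))) (at t))"

text \<open>Vector spaces given by generators and relations: \<open>quot X R\<close> is the free vector space on the
  set \<open>X\<close> modulo the span of \<open>R\<close>, its elements being cosets.\<close>

definition gen :: "'x \<Rightarrow> 'x \<Rightarrow>\<^sub>0 complex"
  where "gen x = Poly_Mapping.single x 1"

definition cls :: "('x \<Rightarrow>\<^sub>0 complex) set \<Rightarrow> ('x \<Rightarrow>\<^sub>0 complex) \<Rightarrow> ('x \<Rightarrow>\<^sub>0 complex) set"
  where "cls R v = {w. w - v \<in> cspan R}"

definition quot :: "'x set \<Rightarrow> ('x \<Rightarrow>\<^sub>0 complex) set \<Rightarrow> ('x \<Rightarrow>\<^sub>0 complex) set set"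
  where "quot X R = {cls R v | v. Poly_Mapping.keys v \<subseteq> X}"

definition qadd ::
  "('x \<Rightarrow>\<^sub>0 complex) set \<Rightarrow> ('x \<Rightarrow>\<^sub>0 complex) set \<Rightarrow> ('x \<Rightarrow>\<^sub>0 complex) set \<Rightarrow> ('x \<Rightarrow>\<^sub>0 complex) set"
  where "qadd R A B = (\<Union>a\<in>A. \<Union>b\<in>B. cls R (a + b))"

definition qdiff ::
  "('x \<Rightarrow>\<^sub>0 complex) set \<Rightarrow> ('x \<Rightarrow>\<^sub>0 complex) set \<Rightarrow> ('x \<Rightarrow>\<^sub>0 complex) set \<Rightarrow> ('x \<Rightarrow>\<^sub>0 complex) set"
  where "qdiff R A B = (\<Union>a\<in>A. \<Union>b\<in>B. cls R (a - b))"

definition qscale ::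
  "('x \<Rightarrow>\<^sub>0 complex) set \<Rightarrow> complex \<Rightarrow> ('x \<Rightarrow>\<^sub>0 complex) set \<Rightarrow> ('x \<Rightarrow>\<^sub>0 complex) set"
  where "qscale R c A = (\<Union>a\<in>A. cls R (c *\<^sub>C a))"

definition lin_ext :: "('x \<Rightarrow> 'y \<Rightarrow>\<^sub>0 complex) \<Rightarrow> ('x \<Rightarrow>\<^sub>0 complex) \<Rightarrow> 'y \<Rightarrow>\<^sub>0 complex"
  where "lin_ext f v = (\<Sum>x\<in>Poly_Mapping.keys v. Poly_Mapping.lookup v x *\<^sub>C f x)"

text \<open>The endomorphism of a quotient by the span of \<open>R\<close> induced by prescribing the images of the
  generators.\<close>

definition qmap :: "('x \<Rightarrow>\<^sub>0 complex) set \<Rightarrow> ('x \<Rightarrow> 'x \<Rightarrow>\<^sub>0 complex)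
    \<Rightarrow> ('x \<Rightarrow>\<^sub>0 complex) set \<Rightarrow> ('x \<Rightarrow>\<^sub>0 complex) set"
  where "qmap R f A = (\<Union>a\<in>A. cls R (lin_ext f a))"

type_synonym 'g uel = "((cproj \<Rightarrow> 'g) list \<Rightarrow>\<^sub>0 complex) set"
type_synonym 'w tel = "((nat \<Rightarrow> 'w) \<Rightarrow>\<^sub>0 complex) set"

text \<open>The universal enveloping algebra of a Lie algebra \<open>L\<close> of meromorphic maps: the free
  associative algebra on the set \<open>L\<close> (with the words in \<open>L\<close> as basis) modulo the two-sided ideal
  that makes \<open>L\<close> sit in it linearly and its bracket a commutator.\<close>

definition uea_rel :: "(cproj \<Rightarrow> 'g::complex_lie_algebra) set \<Rightarrow> ((cproj \<Rightarrow> 'g) list \<Rightarrow>\<^sub>0 complex) set"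
  where "uea_rel L =
      {gen (u @ [madd a b] @ v) - gen (u @ [a] @ v) - gen (u @ [b] @ v) | u v a b.
         u \<in> lists L \<and> v \<in> lists L \<and> a \<in> L \<and> b \<in> L}
    \<union> {gen (u @ [mscale c a] @ v) - c *\<^sub>C gen (u @ [a] @ v) | u v c a.
         u \<in> lists L \<and> v \<in> lists L \<and> a \<in> L}
    \<union> {gen (u @ [a, b] @ v) - gen (u @ [b, a] @ v) - gen (u @ [mlie a b] @ v) | u v a b.
         u \<in> lists L \<and> v \<in> lists L \<and> a \<in> L \<and> b \<in> L}"

definition uea :: "(cproj \<Rightarrow> 'g::complex_lie_algebra) set \<Rightarrow> 'g uel set"
  where "uea L = quot (lists L) (uea_rel L)"

definition uword :: "(cproj \<Rightarrow> 'g::complex_lie_algebra) set \<Rightarrow> (cproj \<Rightarrow> 'g) list \<Rightarrow> 'g uel"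
  where "uword L u = cls (uea_rel L) (gen u)"

definition uleft ::
  "(cproj \<Rightarrow> 'g::complex_lie_algebra) set \<Rightarrow> (cproj \<Rightarrow> 'g) \<Rightarrow> 'g uel \<Rightarrow> 'g uel"
  where "uleft L \<alpha> = qmap (uea_rel L) (\<lambda>u. gen (\<alpha> # u))"

definition uright ::
  "(cproj \<Rightarrow> 'g::complex_lie_algebra) set \<Rightarrow> (cproj \<Rightarrow> 'g) \<Rightarrow> 'g uel \<Rightarrow> 'g uel"
  where "uright L \<alpha> = qmap (uea_rel L) (\<lambda>u. gen (u @ [\<alpha>]))"

text \<open>The tensor product of the spaces \<open>W k\<close>, \<open>k < n\<close>. They are taken as subspaces of one ambient
  space, which is no restriction (use the direct sum).\<close>

definition tuples :: "nat \<Rightarrow> (nat \<Rightarrow> 'w set) \<Rightarrow> (nat \<Rightarrow> 'w) set"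
  where "tuples n W = (\<Pi>\<^sub>E k\<in>{..<n}. W k)"

definition tensor_rel ::
  "nat \<Rightarrow> (nat \<Rightarrow> 'w::complex_vector_space set) \<Rightarrow> ((nat \<Rightarrow> 'w) \<Rightarrow>\<^sub>0 complex) set"
  where "tensor_rel n W =
      {gen (w(k := a + b)) - gen (w(k := a)) - gen (w(k := b)) | w k a b.
         w \<in> tuples n W \<and> k < n \<and> a \<in> W k \<and> b \<in> W k}
    \<union> {gen (w(k := c *\<^sub>C a)) - c *\<^sub>C gen (w(k := a)) | w k c a.
         w \<in> tuples n W \<and> k < n \<and> a \<in> W k}"

definition tensor :: "nat \<Rightarrow> (nat \<Rightarrow> 'w::complex_vector_space set) \<Rightarrow> 'w tel set"
  where "tensor n W = quot (tuples n W) (tensor_rel n W)"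

definition pure :: "nat \<Rightarrow> (nat \<Rightarrow> 'w::complex_vector_space set) \<Rightarrow> (nat \<Rightarrow> 'w) \<Rightarrow> 'w tel"
  where "pure n W w = cls (tensor_rel n W) (gen w)"

definition tensor_act ::
  "nat \<Rightarrow> (nat \<Rightarrow> 'w::complex_vector_space set) \<Rightarrow> (nat \<Rightarrow> 'g \<Rightarrow> 'w \<Rightarrow> 'w) \<Rightarrow> 'g \<Rightarrow> 'w tel \<Rightarrow> 'w tel"
  where "tensor_act n W \<rho> x = qmap (tensor_rel n W) (\<lambda>w. \<Sum>k<n. gen (w(k := \<rho> k x (w k))))"

text \<open>Relations defining the tensor product over the enveloping algebra of the constant maps. The
  last family need only run over the constant maps themselves, since these generate that algebra.\<close>

definition DW_rel ::
  "cproj set \<Rightarrow> nat \<Rightarrow> (nat \<Rightarrow> 'w::complex_vector_space set)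
    \<Rightarrow> (nat \<Rightarrow> 'g::complex_lie_algebra \<Rightarrow> 'w \<Rightarrow> 'w) \<Rightarrow> ('g uel \<times> 'w tel \<Rightarrow>\<^sub>0 complex) set"
  where "DW_rel D n W \<rho> =
    (let L = maps_poles_in D; U = uea L; T = tensor n W in
      {gen (qadd (uea_rel L) a b, t) - gen (a, t) - gen (b, t) | a b t.
         a \<in> U \<and> b \<in> U \<and> t \<in> T}
    \<union> {gen (qscale (uea_rel L) c a, t) - c *\<^sub>C gen (a, t) | c a t. a \<in> U \<and> t \<in> T}
    \<union> {gen (a, qadd (tensor_rel n W) s t) - gen (a, s) - gen (a, t) | a s t.
         a \<in> U \<and> s \<in> T \<and> t \<in> T}
    \<union> {gen (a, qscale (tensor_rel n W) c t) - c *\<^sub>C gen (a, t) | c a t. a \<in> U \<and> t \<in> T}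
    \<union> {gen (uright L (\<lambda>_. x) a, t) - gen (a, tensor_act n W \<rho> x t) | x a t. a \<in> U \<and> t \<in> T})"

definition DW ::
  "cproj set \<Rightarrow> nat \<Rightarrow> (nat \<Rightarrow> 'w::complex_vector_space set)
    \<Rightarrow> (nat \<Rightarrow> 'g::complex_lie_algebra \<Rightarrow> 'w \<Rightarrow> 'w) \<Rightarrow> ('g uel \<times> 'w tel \<Rightarrow>\<^sub>0 complex) set set"
  where "DW D n W \<rho> = quot (uea (maps_poles_in D) \<times> tensor n W) (DW_rel D n W \<rho>)"

definition DW_act ::
  "cproj set \<Rightarrow> nat \<Rightarrow> (nat \<Rightarrow> 'w::complex_vector_space set)
    \<Rightarrow> (nat \<Rightarrow> 'g::complex_lie_algebra \<Rightarrow> 'w \<Rightarrow> 'w) \<Rightarrow> (cproj \<Rightarrow> 'g)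
    \<Rightarrow> ('g uel \<times> 'w tel \<Rightarrow>\<^sub>0 complex) set \<Rightarrow> ('g uel \<times> 'w tel \<Rightarrow>\<^sub>0 complex) set"
  where "DW_act D n W \<rho> \<alpha> =
    qmap (DW_rel D n W \<rho>) (\<lambda>(a, t). gen (uleft (maps_poles_in D) \<alpha> a, t))"

text \<open>The inductive description of the operators: it determines \<open>J \<nu>\<close> on \<open>DW\<close> for all maps \<open>\<nu>\<close> that
  are regular along the frontier, and says nothing about other maps.\<close>

definition is_DJ ::
  "cproj set \<Rightarrow> (real \<Rightarrow> cproj) \<Rightarrow> nat \<Rightarrow> (nat \<Rightarrow> cproj) \<Rightarrow> (nat \<Rightarrow> 'w::complex_vector_space set)
    \<Rightarrow> (nat \<Rightarrow> 'g::quadratic_lie_algebra \<Rightarrow> 'w \<Rightarrow> 'w)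
    \<Rightarrow> ((cproj \<Rightarrow> 'g) \<Rightarrow> ('g uel \<times> 'w tel \<Rightarrow>\<^sub>0 complex) set \<Rightarrow> ('g uel \<times> 'w tel \<Rightarrow>\<^sub>0 complex) set)
    \<Rightarrow> bool"
  where "is_DJ D \<gamma> n z W \<rho> J \<longleftrightarrow>
    (let R = DW_rel D n W \<rho>; M = DW D n W \<rho>; L = maps_poles_in D;
         act = DW_act D n W \<rho>;
         one_tensor = (\<lambda>w. gen (uword L [], pure n W w));
         at_point = (\<lambda>\<nu> k w. w(k := \<rho> k (\<nu> (z k)) (w k)))
     in \<forall>\<nu> \<in> maps_regular_on (frontier D).
        (\<forall>m\<in>M. J \<nu> m \<in> M)
      \<and> (\<forall>m\<in>M. \<forall>m'\<in>M. J \<nu> (qadd R m m') = qadd R (J \<nu> m) (J \<nu> m'))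
      \<and> (\<forall>c. \<forall>m\<in>M. J \<nu> (qscale R c m) = qscale R c (J \<nu> m))
      \<and> (\<forall>\<mu> \<in> maps_regular_on (frontier D). \<forall>m\<in>M. J (madd \<mu> \<nu>) m = qadd R (J \<mu> m) (J \<nu> m))
      \<and> (\<forall>c. \<forall>m\<in>M. J (mscale c \<nu>) m = qscale R c (J \<nu> m))
      \<and> (\<forall>\<alpha>\<in>L. \<forall>m\<in>M. qdiff R (J \<nu> (act \<alpha> m)) (act \<alpha> (J \<nu> m))
            = qadd R (J (mlie \<nu> \<alpha>) m) (qscale R (boundary_pairing \<gamma> \<nu> \<alpha>) m))
      \<and> (\<nu> \<in> maps_regular_on (exterior D) \<longrightarrow> (\<forall>w\<in>tuples n W.
            J \<nu> (cls R (one_tensor w)) = cls R (gen (uword L [\<nu>], pure n W w)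
              - (\<Sum>k \<in> {k. k < n \<and> z k \<in> exterior D}. one_tensor (at_point \<nu> k w)))))
      \<and> (\<nu> \<in> maps_regular_on D \<longrightarrow> (\<forall>w\<in>tuples n W.
            J \<nu> (cls R (one_tensor w)) = cls R
              (\<Sum>k \<in> {k. k < n \<and> z k \<in> D}. one_tensor (at_point \<nu> k w)))))"

text \<open>The operator \<open>[J \<mu>, J \<nu>] - J [\<mu>, \<nu>]\<close>, evaluated at \<open>m\<close>.\<close>

definition DJ_defect ::
  "('x \<Rightarrow>\<^sub>0 complex) set
    \<Rightarrow> ((cproj \<Rightarrow> 'g::complex_lie_algebra) \<Rightarrow> ('x \<Rightarrow>\<^sub>0 complex) set \<Rightarrow> ('x \<Rightarrow>\<^sub>0 complex) set)
    \<Rightarrow> (cproj \<Rightarrow> 'g) \<Rightarrow> (cproj \<Rightarrow> 'g) \<Rightarrow> ('x \<Rightarrow>\<^sub>0 complex) set \<Rightarrow> ('x \<Rightarrow>\<^sub>0 complex) set"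
  where "DJ_defect R J \<mu> \<nu> m =
    qdiff R (qdiff R (J \<mu> (J \<nu> m)) (J \<nu> (J \<mu> m))) (J (mlie \<mu> \<nu>) m)"

end

theory Submission
  imports Defs
begin

text \<open>Write \<open>B \<mu> \<nu>\<close> for the boundary pairing and \<open>gap \<mu> \<nu>\<close> for the operator
  \<open>[J \<mu>, J \<nu>] - J [\<mu>, \<nu>] - B \<mu> \<nu>\<close>, which has to vanish. The relation that describes the commutator
  of \<open>J \<nu>\<close> with the action of a map \<open>\<alpha>\<close> with poles in \<open>D\<close>, the Jacobi identity and the cocycle identity
  \<open>B [\<mu>, \<nu>] \<alpha> = B \<mu> [\<nu>, \<alpha>] + B [\<mu>, \<alpha>] \<nu>\<close> (Leibniz rule and invariance of the form,
  \<open>boundary_pairing_cocycle\<close>) give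
  \<open>[gap \<mu> \<nu>, \<alpha>] = gap \<mu> [\<nu>, \<alpha>] + gap [\<mu>, \<alpha>] \<nu>\<close>.
  So if all gaps vanish at \<open>m\<close>, they all vanish at \<open>\<alpha> m\<close> (\<open>gap_act\<close>). The module being generated by the
  pure tensors of the representations (\<open>DW_induct\<close>), only these have to be treated.

  There the gap is computed directly. It is biadditive, and by partial fractions every map that is
  regular along the boundary is the sum of a map with poles in \<open>D\<close> and a map that is regular on the
  closure of \<open>D\<close> (\<open>mero_maps_split\<close>). For maps of these two kinds the operators are given explicitly
  by left multiplication and by evaluations at the marked points; evaluations at different points commute,
  and those at one point reproduce the bracket (\<open>double_sum_bracket\<close>). Beyond the antisymmetry of \<open>B\<close>,
  which is integration by parts over a closed curve, this uses that \<open>B \<mu> \<nu> = 0\<close> if both maps have their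
  poles in \<open>D\<close> or if both are regular on the closure of \<open>D\<close>. The same vanishing yields the two special
  cases from the general formula.

  The vanishing is Cauchy's theorem for the two sides of the curve; in coordinates it concerns the
  integral of \<open>f dg\<close> for scalar functions \<open>f\<close>, \<open>g\<close>. If the poles lie in \<open>D\<close>, partial fractions reduce
  it to polynomials in two functions with one simple pole each, at points \<open>p\<close>, \<open>q\<close> of \<open>D\<close>. For \<open>p = q\<close> the
  form is exact, and moving \<open>p\<close> a little does not affect the vanishing, because the new function is a uniform
  limit of polynomials in the old one on the complement of \<open>D\<close>; since \<open>D\<close> is connected, the case of
  distinct points follows (\<open>loop_int_two_poles\<close>). If \<open>f\<close> and \<open>g\<close> are regular on the closure of \<open>D\<close>, the
  form has a primitive in \<open>D\<close>, because \<open>D\<close> is a disc. Curves slightly to the left of the boundary lie in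
  \<open>D\<close> (\<open>uniform_strip\<close>), so the integrals over them vanish, and these converge to the integral over
  the boundary (\<open>integral_zero\<close>).

  The target of the maps has no topology and may have infinite dimension, but every map has finite
  rank; limits and derivatives are taken in coordinates.\<close>

section \<open>Linear algebra over the complex numbers\<close>

interpretation cvs: vector_space "scaleC :: complex \<Rightarrow> 'a \<Rightarrow> 'a::complex_vector_space"
  by (rule vector_space_scaleC)

interpretation cvp: vector_space_pair
  "scaleC :: complex \<Rightarrow> 'a \<Rightarrow> 'a::complex_vector_space"
  "scaleC :: complex \<Rightarrow> 'b \<Rightarrow> 'b::complex_vector_space"
  by unfold_locales

lemma functional_add: "functional l \<Longrightarrow> l (x + y) = l x + l y"
  and functional_scale: "functional l \<Longrightarrow> l (c *\<^sub>C x) = c * l x"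
  by (auto simp: Vector_Spaces.linear_iff)

lemma functionalI:
  assumes "\<And>x y. l (x + y) = l x + l y" "\<And>c x. l (c *\<^sub>C x) = c * l x"
  shows "functional (l :: 'a::complex_vector_space \<Rightarrow> complex)"
proof -
  have "vector_space ((*) :: complex \<Rightarrow> complex \<Rightarrow> complex)"
    by unfold_locales (auto simp: algebra_simps)
  then show ?thesis
    using assms vector_space_scaleC by (auto simp: Vector_Spaces.linear_iff)
qed

lemma functional_zero: "functional l \<Longrightarrow> l 0 = 0"
  using functional_add[of l 0 0] by simp

lemma functional_sum: "functional l \<Longrightarrow> l (sum f A) = (\<Sum>a\<in>A. l (f a))"
  by (induction A rule: infinite_finite_induct) (auto simp: functional_zero functional_add)

text \<open>Coordinates in a Hamel basis. They are linear functionals, and a vector has only finitely many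
  nonzero ones.\<close>

definition coord :: "'a::complex_vector_space \<Rightarrow> 'a \<Rightarrow> complex"
  where "coord b v = cvs.representation (cvs.extend_basis {}) v b"

lemma basis_independent: "cvs.independent (cvs.extend_basis {})"
  and basis_span: "cvs.span (cvs.extend_basis {}) = UNIV"
  by (auto intro!: cvs.independent_extend_basis cvs.span_extend_basis cvs.independent_empty)

lemma functional_coord: "functional (coord b)"
  unfolding coord_def [abs_def] by (rule cvs.linear_representation[OF basis_independent basis_span])

lemma finite_coord: "finite {b. coord b v \<noteq> 0}"
  unfolding coord_def by (rule cvs.finite_representation)

lemma coord_expand:
  assumes "finite A" "{b. coord b v \<noteq> 0} \<subseteq> A"
  shows "(\<Sum>b\<in>A. coord b v *\<^sub>C b) = v"
proof -
  have "(\<Sum>b | coord b v \<noteq> 0. coord b v *\<^sub>C b) = v"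
    unfolding coord_def using basis_independent basis_span
    by (intro cvs.sum_nonzero_representation_eq) auto
  moreover have "(\<Sum>b\<in>A. coord b v *\<^sub>C b) = (\<Sum>b | coord b v \<noteq> 0. coord b v *\<^sub>C b)"
    using assms by (intro sum.mono_neutral_right) auto
  ultimately show ?thesis by simp
qed

text \<open>This makes weak limits unique.\<close>

lemma functionals_separate:
  assumes "\<And>l. functional l \<Longrightarrow> l u = l (v :: 'a::complex_vector_space)"
  shows "u = v"
proof -
  have *: "coord b u = coord b v" for b
    using assms functional_coord by blast
  have "u = (\<Sum>b | coord b u \<noteq> 0. coord b u *\<^sub>C b)"
    by (rule coord_expand[symmetric]) (auto simp: finite_coord)
  also have "\<dots> = (\<Sum>b | coord b v \<noteq> 0. coord b v *\<^sub>C b)"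
    by (simp add: *)
  also have "\<dots> = v"
    by (rule coord_expand) (auto simp: finite_coord)
  finally show ?thesis .
qed

definition finite_rank :: "('x \<Rightarrow> 'g::complex_vector_space) \<Rightarrow> bool"
  where "finite_rank X \<longleftrightarrow> (\<exists>B. finite B \<and> range X \<subseteq> cspan B)"

lemma finite_rank_support:
  assumes "finite_rank f"
  obtains A where "finite A" "\<And>p. {b. coord b (f p) \<noteq> 0} \<subseteq> A"
proof -
  obtain B where B: "finite B" "range f \<subseteq> cspan B"
    using assms by (auto simp: finite_rank_def)
  define A where "A = (\<Union>v\<in>B. {b. coord b v \<noteq> 0})"
  have "finite A"
    using B by (auto simp: A_def finite_coord)
  moreover have "{b. coord b v \<noteq> 0} \<subseteq> A" if "v \<in> cspan B" for v
    using that
  proof (induction rule: cvs.span_induct_alt)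
    case base
    then show ?case by (auto simp: functional_zero[OF functional_coord])
  next
    case (step c x y)
    then show ?case
      by (auto simp: A_def functional_add[OF functional_coord] functional_scale[OF functional_coord])
  qed
  then have "{b. coord b (f p) \<noteq> 0} \<subseteq> A" for p
    using B(2) by blast
  ultimately show ?thesis by (rule that)
qed

text \<open>With a common finite index set, a curve and its derivative can be expanded in the same vectors.\<close>

lemma finite_rank_expand2:
  assumes "finite_rank X" "finite_rank Y"
  obtains A where "finite A" "\<And>t. X t = (\<Sum>b\<in>A. coord b (X t) *\<^sub>C b)" "\<And>t. Y t = (\<Sum>b\<in>A. coord b (Y t) *\<^sub>C b)"
proof -
  obtain A1 where A1: "finite A1" "\<And>t. {b. coord b (X t) \<noteq> 0} \<subseteq> A1"
    using assms(1) by (rule finite_rank_support) blast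
  obtain A2 where A2: "finite A2" "\<And>t. {b. coord b (Y t) \<noteq> 0} \<subseteq> A2"
    using assms(2) by (rule finite_rank_support) blast
  have "finite (A1 \<union> A2)" using A1 A2 by simp
  moreover have "X t = (\<Sum>b\<in>A1 \<union> A2. coord b (X t) *\<^sub>C b)" "Y s = (\<Sum>b\<in>A1 \<union> A2. coord b (Y s) *\<^sub>C b)" for s t
    using A1(2)[of t] A2(2)[of s] \<open>finite (A1 \<union> A2)\<close> by (auto intro!: coord_expand[symmetric])
  ultimately show ?thesis by (rule that)
qed

lemma finite_rank_sum: "finite I \<Longrightarrow> finite_rank (\<lambda>t. \<Sum>i\<in>I. x i t *\<^sub>C v i)"
  unfolding finite_rank_def
  by (rule exI[of _ "v ` I"]) (auto intro!: cvs.span_sum cvs.span_scale intro: cvs.span_base)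

lemma finite_rank_add:
  assumes "finite_rank X" "finite_rank Y"
  shows "finite_rank (\<lambda>t. X t + Y t)"
proof -
  obtain A B where "finite A" "range X \<subseteq> cspan A" "finite B" "range Y \<subseteq> cspan B"
    using assms by (auto simp: finite_rank_def)
  then have "range (\<lambda>q. X q + Y q) \<subseteq> cspan (A \<union> B)" "finite (A \<union> B)"
    by (auto intro!: cvs.span_add intro: subsetD[OF cvs.span_mono])
  then show ?thesis unfolding finite_rank_def by blast
qed

text \<open>Extend a basis of the span to a basis of the whole space, and let the projection kill the
  former basis and fix the rest of the latter.\<close>

lemma ex_projection:
  fixes S :: "'a::complex_vector_space set"
  shows "\<exists>\<pi>. Vector_Spaces.linear scaleC scaleC \<pi> \<and> (\<forall>v. (\<pi> v :: 'a) = 0 \<longleftrightarrow> v \<in> cspan S)"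
proof -
  obtain B where B: "cvs.independent B" "cspan B = cspan S"
    using cvs.basis_exists[of "cspan S"] by (metis cvs.span_eq cvs.span_span subset_antisym cvs.span_minimal cvs.subspace_span)
  define E where "E = cvs.extend_basis B"
  have E: "cvs.independent E" "cspan E = UNIV" "B \<subseteq> E"
    unfolding E_def using B by (auto simp: cvs.independent_extend_basis cvs.span_extend_basis cvs.extend_basis_superset)
  obtain \<pi> :: "'a \<Rightarrow> 'a" where \<pi>: "Vector_Spaces.linear scaleC scaleC \<pi>" "\<forall>x\<in>E. \<pi> x = (if x \<in> B then 0 else x)"
    using cvp.linear_independent_extend[OF E(1), of "\<lambda>x. if x \<in> B then 0 else x"] by blast
  have add: "\<pi> (x + y) = \<pi> x + \<pi> y" and scale: "\<pi> (c *\<^sub>C x) = c *\<^sub>C \<pi> x" for x y c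
    using \<pi>(1) by (auto simp: Vector_Spaces.linear_iff)
  have zero: "\<pi> 0 = 0" using add[of 0 0] by simp
  have "\<pi> v = 0" if "v \<in> cspan B" for v
    using that
  proof (induction rule: cvs.span_induct_alt)
    case (step c x y)
    then show ?case using \<pi>(2) E(3) by (auto simp: add scale)
  qed (rule zero)
  moreover have "v - \<pi> v \<in> cspan B" for v
  proof -
    have "v \<in> cspan E" using E by simp
    then show ?thesis
    proof (induction rule: cvs.span_induct_alt)
      case base then show ?case by (simp add: zero cvs.span_zero)
    next
      case (step c x y)
      have "x - \<pi> x \<in> cspan B"
        using \<pi>(2) step by (auto simp: cvs.span_zero intro: cvs.span_base)
      then have "c *\<^sub>C (x - \<pi> x) + (y - \<pi> y) \<in> cspan B"
        using step by (intro cvs.span_add cvs.span_scale)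
      then show ?case by (simp add: add scale algebra_simps cvs.scale_right_diff_distrib)
    qed
  qed
  ultimately have "\<pi> v = 0 \<longleftrightarrow> v \<in> cspan B" for v
    by (metis diff_zero)
  with \<pi>(1) show ?thesis unfolding B(2) by blast
qed

section \<open>Quotients of free vector spaces\<close>

text \<open>A linear projection whose kernel is the span of the relations identifies the cosets with vectors of
  the free space, so that identities in the quotient become identities in an abelian group type.\<close>

definition coset_proj :: "('x \<Rightarrow>\<^sub>0 complex) set \<Rightarrow> ('x \<Rightarrow>\<^sub>0 complex) \<Rightarrow> 'x \<Rightarrow>\<^sub>0 complex"
  where "coset_proj R = (SOME \<pi>. Vector_Spaces.linear scaleC scaleC \<pi> \<and> (\<forall>v. \<pi> v = 0 \<longleftrightarrow> v \<in> cspan R))"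

definition coset_rep :: "('x \<Rightarrow>\<^sub>0 complex) set \<Rightarrow> ('x \<Rightarrow>\<^sub>0 complex) set \<Rightarrow> 'x \<Rightarrow>\<^sub>0 complex"
  where "coset_rep R A = coset_proj R (SOME a. a \<in> A)"

lemma coset_proj: "Vector_Spaces.linear scaleC scaleC (coset_proj R)"
    "coset_proj R v = 0 \<longleftrightarrow> v \<in> cspan R"
  using someI_ex[OF ex_projection[of R], folded coset_proj_def] by blast+

lemma coset_proj_add: "coset_proj R (u + v) = coset_proj R u + coset_proj R v"
  and coset_proj_scale: "coset_proj R (c *\<^sub>C u) = c *\<^sub>C coset_proj R u"
  using coset_proj(1)[of R] by (auto simp: Vector_Spaces.linear_iff)

lemma coset_proj_diff: "coset_proj R (u - v) = coset_proj R u - coset_proj R v"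
  using coset_proj_add[of R "u - v" v] by simp

lemma coset_proj_zero: "coset_proj R 0 = 0"
  using coset_proj_add[of R 0 0] by simp

lemma coset_proj_sum: "coset_proj R (sum f A) = (\<Sum>a\<in>A. coset_proj R (f a))"
  by (induction A rule: infinite_finite_induct) (auto simp: coset_proj_zero coset_proj_add)

lemma in_cls: "w \<in> cls R v \<longleftrightarrow> coset_proj R w = coset_proj R v"
  by (simp add: cls_def coset_proj(2)[symmetric] coset_proj_diff)

lemma cls_eq_iff: "cls R u = cls R v \<longleftrightarrow> coset_proj R u = coset_proj R v"
  using in_cls[of _ R u] in_cls[of _ R v] in_cls[of u R u] by auto

lemma cls_eq_iff': "cls R u = cls R v \<longleftrightarrow> u - v \<in> cspan R"
  by (simp add: cls_eq_iff coset_proj(2)[symmetric] coset_proj_diff)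

lemma coset_rep_cls: "coset_rep R (cls R v) = coset_proj R v"
proof -
  have "(SOME a. a \<in> cls R v) \<in> cls R v"
    by (rule someI[of _ v]) (simp add: in_cls)
  then show ?thesis by (simp add: coset_rep_def in_cls)
qed

lemma qadd_cls: "qadd R (cls R u) (cls R v) = cls R (u + v)"
proof -
  have *: "cls R (a + b) = cls R (u + v)" if "a \<in> cls R u" "b \<in> cls R v" for a b
    using that by (simp add: in_cls cls_eq_iff coset_proj_add)
  have "u \<in> cls R u" "v \<in> cls R v" by (simp_all add: in_cls)
  with * show ?thesis unfolding qadd_def by blast
qed

lemma qdiff_cls: "qdiff R (cls R u) (cls R v) = cls R (u - v)"
proof -
  have *: "cls R (a - b) = cls R (u - v)" if "a \<in> cls R u" "b \<in> cls R v" for a b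
    using that by (simp add: in_cls cls_eq_iff coset_proj_diff)
  have "u \<in> cls R u" "v \<in> cls R v" by (simp_all add: in_cls)
  with * show ?thesis unfolding qdiff_def by blast
qed

lemma qscale_cls: "qscale R c (cls R u) = cls R (c *\<^sub>C u)"
proof -
  have *: "cls R (c *\<^sub>C a) = cls R (c *\<^sub>C u)" if "a \<in> cls R u" for a
    using that by (simp add: in_cls cls_eq_iff coset_proj_scale)
  have "u \<in> cls R u" by (simp add: in_cls)
  with * show ?thesis unfolding qscale_def by blast
qed

lemma quot_cases:
  assumes "A \<in> quot X R"
  obtains v where "A = cls R v" "Poly_Mapping.keys v \<subseteq> X"
  using assms by (auto simp: quot_def)

lemma coset_rep_inject:
  assumes "A \<in> quot X R" "B \<in> quot X R"
  shows "coset_rep R A = coset_rep R B \<longleftrightarrow> A = B"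
  using assms by (elim quot_cases) (simp add: coset_rep_cls cls_eq_iff[symmetric])

lemma keys_scaleC: "Poly_Mapping.keys (c *\<^sub>C v) \<subseteq> Poly_Mapping.keys v"
  by (auto simp: in_keys_iff lookup_scaleC)

lemma quot_closed:
  assumes "A \<in> quot X R" "B \<in> quot X R"
  shows quot_qadd: "qadd R A B \<in> quot X R"
    and quot_qdiff: "qdiff R A B \<in> quot X R"
    and quot_qscale: "qscale R c A \<in> quot X R"
proof -
  obtain u v where uv: "A = cls R u" "Poly_Mapping.keys u \<subseteq> X" "B = cls R v" "Poly_Mapping.keys v \<subseteq> X"
    using assms by (auto elim!: quot_cases)
  have "Poly_Mapping.keys (u + v) \<subseteq> X" "Poly_Mapping.keys (u - v) \<subseteq> X" "Poly_Mapping.keys (c *\<^sub>C u) \<subseteq> X"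
    using uv Poly_Mapping.keys_add[of u v] keys_diff[of u v] keys_scaleC[of c u] by auto
  then show "qadd R A B \<in> quot X R" "qdiff R A B \<in> quot X R" "qscale R c A \<in> quot X R"
    by (auto simp: uv qadd_cls qdiff_cls qscale_cls quot_def)
qed

lemma coset_rep_simps:
  assumes "A \<in> quot X R"
  shows coset_rep_qadd: "B \<in> quot X R \<Longrightarrow> coset_rep R (qadd R A B) = coset_rep R A + coset_rep R B"
    and coset_rep_qdiff: "B \<in> quot X R \<Longrightarrow> coset_rep R (qdiff R A B) = coset_rep R A - coset_rep R B"
    and coset_rep_qscale: "coset_rep R (qscale R c A) = c *\<^sub>C coset_rep R A"
  using assms by (auto elim!: quot_cases simp: coset_rep_cls qadd_cls qdiff_cls qscale_cls
      coset_proj_add coset_proj_diff coset_proj_scale)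

lemma cls_gen_in_quot: "x \<in> X \<Longrightarrow> cls R (gen x) \<in> quot X R"
  by (auto simp: quot_def gen_def intro!: exI[of _ "Poly_Mapping.single x 1"])

lemma cls_zero_in_quot: "cls R 0 \<in> quot X R"
  by (auto simp: quot_def intro!: exI[of _ 0])

lemma lin_ext_superset:
  assumes "finite A" "Poly_Mapping.keys v \<subseteq> A"
  shows "lin_ext f v = (\<Sum>x\<in>A. Poly_Mapping.lookup v x *\<^sub>C f x)"
  unfolding lin_ext_def using assms
  by (intro sum.mono_neutral_left) (auto simp: in_keys_iff)

lemma lin_ext_add: "lin_ext f (u + v) = lin_ext f u + lin_ext f v"
proof -
  define A where "A = Poly_Mapping.keys u \<union> Poly_Mapping.keys v"
  have "finite A" "Poly_Mapping.keys u \<subseteq> A" "Poly_Mapping.keys v \<subseteq> A" "Poly_Mapping.keys (u + v) \<subseteq> A"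
    using Poly_Mapping.keys_add[of u v] by (auto simp: A_def)
  then show ?thesis
    by (simp add: lin_ext_superset[of A] lookup_add cvs.scale_left_distrib sum.distrib)
qed

lemma lin_ext_scale: "lin_ext f (c *\<^sub>C v) = c *\<^sub>C lin_ext f v"
  using keys_scaleC[of c v]
  by (subst (1 2) lin_ext_superset[of "Poly_Mapping.keys v"])
     (auto simp: lookup_scaleC cvs.scale_sum_right)

lemma lin_ext_zero: "lin_ext f 0 = 0"
  by (simp add: lin_ext_def)

lemma lin_ext_diff: "lin_ext f (u - v) = lin_ext f u - lin_ext f v"
  using lin_ext_add[of f "u - v" v] by simp

lemma lin_ext_gen: "lin_ext f (gen x) = f x"
  by (simp add: lin_ext_def gen_def)

lemma lin_ext_gen_id: "lin_ext gen v = v"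
proof (rule poly_mapping_eqI)
  fix x
  have "Poly_Mapping.lookup (lin_ext gen v) x
      = (\<Sum>y\<in>Poly_Mapping.keys v. Poly_Mapping.lookup v y * (if y = x then 1 else 0))"
    by (auto simp: lin_ext_def lookup_sum lookup_scaleC gen_def lookup_single when_def intro!: sum.cong)
  also have "\<dots> = Poly_Mapping.lookup v x"
    by (simp add: if_distrib[of "(*) _"] sum.delta in_keys_iff cong: if_cong)
  finally show "Poly_Mapping.lookup (lin_ext gen v) x = Poly_Mapping.lookup v x" .
qed

lemma lin_ext_span:
  assumes "\<And>r. r \<in> R \<Longrightarrow> lin_ext f r \<in> cspan S" "v \<in> cspan R"
  shows "lin_ext f v \<in> cspan S"
  using assms(2)
  by (induction rule: cvs.span_induct_alt)
     (auto simp: lin_ext_zero lin_ext_add lin_ext_scale intro!: cvs.span_zero cvs.span_add cvs.span_scale assms(1))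

text \<open>The lift maps relations to relations, so the cosets that \<open>qmap\<close> unites are all the same.\<close>

lemma qmap_cls:
  assumes "\<And>r. r \<in> R \<Longrightarrow> lin_ext f r \<in> cspan R"
  shows "qmap R f (cls R v) = cls R (lin_ext f v)"
proof -
  have *: "cls R (lin_ext f a) = cls R (lin_ext f v)" if "a \<in> cls R v" for a
    using lin_ext_span[of R f R "a - v"] assms that
    by (simp add: cls_eq_iff' lin_ext_diff cls_def[of R v])
  have "v \<in> cls R v" by (simp add: in_cls)
  with * show ?thesis unfolding qmap_def by blast
qed

lemma quot_induct [consumes 1, case_names zero gen add scale]:
  assumes "A \<in> quot X R"
    and zero: "P (cls R 0)"
    and gen: "\<And>x. x \<in> X \<Longrightarrow> P (cls R (gen x))"
    and add: "\<And>A B. A \<in> quot X R \<Longrightarrow> B \<in> quot X R \<Longrightarrow> P A \<Longrightarrow> P B \<Longrightarrow> P (qadd R A B)"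
    and scale: "\<And>c A. A \<in> quot X R \<Longrightarrow> P A \<Longrightarrow> P (qscale R c A)"
  shows "P A"
proof -
  obtain v where v: "A = cls R v" "Poly_Mapping.keys v \<subseteq> X"
    using assms(1) by (rule quot_cases)
  have "cls R (\<Sum>x\<in>K. Poly_Mapping.lookup v x *\<^sub>C gen x) \<in> quot X R
      \<and> P (cls R (\<Sum>x\<in>K. Poly_Mapping.lookup v x *\<^sub>C gen x))"
    if "finite K" "K \<subseteq> X" for K
    using that
  proof (induction K)
    case empty
    then show ?case using zero by (simp add: cls_zero_in_quot)
  next
    case (insert x K)
    have x: "qscale R (Poly_Mapping.lookup v x) (cls R (gen x)) \<in> quot X R"
      "P (qscale R (Poly_Mapping.lookup v x) (cls R (gen x)))"
      using insert cls_gen_in_quot[of x X R] scale gen quot_qscale by (auto intro: quot_qscale)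
    then show ?case
      using insert add[OF x(1) _ x(2), of "cls R (\<Sum>x\<in>K. Poly_Mapping.lookup v x *\<^sub>C gen x)"]
        quot_qadd[OF x(1), of "cls R (\<Sum>x\<in>K. Poly_Mapping.lookup v x *\<^sub>C gen x)"]
      by (simp add: qscale_cls qadd_cls)
  qed
  from this[OF finite_keys v(2)] show ?thesis
    using lin_ext_gen_id[of v] by (simp add: v lin_ext_def)
qed

section \<open>The induced module and its generators\<close>

lemma lin_ext_sum: "lin_ext f (sum h A) = (\<Sum>a\<in>A. lin_ext f (h a))"
  by (induction A rule: infinite_finite_induct) (auto simp: lin_ext_zero lin_ext_add)

lemma lin_ext_comp: "lin_ext f (lin_ext g v) = lin_ext (\<lambda>x. lin_ext f (g x)) v"
  unfolding lin_ext_def[of g] lin_ext_def[of "\<lambda>x. lin_ext f (g x)"]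
  by (simp add: lin_ext_sum lin_ext_scale)

lemma keys_sum_subset:
  "(\<And>a. a \<in> A \<Longrightarrow> Poly_Mapping.keys (h a) \<subseteq> X) \<Longrightarrow> Poly_Mapping.keys (sum h A) \<subseteq> X"
proof (induction A rule: infinite_finite_induct)
  case (insert a A)
  then show ?case using Poly_Mapping.keys_add[of "h a" "sum h A"] by auto
qed auto

lemma keys_lin_ext:
  assumes "\<And>x. x \<in> Poly_Mapping.keys v \<Longrightarrow> Poly_Mapping.keys (f x) \<subseteq> X"
  shows "Poly_Mapping.keys (lin_ext f v) \<subseteq> X"
  unfolding lin_ext_def by (intro keys_sum_subset order_trans[OF keys_scaleC] assms)

lemma qmap_linear:
  assumes rel: "\<And>r. r \<in> R \<Longrightarrow> lin_ext f r \<in> cspan R"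
    and gens: "\<And>x. x \<in> X \<Longrightarrow> Poly_Mapping.keys (f x) \<subseteq> X"
    and A: "A \<in> quot X R"
  shows qmap_closed: "qmap R f A \<in> quot X R"
    and qmap_qadd: "B \<in> quot X R \<Longrightarrow> qmap R f (qadd R A B) = qadd R (qmap R f A) (qmap R f B)"
    and qmap_qscale: "qmap R f (qscale R c A) = qscale R c (qmap R f A)"
proof -
  obtain u where u: "A = cls R u" "Poly_Mapping.keys u \<subseteq> X"
    using A by (rule quot_cases)
  have "Poly_Mapping.keys (lin_ext f u) \<subseteq> X"
    using u gens by (intro keys_lin_ext) auto
  then show "qmap R f A \<in> quot X R"
    using u by (auto simp: qmap_cls[OF rel] quot_def)
  show "B \<in> quot X R \<Longrightarrow> qmap R f (qadd R A B) = qadd R (qmap R f A) (qmap R f B)"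
    by (auto elim!: quot_cases simp: u qadd_cls qmap_cls[OF rel] lin_ext_add)
  show "qmap R f (qscale R c A) = qscale R c (qmap R f A)"
    by (simp add: u qscale_cls qmap_cls[OF rel] lin_ext_scale)
qed

lemma keys_gen: "Poly_Mapping.keys (gen x) = {x}"
  by (simp add: gen_def)

text \<open>The relations of the enveloping algebra have arbitrary words around the place where the relation acts,
  so multiplication by further words gives relations of the same kind.\<close>

lemma uea_rel_context:
  assumes "x \<in> lists L" "y \<in> lists L" "r \<in> uea_rel L"
  shows "lin_ext (\<lambda>u. gen (x @ u @ y)) r \<in> cspan (uea_rel L)"
proof (rule cvs.span_base)
  have app: "x @ u \<in> lists L" "u @ y \<in> lists L" if "u \<in> lists L" for u
    using that assms(1,2) by auto
  consider (add) u v a b where "r = gen (u @ [madd a b] @ v) - gen (u @ [a] @ v) - gen (u @ [b] @ v)"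
      "u \<in> lists L" "v \<in> lists L" "a \<in> L" "b \<in> L"
    | (scale) u v c a where "r = gen (u @ [mscale c a] @ v) - c *\<^sub>C gen (u @ [a] @ v)"
      "u \<in> lists L" "v \<in> lists L" "a \<in> L"
    | (lie) u v a b where "r = gen (u @ [a, b] @ v) - gen (u @ [b, a] @ v) - gen (u @ [mlie a b] @ v)"
      "u \<in> lists L" "v \<in> lists L" "a \<in> L" "b \<in> L"
    using assms(3) unfolding uea_rel_def by blast
  then show "lin_ext (\<lambda>u. gen (x @ u @ y)) r \<in> uea_rel L"
  proof cases
    case add
    have "lin_ext (\<lambda>u. gen (x @ u @ y)) r = gen ((x @ u) @ [madd a b] @ (v @ y))
        - gen ((x @ u) @ [a] @ (v @ y)) - gen ((x @ u) @ [b] @ (v @ y))"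
      by (simp add: add lin_ext_diff lin_ext_gen)
    then show ?thesis using add app unfolding uea_rel_def by blast
  next
    case scale
    have "lin_ext (\<lambda>u. gen (x @ u @ y)) r
        = gen ((x @ u) @ [mscale c a] @ (v @ y)) - c *\<^sub>C gen ((x @ u) @ [a] @ (v @ y))"
      by (simp add: scale lin_ext_diff lin_ext_gen lin_ext_scale)
    then show ?thesis using scale app unfolding uea_rel_def by blast
  next
    case lie
    have "lin_ext (\<lambda>u. gen (x @ u @ y)) r = gen ((x @ u) @ [a, b] @ (v @ y))
        - gen ((x @ u) @ [b, a] @ (v @ y)) - gen ((x @ u) @ [mlie a b] @ (v @ y))"
      by (simp add: lie lin_ext_diff lin_ext_gen)
    then show ?thesis using lie app unfolding uea_rel_def by blast
  qed
qed

lemma uea_rel_left: "\<alpha> \<in> L \<Longrightarrow> r \<in> uea_rel L \<Longrightarrow> lin_ext (\<lambda>u. gen (\<alpha> # u)) r \<in> cspan (uea_rel L)"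
  and uea_rel_right: "\<alpha> \<in> L \<Longrightarrow> r \<in> uea_rel L \<Longrightarrow> lin_ext (\<lambda>u. gen (u @ [\<alpha>])) r \<in> cspan (uea_rel L)"
  using uea_rel_context[of "[\<alpha>]" L "[]" r] uea_rel_context[of "[]" L "[\<alpha>]" r] by simp_all

lemma uleft_cls: "\<alpha> \<in> L \<Longrightarrow> uleft L \<alpha> (cls (uea_rel L) v) = cls (uea_rel L) (lin_ext (\<lambda>u. gen (\<alpha> # u)) v)"
  unfolding uleft_def by (intro qmap_cls uea_rel_left)

lemma uleft_linear:
  assumes "\<alpha> \<in> L" "a \<in> uea L"
  shows uleft_closed: "uleft L \<alpha> a \<in> uea L"
    and uleft_qadd: "b \<in> uea L \<Longrightarrow> uleft L \<alpha> (qadd (uea_rel L) a b) = qadd (uea_rel L) (uleft L \<alpha> a) (uleft L \<alpha> b)"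
    and uleft_qscale: "uleft L \<alpha> (qscale (uea_rel L) c a) = qscale (uea_rel L) c (uleft L \<alpha> a)"
proof -
  have gens: "Poly_Mapping.keys (gen (\<alpha> # u)) \<subseteq> lists L" if "u \<in> lists L" for u
    using that assms(1) by (simp add: keys_gen)
  note lin = qmap_linear[OF uea_rel_left[OF assms(1)] gens assms(2)[unfolded uea_def], folded uleft_def uea_def]
  show "uleft L \<alpha> a \<in> uea L"
    and "b \<in> uea L \<Longrightarrow> uleft L \<alpha> (qadd (uea_rel L) a b) = qadd (uea_rel L) (uleft L \<alpha> a) (uleft L \<alpha> b)"
    and "uleft L \<alpha> (qscale (uea_rel L) c a) = qscale (uea_rel L) c (uleft L \<alpha> a)"
    using lin by blast+
qed

lemma uleft_uword: "\<alpha> \<in> L \<Longrightarrow> uleft L \<alpha> (uword L u) = uword L (\<alpha> # u)"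
  by (simp add: uword_def uleft_cls lin_ext_gen)

text \<open>It is for this reason that left multiplication descends to the tensor product over the constants.\<close>

lemma uleft_uright:
  assumes "\<alpha> \<in> L" "\<beta> \<in> L" "a \<in> uea L"
  shows "uleft L \<alpha> (uright L \<beta> a) = uright L \<beta> (uleft L \<alpha> a)"
proof -
  obtain v where v: "a = cls (uea_rel L) v"
    using assms(3) unfolding uea_def by (rule quot_cases)
  have "uright L \<beta> (cls (uea_rel L) v) = cls (uea_rel L) (lin_ext (\<lambda>u. gen (u @ [\<beta>])) v)" for v
    unfolding uright_def by (intro qmap_cls uea_rel_right assms(2))
  then show ?thesis
    by (simp add: v uleft_cls[OF assms(1)] lin_ext_comp lin_ext_gen)
qed

lemma const_regular_on: "(\<lambda>_. x) \<in> maps_regular_on S"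
proof -
  have "regular_at (\<lambda>_. x) p" for p
    by (simp add: regular_at_def o_def)
  moreover have "range (\<lambda>_. x) \<subseteq> cspan {x}"
    by (auto intro: cvs.span_base)
  ultimately show ?thesis
    by (auto simp: maps_regular_on_def mero_maps_def o_def intro!: exI[of _ "{x}"])
qed

lemma DW_rel_cases:
  assumes "r \<in> DW_rel D n W \<rho>"
  defines "L \<equiv> maps_poles_in D"
  obtains
    (addl) a b t where "r = gen (qadd (uea_rel L) a b, t) - gen (a, t) - gen (b, t)"
      "a \<in> uea L" "b \<in> uea L" "t \<in> tensor n W"
  | (scalel) c a t where "r = gen (qscale (uea_rel L) c a, t) - c *\<^sub>C gen (a, t)"
      "a \<in> uea L" "t \<in> tensor n W"
  | (addr) a s t where "r = gen (a, qadd (tensor_rel n W) s t) - gen (a, s) - gen (a, t)"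
      "a \<in> uea L" "s \<in> tensor n W" "t \<in> tensor n W"
  | (scaler) c a t where "r = gen (a, qscale (tensor_rel n W) c t) - c *\<^sub>C gen (a, t)"
      "a \<in> uea L" "t \<in> tensor n W"
  | (middle) x a t where "r = gen (uright L (\<lambda>_. x) a, t) - gen (a, tensor_act n W \<rho> x t)"
      "a \<in> uea L" "t \<in> tensor n W"
  using assms(1) unfolding DW_rel_def Let_def L_def[symmetric] by blast

lemma DW_relI:
  fixes D :: "cproj set" and \<rho> :: "nat \<Rightarrow> 'g::complex_lie_algebra \<Rightarrow> 'w::complex_vector_space \<Rightarrow> 'w"
  defines "L \<equiv> maps_poles_in D :: (cproj \<Rightarrow> 'g) set"
  assumes "a \<in> uea L" "t \<in> tensor n W"
  shows "b \<in> uea L \<Longrightarrow> gen (qadd (uea_rel L) a b, t) - gen (a, t) - gen (b, t) \<in> DW_rel D n W \<rho>"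
    and "gen (qscale (uea_rel L) c a, t) - c *\<^sub>C gen (a, t) \<in> DW_rel D n W \<rho>"
    and "s \<in> tensor n W \<Longrightarrow> gen (a, qadd (tensor_rel n W) s t) - gen (a, s) - gen (a, t) \<in> DW_rel D n W \<rho>"
    and "gen (a, qscale (tensor_rel n W) c t) - c *\<^sub>C gen (a, t) \<in> DW_rel D n W \<rho>"
    and "gen (uright L (\<lambda>_. x) a, t) - gen (a, tensor_act n W \<rho> x t) \<in> DW_rel D n W \<rho>"
  using assms(2,3) unfolding DW_rel_def Let_def L_def[symmetric] by blast+

text \<open>Left multiplication is linear and commutes with right multiplication by constants; so each of the five
  families of relations is mapped to itself.\<close>

lemma DW_rel_act:
  assumes "\<alpha> \<in> maps_poles_in D" "r \<in> DW_rel D n W \<rho>"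
  shows "lin_ext (\<lambda>(a, t). gen (uleft (maps_poles_in D) \<alpha> a, t)) r \<in> cspan (DW_rel D n W \<rho>)"
  using assms(2)
proof (cases r rule: DW_rel_cases, goal_cases)
  case (1 a b t)
  then show ?case
    by (auto simp: lin_ext_diff lin_ext_gen uleft_qadd[OF assms(1)]
        intro!: cvs.span_base DW_relI uleft_closed[OF assms(1)])
next
  case (2 c a t)
  then show ?case
    by (auto simp: lin_ext_diff lin_ext_scale lin_ext_gen uleft_qscale[OF assms(1)]
        intro!: cvs.span_base DW_relI uleft_closed[OF assms(1)])
next
  case (3 a s t)
  then show ?case
    by (auto simp: lin_ext_diff lin_ext_gen intro!: cvs.span_base DW_relI uleft_closed[OF assms(1)])
next
  case (4 c a t)
  then show ?case
    by (auto simp: lin_ext_diff lin_ext_scale lin_ext_gen intro!: cvs.span_base DW_relI uleft_closed[OF assms(1)])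
next
  case (5 x a t)
  then show ?case
    by (auto simp: lin_ext_diff lin_ext_gen uleft_uright[OF assms(1) const_regular_on]
        intro!: cvs.span_base DW_relI uleft_closed[OF assms(1)])
qed

lemma DW_act_linear:
  assumes "\<alpha> \<in> maps_poles_in D" "m \<in> DW D n W \<rho>"
  shows DW_act_closed: "DW_act D n W \<rho> \<alpha> m \<in> DW D n W \<rho>"
    and DW_act_qadd: "m' \<in> DW D n W \<rho> \<Longrightarrow> DW_act D n W \<rho> \<alpha> (qadd (DW_rel D n W \<rho>) m m')
          = qadd (DW_rel D n W \<rho>) (DW_act D n W \<rho> \<alpha> m) (DW_act D n W \<rho> \<alpha> m')"
    and DW_act_qscale: "DW_act D n W \<rho> \<alpha> (qscale (DW_rel D n W \<rho>) c m)
          = qscale (DW_rel D n W \<rho>) c (DW_act D n W \<rho> \<alpha> m)"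
proof -
  have gens: "Poly_Mapping.keys ((\<lambda>(a, t). gen (uleft (maps_poles_in D) \<alpha> a, t)) x)
      \<subseteq> uea (maps_poles_in D) \<times> tensor n W" if "x \<in> uea (maps_poles_in D) \<times> tensor n W" for x
    using that by (auto simp: keys_gen uleft_closed[OF assms(1)])
  note lin = qmap_linear[OF DW_rel_act[OF assms(1)] gens assms(2)[unfolded DW_def], folded DW_act_def DW_def]
  show "DW_act D n W \<rho> \<alpha> m \<in> DW D n W \<rho>"
    and "m' \<in> DW D n W \<rho> \<Longrightarrow> DW_act D n W \<rho> \<alpha> (qadd (DW_rel D n W \<rho>) m m')
          = qadd (DW_rel D n W \<rho>) (DW_act D n W \<rho> \<alpha> m) (DW_act D n W \<rho> \<alpha> m')"
    and "DW_act D n W \<rho> \<alpha> (qscale (DW_rel D n W \<rho>) c m)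
          = qscale (DW_rel D n W \<rho>) c (DW_act D n W \<rho> \<alpha> m)"
    using lin by blast+
qed

lemma DW_act_gen:
  assumes "\<alpha> \<in> maps_poles_in D"
  shows "DW_act D n W \<rho> \<alpha> (cls (DW_rel D n W \<rho>) (gen (uword (maps_poles_in D) u, t)))
    = cls (DW_rel D n W \<rho>) (gen (uword (maps_poles_in D) (\<alpha> # u), t))"
  unfolding DW_act_def
  by (subst qmap_cls[OF DW_rel_act[OF assms]]) (simp_all add: lin_ext_gen uleft_uword[OF assms])

lemma uword_in_uea: "u \<in> lists L \<Longrightarrow> uword L u \<in> uea L"
  by (simp add: uword_def uea_def cls_gen_in_quot)

lemma pure_in_tensor: "w \<in> tuples n W \<Longrightarrow> pure n W w \<in> tensor n W"
  by (simp add: pure_def tensor_def cls_gen_in_quot)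

definition DW_pure :: "cproj set \<Rightarrow> nat \<Rightarrow> (nat \<Rightarrow> 'w::complex_vector_space set)
    \<Rightarrow> (nat \<Rightarrow> 'g::complex_lie_algebra \<Rightarrow> 'w \<Rightarrow> 'w) \<Rightarrow> (nat \<Rightarrow> 'w) \<Rightarrow> ('g uel \<times> 'w tel \<Rightarrow>\<^sub>0 complex) set"
  where "DW_pure D n W \<rho> w = cls (DW_rel D n W \<rho>) (gen (uword (maps_poles_in D) [], pure n W w))"

lemma DW_pure_closed: "w \<in> tuples n W \<Longrightarrow> DW_pure D n W \<rho> w \<in> DW D n W \<rho>"
  by (auto simp: DW_pure_def DW_def intro!: cls_gen_in_quot uword_in_uea pure_in_tensor)

text \<open>Both entries of a generator are classes themselves. Expanding the second into pure tensors and the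
  first into words leaves words applied to pure tensors, and a word is its first letter acting on the rest.\<close>

lemma DW_induct [consumes 1, case_names zero pure act add scale]:
  fixes \<rho> :: "nat \<Rightarrow> 'g::complex_lie_algebra \<Rightarrow> 'w::complex_vector_space \<Rightarrow> 'w"
  assumes "m \<in> DW D n W \<rho>"
  defines "R \<equiv> DW_rel D n W \<rho>"
  assumes zero: "P (cls R 0)"
    and pure: "\<And>w. w \<in> tuples n W \<Longrightarrow> P (DW_pure D n W \<rho> w)"
    and act: "\<And>\<alpha> m. \<alpha> \<in> maps_poles_in D \<Longrightarrow> m \<in> DW D n W \<rho> \<Longrightarrow> P m \<Longrightarrow> P (DW_act D n W \<rho> \<alpha> m)"
    and add: "\<And>m m'. m \<in> DW D n W \<rho> \<Longrightarrow> m' \<in> DW D n W \<rho> \<Longrightarrow> P m \<Longrightarrow> P m' \<Longrightarrow> P (qadd R m m')"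
    and scale: "\<And>c m. m \<in> DW D n W \<rho> \<Longrightarrow> P m \<Longrightarrow> P (qscale R c m)"
  shows "P m"
proof -
  let ?L = "maps_poles_in D :: (cproj \<Rightarrow> 'g) set"
  have mem: "cls R (gen (a, t)) \<in> DW D n W \<rho>" if "a \<in> uea ?L" "t \<in> tensor n W" for a t
    using that by (auto simp: R_def DW_def intro!: cls_gen_in_quot)
  have eqs: "b \<in> uea ?L \<Longrightarrow> cls R (gen (qadd (uea_rel ?L) a b, t)) = qadd R (cls R (gen (a, t))) (cls R (gen (b, t)))"
    "cls R (gen (qscale (uea_rel ?L) c a, t)) = qscale R c (cls R (gen (a, t)))"
    "s \<in> tensor n W \<Longrightarrow> cls R (gen (a, qadd (tensor_rel n W) s t)) = qadd R (cls R (gen (a, s))) (cls R (gen (a, t)))"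
    "cls R (gen (a, qscale (tensor_rel n W) c t)) = qscale R c (cls R (gen (a, t)))"
    if "a \<in> uea ?L" "t \<in> tensor n W" for a b s t c
    using DW_relI[OF that, where \<rho> = \<rho>, folded R_def]
    by (auto simp: qadd_cls qscale_cls cls_eq_iff' diff_diff_eq intro: cvs.span_base)
  have zeros: "cls R (gen (cls (uea_rel ?L) 0, t)) = cls R 0" "cls R (gen (a, cls (tensor_rel n W) 0)) = cls R 0"
    if "a \<in> uea ?L" "t \<in> tensor n W" for a t
  proof -
    have "cls (uea_rel ?L) 0 \<in> uea ?L" "cls (tensor_rel n W) 0 \<in> tensor n W"
      by (auto simp: uea_def tensor_def cls_zero_in_quot)
    from eqs(2)[OF this(1) that(2), of 0] eqs(4)[OF that(1) this(2), of 0]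
    show "cls R (gen (cls (uea_rel ?L) 0, t)) = cls R 0" "cls R (gen (a, cls (tensor_rel n W) 0)) = cls R 0"
      by (simp_all add: qscale_cls)
  qed
  have words: "P (cls R (gen (uword ?L u, pure n W w)))" if "u \<in> lists ?L" "w \<in> tuples n W" for u w
    using that(1)
  proof (induction u)
    case Nil
    then show ?case using pure[OF that(2)] by (simp add: DW_pure_def R_def)
  next
    case (Cons \<alpha> u)
    then have "P (DW_act D n W \<rho> \<alpha> (cls R (gen (uword ?L u, pure n W w))))"
      by (intro act mem uword_in_uea pure_in_tensor that) auto
    then show ?case using Cons by (simp add: R_def DW_act_gen)
  qed
  have tens: "P (cls R (gen (uword ?L u, t)))" if "u \<in> lists ?L" "t \<in> tensor n W" for u t
    using that(2) unfolding tensor_def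
  proof (induction rule: quot_induct)
    case zero
    then show ?case using zeros(2)[OF uword_in_uea[OF that(1)] that(2)] assms(3) by simp
  next
    case (gen w)
    then show ?case using words[OF that(1), of w] by (simp add: pure_def)
  next
    case (add s t)
    then show ?case
      using eqs(3)[OF uword_in_uea[OF that(1)], of t s] mem uword_in_uea[OF that(1)] assms(6)
      by (simp add: tensor_def)
  next
    case (scale c t)
    then show ?case
      using eqs(4)[OF uword_in_uea[OF that(1)], of t c] mem uword_in_uea[OF that(1)] assms(7)
      by (simp add: tensor_def)
  qed
  have gens: "P (cls R (gen (a, t)))" if "a \<in> uea ?L" "t \<in> tensor n W" for a t
    using that(1) unfolding uea_def
  proof (induction rule: quot_induct)
    case zero
    then show ?case using zeros(1)[OF that] assms(3) by simp
  next
    case (gen u)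
    then show ?case using tens[OF _ that(2), of u] by (simp add: uword_def)
  next
    case (add a b)
    then show ?case
      using eqs(1)[OF _ that(2), of a b] mem[OF _ that(2)] assms(6) by (simp add: uea_def)
  next
    case (scale c a)
    then show ?case
      using eqs(2)[OF _ that(2), of a c] mem[OF _ that(2)] assms(7) by (simp add: uea_def)
  qed
  show ?thesis
    using assms(1) unfolding DW_def R_def[symmetric]
  proof (induction rule: quot_induct)
    case zero
    then show ?case by (rule assms(3))
  next
    case (gen x)
    then show ?case using gens by (cases x) auto
  next
    case (add m m')
    then show ?case using assms(6) by (simp add: DW_def R_def)
  next
    case (scale c m)
    then show ?case using assms(7) by (simp add: DW_def R_def)
  qed
qed

lemma DW_pure_add:
  assumes "w \<in> tuples n W" "k < n" "csubspace (W k)" "a \<in> W k" "b \<in> W k"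
  shows "DW_pure D n W \<rho> (w(k := a + b))
    = qadd (DW_rel D n W \<rho>) (DW_pure D n W \<rho> (w(k := a))) (DW_pure D n W \<rho> (w(k := b)))"
proof -
  have tup: "w(k := c) \<in> tuples n W" if "c \<in> W k" for c
    using assms(1,2) that by (auto simp: tuples_def PiE_iff extensional_def)
  have "gen (w(k := a + b)) - gen (w(k := a)) - gen (w(k := b)) \<in> tensor_rel n W"
    using assms unfolding tensor_rel_def by blast
  then have "pure n W (w(k := a + b)) = qadd (tensor_rel n W) (pure n W (w(k := a))) (pure n W (w(k := b)))"
    by (simp add: pure_def qadd_cls cls_eq_iff' diff_diff_eq cvs.span_base)
  moreover have "gen (uword (maps_poles_in D) [], qadd (tensor_rel n W) (pure n W (w(k := a))) (pure n W (w(k := b))))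
      - gen (uword (maps_poles_in D) [], pure n W (w(k := a)))
      - gen (uword (maps_poles_in D) [], pure n W (w(k := b))) \<in> DW_rel D n W \<rho>"
    using assms by (intro DW_relI pure_in_tensor uword_in_uea tup) auto
  ultimately show ?thesis
    by (simp add: DW_pure_def qadd_cls cls_eq_iff' diff_diff_eq cvs.span_base)
qed

section \<open>Charts of the projective line\<close>

lemma inf_chart_eq_Fin: "inf_chart w = Fin z \<longleftrightarrow> w \<noteq> 0 \<and> z = inverse w"
  by (auto simp: inf_chart_def)

lemma inj_chart: "c \<in> charts \<Longrightarrow> inj c"
  by (auto simp: charts_def inj_def inf_chart_def split: if_splits)

lemma chart_inject: "c \<in> charts \<Longrightarrow> c u = c v \<longleftrightarrow> u = v"
  using inj_chart by (auto simp: inj_def)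

lemma vimage_chart_singleton: "c \<in> charts \<Longrightarrow> c -` {c u} = {u}"
  by (auto simp: chart_inject)

lemma chart_cover: obtains c u where "c \<in> charts" "p = c u"
proof (cases p)
  case (Fin z)
  then show ?thesis using that[of Fin z] by (simp add: charts_def)
next
  case Infty
  then show ?thesis using that[of inf_chart 0] by (simp add: charts_def inf_chart_def)
qed

lemma open_vimage_chart: "c \<in> charts \<Longrightarrow> open S \<Longrightarrow> open (c -` S)"
  by (simp add: open_cproj_def)

lemma open_image_chart:
  assumes "c \<in> charts" "open S"
  shows "open (c ` S)"
  unfolding open_cproj_def
proof
  fix c' assume "c' \<in> charts"
  have *: "open ({w. w \<noteq> 0} \<inter> inverse -` S :: complex set)"
    by (intro continuous_open_preimage continuous_intros assms) (auto simp: open_Collect_neq)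
  have "Fin -` inf_chart ` S = {w. w \<noteq> 0} \<inter> inverse -` S"
    by (auto simp: image_iff eq_commute[of "Fin _"] inf_chart_eq_Fin intro!: bexI[of _ "inverse _"])
  moreover have "inf_chart -` Fin ` S = {w. w \<noteq> 0} \<inter> inverse -` S"
    by (auto simp: inf_chart_eq_Fin image_iff)
  ultimately show "open (c' -` c ` S)"
    using * assms \<open>c' \<in> charts\<close> inj_chart[OF assms(1)]
    by (auto simp: charts_def inj_vimage_image_eq)
qed

text \<open>Charts are open embeddings, so limits may be computed in them.\<close>

lemma filtermap_nhds_chart:
  assumes "c \<in> charts"
  shows "filtermap c (nhds u) = nhds (c u)"
proof (rule filter_eqI)
  fix P
  show "eventually P (filtermap c (nhds u)) = eventually P (nhds (c u))"
  proof
    assume "eventually P (filtermap c (nhds u))"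
    then obtain S where "open S" "u \<in> S" "\<forall>x\<in>S. P (c x)"
      by (auto simp: eventually_filtermap eventually_nhds)
    then show "eventually P (nhds (c u))"
      using open_image_chart[OF assms, of S] by (auto simp: eventually_nhds intro!: exI[of _ "c ` S"])
  next
    assume "eventually P (nhds (c u))"
    then obtain S where "open S" "c u \<in> S" "\<forall>x\<in>S. P x"
      by (auto simp: eventually_nhds)
    then show "eventually P (filtermap c (nhds u))"
      using open_vimage_chart[OF assms, of S]
      by (auto simp: eventually_filtermap eventually_nhds intro!: exI[of _ "c -` S"])
  qed
qed

lemma eventually_nhds_chart: "c \<in> charts \<Longrightarrow> eventually P (nhds (c u)) \<longleftrightarrow> eventually (\<lambda>v. P (c v)) (nhds u)"
  by (simp add: filtermap_nhds_chart[symmetric] eventually_filtermap)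

lemma eventually_at_chart: "c \<in> charts \<Longrightarrow> eventually P (at (c u)) \<longleftrightarrow> eventually (\<lambda>v. P (c v)) (at u)"
  by (simp add: eventually_at_filter eventually_nhds_chart chart_inject)

lemma filtermap_at_chart: "c \<in> charts \<Longrightarrow> filtermap c (at u) = at (c u)"
  by (simp add: filter_eq_iff eventually_filtermap eventually_at_chart)

lemma tendsto_at_chart: "c \<in> charts \<Longrightarrow> (f \<longlongrightarrow> l) (at (c u)) \<longleftrightarrow> ((f \<circ> c) \<longlongrightarrow> l) (at u)"
  by (simp add: filtermap_at_chart[symmetric] filterlim_filtermap o_def)

lemma cproj_at_neq_bot: "at (p :: cproj) \<noteq> bot"
proof -
  obtain c u where "c \<in> charts" "p = c u" by (rule chart_cover)
  moreover have "at u \<noteq> bot" by simp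
  ultimately show ?thesis by (simp add: trivial_limit_def eventually_at_chart del: trivial_limit_at)
qed

text \<open>Transition maps are the identity and the inversion.\<close>

lemma chart_transition:
  assumes "c \<in> charts" "c' \<in> charts" "c u = c' u'"
  obtains h where "h analytic_on {u}" "h u = u'" "\<forall>\<^sub>F v in nhds u. c v = c' (h v)"
proof (cases "c = c'")
  case True
  then show ?thesis
    using assms that[of "\<lambda>v. v"] by (auto simp: chart_inject)
next
  case False
  then have u: "u \<noteq> 0" "u' = inverse u"
    using assms by (auto simp: charts_def inf_chart_eq_Fin eq_commute[of "Fin _"])
  have ev: "c v = c' (inverse v)" if "v \<noteq> 0" for v
    using assms False that by (auto simp: charts_def inf_chart_def)
  have "\<forall>\<^sub>F v in nhds u. v \<noteq> 0"
    using u by (intro t1_space_nhds) auto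
  then have "\<forall>\<^sub>F v in nhds u. c v = c' (inverse v)"
    by eventually_elim (rule ev)
  moreover have "inverse analytic_on {u}"
    using u by (auto intro!: analytic_intros)
  ultimately show ?thesis using that[of inverse] u by simp
qed

section \<open>Holomorphic and meromorphic functions on the projective line\<close>

definition holo_at :: "(cproj \<Rightarrow> complex) \<Rightarrow> cproj \<Rightarrow> bool"
  where "holo_at f p \<longleftrightarrow> (\<forall>c\<in>charts. (f \<circ> c) analytic_on (c -` {p}))"

definition mero :: "(cproj \<Rightarrow> complex) \<Rightarrow> bool"
  where "mero f \<longleftrightarrow> (\<forall>c\<in>charts. (f \<circ> c) meromorphic_on UNIV)"

lemma holo_at_chart:
  assumes "c \<in> charts"
  shows "holo_at f (c u) \<longleftrightarrow> (f \<circ> c) analytic_on {u}"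
proof
  assume "holo_at f (c u)"
  then show "(f \<circ> c) analytic_on {u}"
    using assms by (auto simp: holo_at_def vimage_chart_singleton)
next
  assume an: "(f \<circ> c) analytic_on {u}"
  have "(f \<circ> c') analytic_on (c' -` {c u})" if c': "c' \<in> charts" for c'
  proof (subst analytic_on_analytic_at, safe)
    fix u' assume "c' u' = c u"
    then obtain h where h: "h analytic_on {u'}" "h u' = u" "\<forall>\<^sub>F v in nhds u'. c' v = c (h v)"
      using chart_transition[OF c' assms] by metis
    have "((f \<circ> c) \<circ> h) analytic_on {u'}"
      using h an by (intro analytic_on_compose) auto
    moreover have "\<forall>\<^sub>F v in nhds u'. ((f \<circ> c) \<circ> h) v = (f \<circ> c') v"
      using h(3) by eventually_elim simp
    ultimately show "(f \<circ> c') analytic_on {u'}"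
      using analytic_at_cong by blast
  qed
  then show "holo_at f (c u)" by (simp add: holo_at_def)
qed

lemma holo_at_const: "holo_at (\<lambda>_. a) p"
  by (simp add: holo_at_def o_def)

lemma holo_at_add: "holo_at f p \<Longrightarrow> holo_at g p \<Longrightarrow> holo_at (\<lambda>q. f q + g q) p"
  and holo_at_mult: "holo_at f p \<Longrightarrow> holo_at g p \<Longrightarrow> holo_at (\<lambda>q. f q * g q) p"
  by (auto simp: holo_at_def o_def intro!: analytic_intros)

lemma holo_at_sum: "(\<And>i. i \<in> I \<Longrightarrow> holo_at (f i) p) \<Longrightarrow> holo_at (\<lambda>q. \<Sum>i\<in>I. f i q) p"
  by (auto simp: holo_at_def o_def intro!: analytic_intros)

lemma holo_at_eventually: "holo_at f p \<Longrightarrow> \<forall>\<^sub>F q in nhds p. holo_at f q"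
proof -
  assume f: "holo_at f p"
  obtain c u where c: "c \<in> charts" "p = c u" by (rule chart_cover)
  with f obtain S where S: "open S" "u \<in> S" "(f \<circ> c) holomorphic_on S"
    by (auto simp: holo_at_chart analytic_at)
  have "\<forall>\<^sub>F v in nhds u. v \<in> S"
    using S by (intro eventually_nhds_in_open)
  then have "\<forall>\<^sub>F v in nhds u. holo_at f (c v)"
    by eventually_elim (use S c in \<open>auto simp: holo_at_chart analytic_at\<close>)
  then show ?thesis using c by (simp add: eventually_nhds_chart)
qed

lemma holo_at_cong:
  assumes "\<forall>\<^sub>F q in nhds p. f q = g q"
  shows "holo_at f p \<longleftrightarrow> holo_at g p"
proof -
  obtain c u where c: "c \<in> charts" "p = c u" by (rule chart_cover)
  then show ?thesis
    using assms analytic_at_cong[of "f \<circ> c" "g \<circ> c" u u]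
    by (simp add: holo_at_chart eventually_nhds_chart)
qed

lemma holo_at_tendsto:
  assumes "holo_at f p" shows "(f \<longlongrightarrow> f p) (at p)"
proof -
  obtain c u where c: "c \<in> charts" "p = c u" by (rule chart_cover)
  then have "isCont (f \<circ> c) u"
    using assms analytic_at_imp_isCont by (simp add: holo_at_chart)
  then show ?thesis
    using c by (simp add: tendsto_at_chart isCont_def)
qed

lemma mero_const: "mero (\<lambda>_. a)"
  by (auto simp: mero_def o_def intro: meromorphic_on_const)

lemma mero_add: "mero f \<Longrightarrow> mero g \<Longrightarrow> mero (\<lambda>q. f q + g q)"
  and mero_mult: "mero f \<Longrightarrow> mero g \<Longrightarrow> mero (\<lambda>q. f q * g q)"
  by (auto simp: mero_def o_def intro!: meromorphic_intros)

lemma mero_sum: "(\<And>i. i \<in> I \<Longrightarrow> mero (f i)) \<Longrightarrow> mero (\<lambda>q. \<Sum>i\<in>I. f i q)"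
  by (auto simp: mero_def o_def intro!: meromorphic_intros)

lemma mero_eventually_holo:
  assumes "mero f" shows "\<forall>\<^sub>F q in at p. holo_at f q"
proof -
  obtain c u where c: "c \<in> charts" "p = c u" by (rule chart_cover)
  have "\<not> u islimpt {w. \<not> (f \<circ> c) analytic_on {w}}"
    using assms c by (intro meromorphic_on_imp_not_islimpt_singularities[of _ UNIV]) (auto simp: mero_def)
  then show ?thesis
    using c by (auto simp: eventually_at_chart holo_at_chart islimpt_conv_frequently_at frequently_def)
qed

lemma mero_cong:
  assumes "mero f" "\<And>p. \<forall>\<^sub>F q in at p. f q = g q"
  shows "mero g"
  unfolding mero_def
proof
  fix c assume c: "c \<in> charts"
  have "\<forall>\<^sub>F w in at u. (f \<circ> c) w = (g \<circ> c) w" for u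
    using assms(2)[of "c u"] c by (simp add: eventually_at_chart)
  then have "(f \<circ> c) meromorphic_on UNIV \<longleftrightarrow> (g \<circ> c) meromorphic_on UNIV"
    by (intro meromorphic_on_cong) auto
  then show "(g \<circ> c) meromorphic_on UNIV"
    using assms(1) c by (simp add: mero_def)
qed

lemma mero_pole_or_limit:
  assumes "mero f" "c \<in> charts"
  shows "is_pole (f \<circ> c) u \<or> (\<exists>a. (f \<longlongrightarrow> a) (at (c u)))"
proof -
  have "not_essential (f \<circ> c) u"
    using assms meromorphic_on_not_essential[of "f \<circ> c" u] meromorphic_on_subset[of "f \<circ> c" UNIV "{u}"]
    by (auto simp: mero_def)
  then show ?thesis
    by (auto simp: not_essential_def tendsto_at_chart[OF assms(2)])
qed

text \<open>Removable singularities, for a function that takes the limit as its value.\<close>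

lemma mero_fill_holo:
  assumes "mero f" "\<forall>\<^sub>F q in at p. g q = f q" "(f \<longlongrightarrow> g p) (at p)"
  shows "holo_at g p"
proof -
  obtain c u where c: "c \<in> charts" "p = c u" by (rule chart_cover)
  have ev: "\<forall>\<^sub>F w in at u. (g \<circ> c) w = (f \<circ> c) w"
    using assms(2) c by (simp add: eventually_at_chart)
  have "(f \<circ> c) meromorphic_on {u}"
    using assms(1) c by (auto simp: mero_def intro: meromorphic_on_subset)
  then have "(g \<circ> c) meromorphic_on {u}"
    using meromorphic_on_cong[of "{u}" "g \<circ> c" "f \<circ> c"] ev by auto
  moreover have "((f \<circ> c) \<longlongrightarrow> g p) (at u)"
    using assms(3) c by (simp add: tendsto_at_chart)
  then have "((g \<circ> c) \<longlongrightarrow> g p) (at u)"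
    using filterlim_cong[OF refl refl ev] by blast
  then have "isCont (g \<circ> c) u"
    using c by (simp add: isCont_def)
  ultimately have "(g \<circ> c) analytic_on {u}"
    by (rule meromorphic_at_isCont_imp_analytic)
  then show ?thesis using c by (simp add: holo_at_chart)
qed

section \<open>Meromorphic maps and their normal forms\<close>

lemma regular_at_iff: "regular_at \<nu> p \<longleftrightarrow> (\<forall>l. functional l \<longrightarrow> holo_at (\<lambda>q. l (\<nu> q)) p)"
  by (simp add: regular_at_def holo_at_def o_def)

text \<open>The conditions for \<open>mero_maps\<close> except the normalization of the values. Pointwise sums and brackets
  of normal forms satisfy them, and \<open>fill_in\<close> then restores the normal form.\<close>

definition pre_mero :: "(cproj \<Rightarrow> 'g::complex_vector_space) \<Rightarrow> bool"
  where "pre_mero \<nu> \<longleftrightarrow> finite_rank \<nu> \<and> (\<forall>l. functional l \<longrightarrow> mero (\<lambda>q. l (\<nu> q)))"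

lemma mero_maps_iff:
  "\<nu> \<in> mero_maps \<longleftrightarrow> pre_mero \<nu> \<and> (\<forall>p. regular_at \<nu> p \<or> pole_at \<nu> p \<and> \<nu> p = 0)"
  by (auto simp: mero_maps_def pre_mero_def finite_rank_def mero_def o_def)

lemma pre_mero_sum:
  assumes "finite I" "\<And>i. i \<in> I \<Longrightarrow> mero (f i)"
  shows "pre_mero (\<lambda>q. \<Sum>i\<in>I. f i q *\<^sub>C v i)"
proof -
  have "mero (\<lambda>q. l (\<Sum>i\<in>I. f i q *\<^sub>C v i))" if "functional l" for l
    using that assms by (auto simp: functional_sum functional_scale intro!: mero_sum mero_mult mero_const)
  then show ?thesis
    using finite_rank_sum[OF assms(1)] unfolding pre_mero_def by blast
qed

lemma regular_at_sum:
  assumes "\<And>i. i \<in> I \<Longrightarrow> holo_at (f i) p"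
  shows "regular_at (\<lambda>q. \<Sum>i\<in>I. f i q *\<^sub>C v i) p"
  using assms by (auto simp: regular_at_iff functional_sum functional_scale
      intro!: holo_at_sum holo_at_mult holo_at_const)

text \<open>This reduces statements on vector-valued maps to statements on scalar functions.\<close>

lemma pre_mero_expand:
  assumes "pre_mero \<nu>"
  obtains A where "finite A" "\<And>q. \<nu> q = (\<Sum>b\<in>A. coord b (\<nu> q) *\<^sub>C b)"
    "\<And>b. mero (\<lambda>q. coord b (\<nu> q))" "\<And>b p. regular_at \<nu> p \<Longrightarrow> holo_at (\<lambda>q. coord b (\<nu> q)) p"
proof -
  have "finite_rank \<nu>" using assms by (simp add: pre_mero_def)
  from this this obtain A where "finite A" "\<And>q. \<nu> q = (\<Sum>b\<in>A. coord b (\<nu> q) *\<^sub>C b)"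
    by (rule finite_rank_expand2) blast
  then show ?thesis
    using that[of A] assms functional_coord by (auto simp: pre_mero_def regular_at_iff)
qed

lemma pre_mero_eventually_regular:
  assumes "pre_mero \<nu>" shows "\<forall>\<^sub>F q in at p. regular_at \<nu> q"
proof -
  obtain A where A: "finite A" "\<And>q. \<nu> q = (\<Sum>b\<in>A. coord b (\<nu> q) *\<^sub>C b)" "\<And>b. mero (\<lambda>q. coord b (\<nu> q))"
    using assms by (rule pre_mero_expand) blast
  have "\<forall>\<^sub>F q in at p. \<forall>b\<in>A. holo_at (\<lambda>q. coord b (\<nu> q)) q"
    using A by (intro eventually_ball_finite ballI mero_eventually_holo)
  then show ?thesis
    by eventually_elim (subst A(2)[abs_def], rule regular_at_sum, blast)
qed

lemma regular_at_cong:
  assumes "\<forall>\<^sub>F q in nhds p. \<mu> q = \<nu> q"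
  shows "regular_at \<mu> p \<longleftrightarrow> regular_at \<nu> p"
proof -
  have "holo_at (\<lambda>q. l (\<mu> q)) p \<longleftrightarrow> holo_at (\<lambda>q. l (\<nu> q)) p" for l
    using assms by (intro holo_at_cong) (auto elim: eventually_mono)
  then show ?thesis by (simp add: regular_at_iff)
qed

lemma lie_sum_left: "lie (\<Sum>i\<in>I. f i) y = (\<Sum>i\<in>I. lie (f i) y)"
proof (induction I rule: infinite_finite_induct)
  case (insert i I)
  then show ?case by (simp add: lie_add_left)
qed (use lie_add_left[of 0 0 y] in auto)

lemma lie_sum_right: "lie x (\<Sum>i\<in>I. f i) = (\<Sum>i\<in>I. lie x (f i))"
proof (induction I rule: infinite_finite_induct)
  case (insert i I)
  then show ?case by (simp add: lie_add_right)
qed (use lie_add_right[of x 0 0] in auto)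

lemma lie_expand:
  "lie (\<Sum>a\<in>A. f a *\<^sub>C a) (\<Sum>b\<in>B. g b *\<^sub>C b) = (\<Sum>(a, b)\<in>A \<times> B. (f a * g b) *\<^sub>C lie a b)"
  by (simp add: lie_sum_left lie_sum_right lie_scaleC_left lie_scaleC_right cvs.scale_scale
      sum.cartesian_product[symmetric] cvs.scale_sum_right mult.commute sum.swap[of _ A B])

lemma pre_mero_lie:
  assumes "pre_mero \<mu>" "pre_mero \<nu>"
  shows "pre_mero (\<lambda>q. lie (\<mu> q) (\<nu> q))"
    and "regular_at \<mu> p \<Longrightarrow> regular_at \<nu> p \<Longrightarrow> regular_at (\<lambda>q. lie (\<mu> q) (\<nu> q)) p"
proof -
  obtain A where A: "finite A" "\<And>q. \<mu> q = (\<Sum>b\<in>A. coord b (\<mu> q) *\<^sub>C b)"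
    "\<And>b. mero (\<lambda>q. coord b (\<mu> q))" "\<And>b p. regular_at \<mu> p \<Longrightarrow> holo_at (\<lambda>q. coord b (\<mu> q)) p"
    using assms(1) by (rule pre_mero_expand) blast
  obtain B where B: "finite B" "\<And>q. \<nu> q = (\<Sum>b\<in>B. coord b (\<nu> q) *\<^sub>C b)"
    "\<And>b. mero (\<lambda>q. coord b (\<nu> q))" "\<And>b p. regular_at \<nu> p \<Longrightarrow> holo_at (\<lambda>q. coord b (\<nu> q)) p"
    using assms(2) by (rule pre_mero_expand) blast
  have eq: "(\<lambda>q. lie (\<mu> q) (\<nu> q))
      = (\<lambda>q. \<Sum>x\<in>A \<times> B. (coord (fst x) (\<mu> q) * coord (snd x) (\<nu> q)) *\<^sub>C lie (fst x) (snd x))"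
    by (subst A(2), subst B(2), subst lie_expand) (simp add: case_prod_unfold)
  show "pre_mero (\<lambda>q. lie (\<mu> q) (\<nu> q))"
    unfolding eq by (intro pre_mero_sum mero_mult A B finite_cartesian_product)
  show "regular_at (\<lambda>q. lie (\<mu> q) (\<nu> q)) p" if "regular_at \<mu> p" "regular_at \<nu> p"
    unfolding eq by (intro regular_at_sum holo_at_mult A B that)
qed

lemma pre_mero_add: "pre_mero \<mu> \<Longrightarrow> pre_mero \<nu> \<Longrightarrow> pre_mero (\<lambda>q. \<mu> q + \<nu> q)"
  by (auto simp: pre_mero_def functional_add intro!: mero_add finite_rank_add)

lemma regular_at_add: "regular_at \<mu> p \<Longrightarrow> regular_at \<nu> p \<Longrightarrow> regular_at (\<lambda>q. \<mu> q + \<nu> q) p"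
  by (auto simp: regular_at_iff functional_add intro!: holo_at_add)

 lemma weak_limit_unique:
  fixes \<nu> :: "cproj \<Rightarrow> 'a::complex_vector_space"
  assumes "weak_limit \<nu> p v" "weak_limit \<nu> p w" shows "v = w"
proof (rule functionals_separate)
  fix l :: "'a \<Rightarrow> complex" assume "functional l"
  then have "((\<lambda>q. l (\<nu> q)) \<longlongrightarrow> l v) (at p)" "((\<lambda>q. l (\<nu> q)) \<longlongrightarrow> l w) (at p)"
    using assms unfolding weak_limit_def by blast+
  then show "l v = l w" by (rule tendsto_unique[OF cproj_at_neq_bot])
qed

lemma fill_in_eqI: "weak_limit \<nu> p v \<Longrightarrow> fill_in \<nu> p = v"
  unfolding fill_in_def using weak_limit_unique by (auto intro!: the_equality)

lemma fill_in_regular: "regular_at \<nu> p \<Longrightarrow> fill_in \<nu> p = \<nu> p"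
  by (rule fill_in_eqI) (auto simp: weak_limit_def regular_at_iff intro: holo_at_tendsto)

lemma fill_in_cong:
  assumes "\<forall>\<^sub>F q in at p. \<mu> q = \<nu> q"
  shows "fill_in \<mu> p = fill_in \<nu> p"
proof -
  have "((\<lambda>q. l (\<mu> q)) \<longlongrightarrow> l v) (at p) \<longleftrightarrow> ((\<lambda>q. l (\<nu> q)) \<longlongrightarrow> l v) (at p)" for l v
    using assms by (intro filterlim_cong) (auto elim: eventually_mono)
  then have "weak_limit \<mu> p v \<longleftrightarrow> weak_limit \<nu> p v" for v
    unfolding weak_limit_def by (intro all_cong) blast
  then have "weak_limit \<mu> p = weak_limit \<nu> p" by blast
  then show ?thesis by (simp add: fill_in_def)
qed

lemma fill_in_eventually: "pre_mero \<nu> \<Longrightarrow> \<forall>\<^sub>F q in at p. fill_in \<nu> q = \<nu> q"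
  using pre_mero_eventually_regular[of \<nu> p] by (auto elim!: eventually_mono simp: fill_in_regular)

lemma pole_at_no_weak_limit:
  assumes "pole_at \<nu> p" shows "\<not> weak_limit \<nu> p v"
proof
  assume lim: "weak_limit \<nu> p v"
  obtain l c u where l: "functional l" "c \<in> charts" "c u = p" "is_pole (l \<circ> \<nu> \<circ> c) u"
    using assms by (auto simp: pole_at_def)
  have "((l \<circ> \<nu>) \<longlongrightarrow> l v) (at (c u))"
    using lim l by (simp add: weak_limit_def o_def)
  then have "((l \<circ> \<nu> \<circ> c) \<longlongrightarrow> l v) (at u)"
    by (simp only: tendsto_at_chart[OF l(2)])
  with l(4) show False
    unfolding is_pole_def using not_tendsto_and_filterlim_at_infinity trivial_limit_at by blast
qed

text \<open>Each of the finitely many coordinates has a limit or a pole; if all have limits, these are the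
  coordinates of a weak limit.\<close>

lemma weak_limit_or_pole:
  assumes "pre_mero \<nu>"
  shows "(\<exists>v. weak_limit \<nu> p v) \<or> pole_at \<nu> p"
proof (rule disjCI)
  assume no: "\<not> pole_at \<nu> p"
  obtain A where A: "finite A" "\<And>q. \<nu> q = (\<Sum>b\<in>A. coord b (\<nu> q) *\<^sub>C b)" "\<And>b. mero (\<lambda>q. coord b (\<nu> q))"
    using assms by (rule pre_mero_expand) blast
  obtain c u where c: "c \<in> charts" "p = c u" by (rule chart_cover)
  have "\<exists>a. ((\<lambda>q. coord b (\<nu> q)) \<longlongrightarrow> a) (at p)" for b
    using mero_pole_or_limit[OF A(3)[of b] c(1), of u] no c functional_coord[of b]
    by (auto simp: pole_at_def o_def)
  then obtain a where a: "\<And>b. ((\<lambda>q. coord b (\<nu> q)) \<longlongrightarrow> a b) (at p)" by metis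
  have "weak_limit \<nu> p (\<Sum>b\<in>A. a b *\<^sub>C b)"
    unfolding weak_limit_def
  proof (intro allI impI)
    fix l :: "'a \<Rightarrow> complex" assume l: "functional l"
    have "((\<lambda>q. \<Sum>b\<in>A. coord b (\<nu> q) * l b) \<longlongrightarrow> (\<Sum>b\<in>A. a b * l b)) (at p)"
      by (intro tendsto_sum tendsto_mult a tendsto_const)
    moreover have "l (\<nu> q) = (\<Sum>b\<in>A. coord b (\<nu> q) * l b)" for q
      by (subst A(2)) (simp add: l functional_sum functional_scale)
    ultimately show "((\<lambda>q. l (\<nu> q)) \<longlongrightarrow> l (\<Sum>b\<in>A. a b *\<^sub>C b)) (at p)"
      by (simp add: l functional_sum functional_scale)
  qed
  then show "\<exists>v. weak_limit \<nu> p v" ..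
qed

text \<open>Otherwise some functional would vanish on the span, hence along the map, but not at the limit.\<close>

lemma weak_limit_in_span:
  assumes "weak_limit \<nu> p v" "range \<nu> \<subseteq> cspan B" "finite B"
  shows "v \<in> cspan (B :: 'g::complex_vector_space set)"
proof (rule ccontr)
  assume "v \<notin> cspan B"
  obtain \<pi> :: "'g \<Rightarrow> 'g" where \<pi>: "Vector_Spaces.linear scaleC scaleC \<pi>" "\<And>v. \<pi> v = 0 \<longleftrightarrow> v \<in> cspan B"
    using ex_projection[of B] by blast
  obtain b where b: "coord b (\<pi> v) \<noteq> 0"
    using coord_expand[of "{}" "\<pi> v"] \<pi>(2) \<open>v \<notin> cspan B\<close> by auto
  have "functional (\<lambda>x. coord b (\<pi> x))"
    using \<pi>(1)
    by (intro functionalI)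
       (simp_all add: Vector_Spaces.linear_iff functional_add[OF functional_coord] functional_scale[OF functional_coord])
  then have "((\<lambda>q. coord b (\<pi> (\<nu> q))) \<longlongrightarrow> coord b (\<pi> v)) (at p)"
    using assms(1) by (auto simp: weak_limit_def)
  moreover have "coord b (\<pi> (\<nu> q)) = 0" for q
    using \<pi>(2)[of "\<nu> q"] assms(2) functional_zero[OF functional_coord] by auto
  ultimately have "((\<lambda>q. 0) \<longlongrightarrow> coord b (\<pi> v)) (at p)"
    by simp
  then show False
    using b tendsto_unique[OF cproj_at_neq_bot _ tendsto_const] by metis
qed

lemma fill_in_mero_maps:
  fixes \<nu> :: "cproj \<Rightarrow> 'g::complex_vector_space"
  assumes "pre_mero \<nu>" shows "fill_in \<nu> \<in> mero_maps"
  unfolding mero_maps_iff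
proof (intro conjI allI)
  obtain B where B: "finite B" "range \<nu> \<subseteq> cspan B"
    using assms by (auto simp: pre_mero_def finite_rank_def)
  have "fill_in \<nu> p \<in> cspan B" for p
    using weak_limit_in_span[OF _ B(2,1)] fill_in_eqI[of \<nu> p]
    by (cases "\<exists>v. weak_limit \<nu> p v") (auto simp: fill_in_def cvs.span_zero)
  moreover have "mero (\<lambda>q. l (fill_in \<nu> q))" if "functional l" for l
  proof (rule mero_cong)
    show "mero (\<lambda>q. l (\<nu> q))" using assms that by (simp add: pre_mero_def)
    show "\<forall>\<^sub>F q in at p. l (\<nu> q) = l (fill_in \<nu> q)" for p
      using fill_in_eventually[OF assms, of p] by eventually_elim simp
  qed
  ultimately show "pre_mero (fill_in \<nu>)"
    using B(1) unfolding pre_mero_def finite_rank_def by blast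
next
  fix p
  show "regular_at (fill_in \<nu>) p \<or> pole_at (fill_in \<nu>) p \<and> fill_in \<nu> p = 0"
  proof (cases "\<exists>v. weak_limit \<nu> p v")
    case True
    then have lim: "weak_limit \<nu> p (fill_in \<nu> p)"
      using fill_in_eqI by metis
    have "holo_at (\<lambda>q. l (fill_in \<nu> q)) p" if "functional l" for l
    proof (rule mero_fill_holo)
      show "mero (\<lambda>q. l (\<nu> q))" using assms that by (simp add: pre_mero_def)
      show "\<forall>\<^sub>F q in at p. l (fill_in \<nu> q) = l (\<nu> q)"
        using fill_in_eventually[OF assms, of p] by eventually_elim simp
      show "((\<lambda>q. l (\<nu> q)) \<longlongrightarrow> l (fill_in \<nu> p)) (at p)"
        using lim that by (simp add: weak_limit_def)
    qed
    then show ?thesis by (simp add: regular_at_iff)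
  next
    case False
    then have "pole_at \<nu> p" using weak_limit_or_pole[OF assms] by blast
    then obtain l c u where l: "functional l" "c \<in> charts" "c u = p" "is_pole (l \<circ> \<nu> \<circ> c) u"
      by (auto simp: pole_at_def)
    have "\<forall>\<^sub>F w in at u. (l \<circ> \<nu> \<circ> c) w = (l \<circ> fill_in \<nu> \<circ> c) w"
      using fill_in_eventually[OF assms, of p] l(2,3) by (auto simp: eventually_at_chart elim!: eventually_mono)
    then have "is_pole (l \<circ> fill_in \<nu> \<circ> c) u"
      using l(4) is_pole_cong by blast
    then have "pole_at (fill_in \<nu>) p"
      using l unfolding pole_at_def by blast
    moreover have "fill_in \<nu> p = 0" using False by (simp add: fill_in_def)
    ultimately show ?thesis by blast
  qed
qed

lemma fill_in_normal: "\<nu> \<in> mero_maps \<Longrightarrow> fill_in \<nu> = \<nu>"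
proof
  fix p assume "\<nu> \<in> mero_maps"
  then consider "regular_at \<nu> p" | "pole_at \<nu> p" "\<nu> p = 0"
    by (auto simp: mero_maps_iff)
  then show "fill_in \<nu> p = \<nu> p"
    by cases (simp add: fill_in_regular, simp add: fill_in_def pole_at_no_weak_limit)
qed

text \<open>A normal form is recovered by \<open>fill_in\<close> from its values near a point. So an identity between meromorphic
  maps has to be checked only at nearby points, where everything is regular and the operations are pointwise.\<close>

lemma mero_maps_eqI:
  assumes "\<mu> \<in> mero_maps" "\<nu> \<in> mero_maps" "\<And>p. \<forall>\<^sub>F q in at p. \<mu> q = \<nu> q"
  shows "\<mu> = \<nu>"
proof
  fix p
  have "fill_in \<mu> p = fill_in \<nu> p" using assms(3) by (rule fill_in_cong)
  then show "\<mu> p = \<nu> p" using assms(1,2) by (simp add: fill_in_normal)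
qed

lemma fill_in_regular_at:
  assumes "pre_mero \<nu>" "regular_at \<nu> p" shows "regular_at (fill_in \<nu>) p"
proof -
  have "\<forall>\<^sub>F q in nhds p. fill_in \<nu> q = \<nu> q"
    using fill_in_eventually[OF assms(1), of p] fill_in_regular[OF assms(2)]
    by (auto simp: eventually_at_filter elim: eventually_mono)
  then show ?thesis using assms(2) regular_at_cong by blast
qed

lemma maps_regular_on_pre_mero: "\<nu> \<in> maps_regular_on S \<Longrightarrow> pre_mero \<nu>"
  by (simp add: maps_regular_on_def mero_maps_iff)

lemma maps_regular_onD: "\<nu> \<in> maps_regular_on S \<Longrightarrow> p \<in> S \<Longrightarrow> regular_at \<nu> p"
  by (simp add: maps_regular_on_def)

lemma fill_in_maps_regular_on:
  "pre_mero \<nu> \<Longrightarrow> (\<And>p. p \<in> S \<Longrightarrow> regular_at \<nu> p) \<Longrightarrow> fill_in \<nu> \<in> maps_regular_on S"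
  by (simp add: maps_regular_on_def fill_in_mero_maps fill_in_regular_at)

lemma maps_regular_on_closed:
  assumes "\<mu> \<in> maps_regular_on S" "\<nu> \<in> maps_regular_on S"
  shows madd_regular_on: "madd \<mu> \<nu> \<in> maps_regular_on S"
    and mlie_regular_on: "mlie \<mu> \<nu> \<in> maps_regular_on S"
proof -
  note pre = assms[THEN maps_regular_on_pre_mero] and reg = assms[THEN maps_regular_onD]
  show "madd \<mu> \<nu> \<in> maps_regular_on S"
    unfolding madd_def by (intro fill_in_maps_regular_on pre_mero_add regular_at_add pre reg)
  show "mlie \<mu> \<nu> \<in> maps_regular_on S"
    unfolding mlie_def by (intro fill_in_maps_regular_on pre_mero_lie pre reg)
qed

lemma madd_regular: "regular_at \<mu> p \<Longrightarrow> regular_at \<nu> p \<Longrightarrow> madd \<mu> \<nu> p = \<mu> p + \<nu> p"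
  by (simp add: madd_def fill_in_regular regular_at_add)

lemma mlie_regular:
  "pre_mero \<mu> \<Longrightarrow> pre_mero \<nu> \<Longrightarrow> regular_at \<mu> p \<Longrightarrow> regular_at \<nu> p \<Longrightarrow> mlie \<mu> \<nu> p = lie (\<mu> p) (\<nu> p)"
  by (simp add: mlie_def fill_in_regular pre_mero_lie)

lemma madd_eventually:
  "pre_mero \<mu> \<Longrightarrow> pre_mero \<nu> \<Longrightarrow> \<forall>\<^sub>F q in at p. madd \<mu> \<nu> q = \<mu> q + \<nu> q"
  unfolding madd_def by (intro fill_in_eventually pre_mero_add)

lemma mlie_eventually:
  "pre_mero \<mu> \<Longrightarrow> pre_mero \<nu> \<Longrightarrow> \<forall>\<^sub>F q in at p. mlie \<mu> \<nu> q = lie (\<mu> q) (\<nu> q)"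
  unfolding mlie_def by (intro fill_in_eventually pre_mero_lie)

lemma lie_antisym: "lie y x = - lie x (y :: 'g::complex_lie_algebra)"
proof -
  have "lie x y + lie y x = lie (x + y) (x + y)"
    unfolding lie_add_left lie_add_right by (simp add: lie_self add.commute)
  then have "lie x y + lie y x = 0" by (simp only: lie_self)
  then show ?thesis by (metis add_eq_0_iff)
qed

lemma lie_minus_right: "lie x (- y) = - lie x (y :: 'g::complex_lie_algebra)"
  using lie_add_right[of x y "- y"] lie_add_right[of x 0 0] by (simp add: eq_neg_iff_add_eq_0 add.commute)

lemma lie_jacobi': "lie (lie x y) z = lie x (lie y z) + lie (lie x z) (y :: 'g::complex_lie_algebra)"
proof -
  have "lie (lie x y) z = - lie z (lie x y)" "lie (lie x z) y = lie y (lie z x)"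
    using lie_antisym[of "lie x y" z] lie_antisym[of "lie x z" y] lie_antisym[of x z] by (auto simp: lie_minus_right)
  then show ?thesis using lie_jacobi[of x y z] by (metis add_eq_0_iff minus_minus)
qed

lemma mero_maps_mlie: "\<mu> \<in> mero_maps \<Longrightarrow> \<nu> \<in> mero_maps \<Longrightarrow> mlie \<mu> \<nu> \<in> mero_maps"
  unfolding mlie_def by (intro fill_in_mero_maps pre_mero_lie) (auto simp: mero_maps_iff)

lemma mero_maps_madd: "\<mu> \<in> mero_maps \<Longrightarrow> \<nu> \<in> mero_maps \<Longrightarrow> madd \<mu> \<nu> \<in> mero_maps"
  unfolding madd_def by (intro fill_in_mero_maps pre_mero_add) (auto simp: mero_maps_iff)

lemma mero_maps_pre: "\<mu> \<in> mero_maps \<Longrightarrow> pre_mero \<mu>"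
  by (simp add: mero_maps_iff)

lemma mlie_jacobi:
  assumes "\<mu> \<in> mero_maps" "\<nu> \<in> mero_maps" "\<alpha> \<in> mero_maps"
  shows "mlie (mlie \<mu> \<nu>) \<alpha> = madd (mlie \<mu> (mlie \<nu> \<alpha>)) (mlie (mlie \<mu> \<alpha>) \<nu>)"
proof (rule mero_maps_eqI)
  fix p
  note closed = mero_maps_mlie mero_maps_pre mero_maps_madd assms
  have "\<forall>\<^sub>F q in at p. mlie \<mu> \<nu> q = lie (\<mu> q) (\<nu> q)" "\<forall>\<^sub>F q in at p. mlie \<nu> \<alpha> q = lie (\<nu> q) (\<alpha> q)"
    "\<forall>\<^sub>F q in at p. mlie \<mu> \<alpha> q = lie (\<mu> q) (\<alpha> q)"
    "\<forall>\<^sub>F q in at p. mlie (mlie \<mu> \<nu>) \<alpha> q = lie (mlie \<mu> \<nu> q) (\<alpha> q)"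
    "\<forall>\<^sub>F q in at p. mlie \<mu> (mlie \<nu> \<alpha>) q = lie (\<mu> q) (mlie \<nu> \<alpha> q)"
    "\<forall>\<^sub>F q in at p. mlie (mlie \<mu> \<alpha>) \<nu> q = lie (mlie \<mu> \<alpha> q) (\<nu> q)"
    "\<forall>\<^sub>F q in at p. madd (mlie \<mu> (mlie \<nu> \<alpha>)) (mlie (mlie \<mu> \<alpha>) \<nu>) q
      = mlie \<mu> (mlie \<nu> \<alpha>) q + mlie (mlie \<mu> \<alpha>) \<nu> q"
    by (intro mlie_eventually madd_eventually closed)+
  then show "\<forall>\<^sub>F q in at p. mlie (mlie \<mu> \<nu>) \<alpha> q = madd (mlie \<mu> (mlie \<nu> \<alpha>)) (mlie (mlie \<mu> \<alpha>) \<nu>) q"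
    by eventually_elim (simp, rule lie_jacobi')
qed (intro mero_maps_mlie mero_maps_madd assms)+

lemma mlie_madd_left:
  assumes "\<mu> \<in> mero_maps" "\<nu> \<in> mero_maps" "\<alpha> \<in> mero_maps"
  shows "mlie (madd \<mu> \<nu>) \<alpha> = madd (mlie \<mu> \<alpha>) (mlie \<nu> \<alpha>)"
proof (rule mero_maps_eqI)
  fix p
  note closed = mero_maps_mlie mero_maps_pre mero_maps_madd assms
  have "\<forall>\<^sub>F q in at p. madd \<mu> \<nu> q = \<mu> q + \<nu> q" "\<forall>\<^sub>F q in at p. mlie \<nu> \<alpha> q = lie (\<nu> q) (\<alpha> q)"
    "\<forall>\<^sub>F q in at p. mlie \<mu> \<alpha> q = lie (\<mu> q) (\<alpha> q)"
    "\<forall>\<^sub>F q in at p. mlie (madd \<mu> \<nu>) \<alpha> q = lie (madd \<mu> \<nu> q) (\<alpha> q)"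
    "\<forall>\<^sub>F q in at p. madd (mlie \<mu> \<alpha>) (mlie \<nu> \<alpha>) q = mlie \<mu> \<alpha> q + mlie \<nu> \<alpha> q"
    by (intro mlie_eventually madd_eventually closed)+
  then show "\<forall>\<^sub>F q in at p. mlie (madd \<mu> \<nu>) \<alpha> q = madd (mlie \<mu> \<alpha>) (mlie \<nu> \<alpha>) q"
    by eventually_elim (simp add: lie_add_left)
qed (intro mero_maps_mlie mero_maps_madd assms)+

lemma weak_limit_uminus: "weak_limit \<nu> p v \<Longrightarrow> weak_limit (\<lambda>q. - \<nu> q) p (- v)"
  unfolding weak_limit_def
proof (intro allI impI)
  fix l :: "'a \<Rightarrow> complex" assume "\<forall>l. functional l \<longrightarrow> ((\<lambda>q. l (\<nu> q)) \<longlongrightarrow> l v) (at p)" and l: "functional l"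
  then have "((\<lambda>q. - l (\<nu> q)) \<longlongrightarrow> - l v) (at p)"
    by (intro tendsto_minus) blast
  moreover have "l (- x) = - l x" for x
    using functional_scale[OF l, of "- 1" x] by simp
  ultimately show "((\<lambda>q. l (- \<nu> q)) \<longlongrightarrow> l (- v)) (at p)" by simp
qed

lemma fill_in_uminus: "fill_in (\<lambda>q. - \<nu> q) = mscale (- 1) (fill_in \<nu>)"
proof
  fix p
  show "fill_in (\<lambda>q. - \<nu> q) p = mscale (- 1) (fill_in \<nu>) p"
  proof (cases "\<exists>v. weak_limit \<nu> p v")
    case True
    then obtain v where v: "weak_limit \<nu> p v" by blast
    show ?thesis using fill_in_eqI[OF v] fill_in_eqI[OF weak_limit_uminus[OF v]] by (simp add: mscale_def)
  next
    case False
    have "\<not> weak_limit (\<lambda>q. - \<nu> q) p v" for v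
      using weak_limit_uminus[of "\<lambda>q. - \<nu> q" p v] False by auto
    then show ?thesis using False by (auto simp: fill_in_def mscale_def)
  qed
qed

lemma mlie_swap: "mlie \<nu> \<mu> = mscale (- 1) (mlie \<mu> \<nu>)"
proof -
  have "(\<lambda>p. lie (\<nu> p) (\<mu> p)) = (\<lambda>p. - lie (\<mu> p) (\<nu> p))"
    using lie_antisym by blast
  then show ?thesis by (simp only: mlie_def fill_in_uminus)
qed

section \<open>Partial fractions\<close>

lemma analytic_on_poly: "f analytic_on A \<Longrightarrow> (\<lambda>z. poly P (f z)) analytic_on A"
  by (induction P) (auto intro!: analytic_intros)

lemma meromorphic_on_poly: "f meromorphic_on A \<Longrightarrow> (\<lambda>z. poly P (f z)) meromorphic_on A"
  by (induction P) (auto intro!: meromorphic_intros)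

lemma meromorphic_at_cong:
  "\<forall>\<^sub>F w in at u. f w = g w \<Longrightarrow> f meromorphic_on {u} \<longleftrightarrow> g meromorphic_on {u}"
  by (rule meromorphic_on_cong) auto

lemma analytic_split_constant:
  assumes "g analytic_on {s}"
  obtains h where "h analytic_on {s}" "\<And>u. u \<noteq> s \<Longrightarrow> g u * inverse (u - s) = g s * inverse (u - s) + h u"
proof -
  obtain A where A: "open A" "s \<in> A" "g holomorphic_on A"
    using assms by (auto simp: analytic_at)
  define h where "h = (\<lambda>u. if u = s then deriv g s else (g u - g s) / (u - s))"
  have "h holomorphic_on A"
    unfolding h_def by (rule pole_lemma_open[OF A(3,1)])
  then have "h analytic_on {s}" using A by (auto simp: analytic_at)
  moreover have "g u * inverse (u - s) = g s * inverse (u - s) + h u" if "u \<noteq> s" for u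
    using that by (simp add: h_def divide_inverse left_diff_distrib)
  ultimately show ?thesis by (rule that)
qed

text \<open>Split off the value of the numerator at \<open>s\<close>, divide the rest by \<open>u - s\<close>, and repeat.\<close>

lemma principal_part_of_quotient:
  assumes "g analytic_on {s}"
  shows "\<exists>P h. coeff P 0 = 0 \<and> h analytic_on {s} \<and>
    (\<forall>u. u \<noteq> s \<longrightarrow> g u * inverse (u - s) ^ n = poly P (inverse (u - s)) + h u)"
  using assms
proof (induction n arbitrary: g)
  case 0
  then show ?case by (intro exI[of _ 0] exI[of _ g]) auto
next
  case (Suc n)
  obtain g1 where g1: "g1 analytic_on {s}" "\<And>u. u \<noteq> s \<Longrightarrow> g u * inverse (u - s) = g s * inverse (u - s) + g1 u"
    using analytic_split_constant[OF Suc.prems] by blast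
  obtain P h where P: "coeff P 0 = 0" "h analytic_on {s}"
    "\<And>u. u \<noteq> s \<Longrightarrow> g1 u * inverse (u - s) ^ n = poly P (inverse (u - s)) + h u"
    using Suc.IH[OF g1(1)] by blast
  have "g u * inverse (u - s) ^ Suc n = poly (monom (g s) (Suc n) + P) (inverse (u - s)) + h u" if "u \<noteq> s" for u
  proof -
    have "g u * inverse (u - s) ^ Suc n = (g s * inverse (u - s) + g1 u) * inverse (u - s) ^ n"
      using g1(2)[OF that] by simp
    also have "\<dots> = g s * inverse (u - s) ^ Suc n + g1 u * inverse (u - s) ^ n"
      by (simp add: algebra_simps)
    finally show ?thesis using P(3)[OF that] by (simp add: poly_monom)
  qed
  then show ?case using P(1,2) by (intro exI[of _ "monom (g s) (Suc n) + P"] exI[of _ h]) simp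
qed

lemma principal_part:
  assumes "G meromorphic_on {s}"
  obtains P h where "coeff P 0 = 0" "h analytic_on {s}"
    "\<forall>\<^sub>F u in at s. G u = poly P (inverse (u - s)) + h u"
proof -
  have iso: "isolated_singularity_at G s" and "not_essential G s"
    using assms by (auto simp: meromorphic_at_iff)
  then consider (lim) a where "G \<midarrow>s\<rightarrow> a" | (pole) "is_pole G s"
    by (auto simp: not_essential_def)
  then have "\<exists>g n. g analytic_on {s} \<and> (\<forall>\<^sub>F u in at s. G u = g u * inverse (u - s) ^ n)"
  proof cases
    case lim
    then show ?thesis
      using remove_sings_analytic_at[OF iso] eventually_remove_sings_eq_at[OF iso]
      by (intro exI[of _ "remove_sings G"] exI[of _ 0]) (auto elim: eventually_mono)
  next
    case pole
    obtain r where r: "r > 0" "G analytic_on ball s r - {s}"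
      using iso by (auto simp: isolated_singularity_at_def)
    then have "G holomorphic_on ball s r - {s}" by (simp add: analytic_imp_holomorphic)
    from zorder_exist_pole[OF this _ _ pole] r(1) obtain e where e: "e > 0"
      "zor_poly G s holomorphic_on cball s e"
      "\<forall>w\<in>cball s e - {s}. G w = zor_poly G s w / (w - s) ^ nat (- zorder G s)"
      by auto
    have "zor_poly G s holomorphic_on ball s e"
      using e(2) holomorphic_on_subset ball_subset_cball by blast
    then have "zor_poly G s analytic_on {s}"
      using e(1) by (auto simp: analytic_at intro!: exI[of _ "ball s e"])
    moreover have "\<forall>\<^sub>F w in at s. w \<in> ball s e - {s}"
      using e(1) by (intro eventually_at_in_open) auto
    then have "\<forall>\<^sub>F u in at s. G u = zor_poly G s u * inverse (u - s) ^ nat (- zorder G s)"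
      by eventually_elim (use e(3) in \<open>auto simp: divide_inverse power_inverse\<close>)
    ultimately show ?thesis by blast
  qed
  then obtain g n where g: "g analytic_on {s}" "\<forall>\<^sub>F u in at s. G u = g u * inverse (u - s) ^ n"
    by blast
  obtain P h where P: "coeff P 0 = 0" "h analytic_on {s}"
    "\<And>u. u \<noteq> s \<Longrightarrow> g u * inverse (u - s) ^ n = poly P (inverse (u - s)) + h u"
    using principal_part_of_quotient[OF g(1), of n] by blast
  have "\<forall>\<^sub>F u in at s. u \<noteq> s" by (simp add: eventually_at_filter)
  with g(2) have "\<forall>\<^sub>F u in at s. G u = poly P (inverse (u - s)) + h u"
    by eventually_elim (simp add: P(3))
  with P(1,2) show ?thesis by (rule that)
qed

text \<open>Subtracting the principal parts one by one leaves an entire function with a limit at infinity, which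
  is constant by Liouville's theorem. The principal parts have no constant term, hence vanish at infinity and do
  not change the limit.\<close>

lemma partial_fractions:
  assumes "finite S" "\<And>u. u \<notin> S \<Longrightarrow> G analytic_on {u}" "\<And>s. s \<in> S \<Longrightarrow> G meromorphic_on {s}"
    and "(G \<longlongrightarrow> a) at_infinity"
  shows "\<exists>P. (\<forall>s\<in>S. coeff (P s) 0 = 0)
    \<and> (\<forall>u. u \<notin> S \<longrightarrow> G u = a + (\<Sum>s\<in>S. poly (P s) (inverse (u - s))))"
  using assms
proof (induction S arbitrary: G)
  case empty
  then have "G holomorphic_on UNIV"
    using analytic_imp_holomorphic[of G UNIV] analytic_on_analytic_at[of G UNIV] by blast
  then have "G u = a" for u
    using Liouville_weak empty.prems(3) by blast
  then show ?case by simp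
next
  case (insert s S)
  obtain P h where P: "coeff P 0 = 0" "h analytic_on {s}"
    "\<forall>\<^sub>F u in at s. G u = poly P (inverse (u - s)) + h u"
    using principal_part[OF insert.prems(2)[of s]] by blast
  define G1 where "G1 = (\<lambda>u. if u = s then h s else G u - poly P (inverse (u - s)))"
  have away: "\<forall>\<^sub>F v in nhds u. G1 v = G v - poly P (inverse (v - s))" if "u \<noteq> s" for u
  proof -
    have "\<forall>\<^sub>F v in nhds u. v \<noteq> s" using that by (rule t1_space_nhds)
    then show ?thesis by eventually_elim (simp add: G1_def)
  qed
  have an: "G1 analytic_on {u}" if "u \<notin> S" for u
  proof (cases "u = s")
    case True
    have "\<forall>\<^sub>F v in nhds s. G1 v = h v"
      using P(3) by (auto simp: eventually_at_filter G1_def elim!: eventually_mono)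
    then show ?thesis using P(2) True analytic_at_cong by blast
  next
    case False
    have "(\<lambda>v. G v - poly P (inverse (v - s))) analytic_on {u}"
      using that False insert.prems(1)[of u] by (intro analytic_intros analytic_on_poly) auto
    then show ?thesis using analytic_at_cong[OF away[OF False] refl] by simp
  qed
  have mer: "G1 meromorphic_on {u}" if "u \<in> S" for u
  proof -
    have "u \<noteq> s" using that insert.hyps by auto
    have "(\<lambda>v. G v - poly P (inverse (v - s))) meromorphic_on {u}"
      using that insert.prems(2)[of u] by (intro meromorphic_intros meromorphic_on_poly) auto
    moreover have "\<forall>\<^sub>F v in at u. G1 v = G v - poly P (inverse (v - s))"
      using away[OF \<open>u \<noteq> s\<close>] by (auto simp: eventually_at_filter elim: eventually_mono)
    ultimately show ?thesis
      using meromorphic_at_cong[of G1 "\<lambda>v. G v - poly P (inverse (v - s))" u] by blast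
  qed
  have "((\<lambda>u. poly P (inverse (u - s))) \<longlongrightarrow> poly P 0) at_infinity"
  proof (rule tendsto_poly)
    have "filterlim (\<lambda>u. u - s) at_infinity at_infinity"
      using tendsto_add_filterlim_at_infinity[OF tendsto_const[of "- s"] filterlim_ident] by simp
    then show "((\<lambda>u. inverse (u - s)) \<longlongrightarrow> 0) at_infinity"
      by (rule filterlim_compose[OF tendsto_inverse_0])
  qed
  then have "((\<lambda>u. G u - poly P (inverse (u - s))) \<longlongrightarrow> a - poly P 0) at_infinity"
    by (intro tendsto_diff insert.prems(3))
  moreover have "poly P 0 = 0" using P(1) by (simp add: poly_0_coeff_0)
  moreover have "\<forall>\<^sub>F u in at_infinity. G u - poly P (inverse (u - s)) = G1 u"
    unfolding eventually_at_infinity by (rule exI[of _ "norm s + 1"]) (auto simp: G1_def)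
  ultimately have "(G1 \<longlongrightarrow> a - 0) at_infinity"
    by (simp only:) (rule Lim_transform_eventually)
  then have "(G1 \<longlongrightarrow> a) at_infinity" by simp
  from insert.IH[OF an mer this] obtain Q where
    Q: "\<And>u. u \<notin> S \<Longrightarrow> G1 u = a + (\<Sum>s\<in>S. poly (Q s) (inverse (u - s)))" "\<forall>s\<in>S. coeff (Q s) 0 = 0"
    by blast
  have "G u = a + (\<Sum>t\<in>insert s S. poly ((Q(s := P)) t) (inverse (u - t)))" if "u \<notin> insert s S" for u
  proof -
    have "(\<Sum>t\<in>S. poly ((Q(s := P)) t) (inverse (u - t))) = (\<Sum>t\<in>S. poly (Q t) (inverse (u - t)))"
      using insert.hyps by (intro sum.cong) auto
    then show ?thesis
      using insert.hyps Q(1)[of u] that by (simp add: G1_def algebra_simps)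
  qed
  then show ?case using Q(2) P(1) by (intro exI[of _ "Q(s := P)"]) auto
qed

section \<open>Coordinates that omit a point\<close>

text \<open>The coordinate \<open>kap b\<close> parametrizes the complement of \<open>Fin b\<close>, with \<open>Infty\<close> at the origin, and
  \<open>spole b s\<close> is the function \<open>1 / (u - s)\<close> of this coordinate \<open>u\<close>, extended by \<open>0\<close> to \<open>Fin b\<close>. A base
  point on the boundary allows the expansion in partial fractions; a base point in \<open>D\<close> turns the boundary
  into a curve in the plane.\<close>

definition kap :: "complex \<Rightarrow> complex \<Rightarrow> cproj"
  where "kap b u = (if u = 0 then Infty else Fin (b + inverse u))"

definition spole :: "complex \<Rightarrow> complex \<Rightarrow> cproj \<Rightarrow> complex"
  where "spole b s q = (case q of Fin z \<Rightarrow> (z - b) / (1 - s * (z - b)) | Infty \<Rightarrow> - inverse s)"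

lemma kap_surj: "q \<noteq> Fin b \<Longrightarrow> \<exists>u. q = kap b u"
proof (cases q)
  case (Fin z)
  assume "q \<noteq> Fin b"
  with Fin show ?thesis by (intro exI[of _ "inverse (z - b)"]) (auto simp: kap_def)
qed (auto simp: kap_def intro!: exI[of _ 0])

lemma spole_base: "spole b s (Fin b) = 0"
  by (simp add: spole_def)

lemma spole_kap: "spole b s (kap b u) = inverse (u - s)"
  by (auto simp: spole_def kap_def divide_simps)

text \<open>This also holds at the pole, where both sides are \<open>0\<close> by the convention for division by zero.\<close>

lemma spole_inf_chart: "spole b s (inf_chart w) = (1 - b * w) / (w - s * (1 - b * w))"
proof (cases "w = 0")
  case False
  then have "inverse w - b = (1 - b * w) / w" "1 - s * (inverse w - b) = (w - s * (1 - b * w)) / w"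
    by (simp_all add: field_simps)
  with False show ?thesis by (simp add: spole_def inf_chart_def)
qed (simp add: spole_def inf_chart_def inverse_eq_divide)

lemma holo_at_spole: "q \<noteq> kap b s \<Longrightarrow> holo_at (spole b s) q"
proof (cases q)
  case (Fin z)
  assume "q \<noteq> kap b s"
  then have "1 - s * (z - b) \<noteq> 0"
    using Fin by (auto simp: kap_def field_simps split: if_splits)
  then have "(spole b s \<circ> Fin) analytic_on {z}"
    by (auto simp: spole_def o_def intro!: analytic_intros)
  then show ?thesis using Fin holo_at_chart[of Fin] by (simp add: charts_def)
next
  case Infty
  assume "q \<noteq> kap b s"
  then have "s \<noteq> 0" using Infty by (auto simp: kap_def)
  then have "(spole b s \<circ> inf_chart) analytic_on {0}"
    by (auto simp: spole_inf_chart o_def intro!: analytic_intros)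
  then have "holo_at (spole b s) (inf_chart 0)"
    by (subst holo_at_chart) (auto simp: charts_def)
  then show ?thesis using Infty by (simp add: inf_chart_def)
qed

lemma mero_spole: "mero (spole b s)"
  unfolding mero_def
proof
  fix c assume "c \<in> charts"
  moreover have "(spole b s \<circ> Fin) meromorphic_on UNIV"
    by (auto simp: spole_def o_def intro!: meromorphic_intros)
  moreover have "(spole b s \<circ> inf_chart) meromorphic_on UNIV"
    by (auto simp: spole_inf_chart o_def intro!: meromorphic_intros)
  ultimately show "(spole b s \<circ> c) meromorphic_on UNIV" by (auto simp: charts_def)
qed

lemma holo_at_poly: "holo_at f p \<Longrightarrow> holo_at (\<lambda>q. poly P (f q)) p"
  by (auto simp: holo_at_def o_def intro!: analytic_on_poly)

lemma mero_poly: "mero f \<Longrightarrow> mero (\<lambda>q. poly P (f q))"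
  by (auto simp: mero_def o_def intro!: meromorphic_on_poly)

lemma kap_local_chart:
  obtains c h where "c \<in> charts" "h analytic_on {u}" "kap b u = c (h u)"
    "\<forall>\<^sub>F v in nhds u. kap b v = c (h v)"
proof (cases "u = 0")
  case False
  have "\<forall>\<^sub>F v in nhds u. v \<noteq> 0" using False by (rule t1_space_nhds)
  then have ev: "\<forall>\<^sub>F v in nhds u. kap b v = Fin (b + inverse v)"
    by eventually_elim (simp add: kap_def)
  show ?thesis
    using False ev by (intro that[of Fin "\<lambda>v. b + inverse v"])
      (auto simp: charts_def kap_def intro!: analytic_intros)
next
  case True
  have "\<forall>\<^sub>F v in nhds 0. b * v + 1 \<in> - {0}"
  proof (rule topological_tendstoD)
    have "((\<lambda>v. b * v + 1) \<longlongrightarrow> b * 0 + 1) (nhds 0)" by (intro tendsto_intros filterlim_ident)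
    then show "((\<lambda>v. b * v + 1) \<longlongrightarrow> 1) (nhds 0)" by simp
  qed auto
  then have ev: "\<forall>\<^sub>F v in nhds 0. kap b v = inf_chart (v / (b * v + 1))"
    by eventually_elim (auto simp: kap_def inf_chart_def field_simps)
  show ?thesis
    using True ev by (intro that[of inf_chart "\<lambda>v. v / (b * v + 1)"])
      (auto simp: charts_def kap_def inf_chart_def intro!: analytic_intros)
qed

lemma holo_at_kap: 
  assumes "holo_at f (kap b u)" shows "(f \<circ> kap b) analytic_on {u}"
proof -
  obtain c h where c: "c \<in> charts" "h analytic_on {u}" "kap b u = c (h u)"
    "\<forall>\<^sub>F v in nhds u. kap b v = c (h v)"
    using kap_local_chart by metis
  have "((f \<circ> c) \<circ> h) analytic_on {u}"
    using assms c by (intro analytic_on_compose) (auto simp: holo_at_chart)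
  moreover have "\<forall>\<^sub>F v in nhds u. ((f \<circ> c) \<circ> h) v = (f \<circ> kap b) v"
    using c(4) by eventually_elim simp
  ultimately show ?thesis using analytic_at_cong by blast
qed

lemma mero_kap: 
  assumes "mero f" shows "(f \<circ> kap b) meromorphic_on UNIV"
proof (subst meromorphic_on_meromorphic_at, safe)
  fix u
  obtain c h where c: "c \<in> charts" "h analytic_on {u}" "kap b u = c (h u)"
    "\<forall>\<^sub>F v in nhds u. kap b v = c (h v)"
    using kap_local_chart by metis
  have "(\<lambda>v. (f \<circ> c) (h v)) meromorphic_on {u}"
    using assms c(1) by (intro meromorphic_on_compose[OF _ c(2) subset_UNIV]) (simp add: mero_def o_def)
  moreover have "\<forall>\<^sub>F v in at u. (f \<circ> kap b) v = (f \<circ> c) (h v)"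
    using c(4) by (auto simp: eventually_at_filter elim!: eventually_mono)
  ultimately show "(f \<circ> kap b) meromorphic_on {u}"
    using meromorphic_at_cong[of "f \<circ> kap b" "\<lambda>v. (f \<circ> c) (h v)" u] by blast
qed

text \<open>The inverse of \<open>kap b\<close>.\<close>

definition tau :: "complex \<Rightarrow> cproj \<Rightarrow> complex"
  where "tau b q = (case q of Fin z \<Rightarrow> inverse (z - b) | Infty \<Rightarrow> 0)"

lemma tau_kap: "tau b (kap b u) = u"
  by (simp add: tau_def kap_def)

lemma kap_tau: "q \<noteq> Fin b \<Longrightarrow> kap b (tau b q) = q"
  using kap_surj[of q b] by (auto simp: tau_kap)

lemma tau_inf_chart: "tau b (inf_chart w) = w / (1 - b * w)"
proof (cases "w = 0")
  case False
  then have "inverse w - b = (1 - b * w) / w" by (simp add: field_simps)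
  with False show ?thesis by (simp add: tau_def inf_chart_def)
qed (simp add: tau_def inf_chart_def)

lemma holo_at_tau: "q \<noteq> Fin b \<Longrightarrow> holo_at (tau b) q"
proof (cases q)
  case (Fin z)
  assume "q \<noteq> Fin b"
  then have "(tau b \<circ> Fin) analytic_on {z}"
    using Fin by (auto simp: tau_def o_def intro!: analytic_intros)
  then show ?thesis using Fin holo_at_chart[of Fin] by (simp add: charts_def)
next
  case Infty
  have "(tau b \<circ> inf_chart) analytic_on {0}"
    by (auto simp: tau_inf_chart o_def intro!: analytic_intros)
  then have "holo_at (tau b) (inf_chart 0)"
    by (subst holo_at_chart) (auto simp: charts_def)
  then show ?thesis using Infty by (simp add: inf_chart_def)
qed

lemma eventually_kap:
  assumes "\<forall>\<^sub>F q in nhds (kap b u). P q"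
  shows "\<forall>\<^sub>F v in nhds u. P (kap b v)"
proof -
  obtain c h where c: "c \<in> charts" "h analytic_on {u}" "kap b u = c (h u)"
    "\<forall>\<^sub>F v in nhds u. kap b v = c (h v)"
    using kap_local_chart by metis
  have "\<forall>\<^sub>F w in nhds (h u). P (c w)"
    using assms c by (simp add: eventually_nhds_chart)
  moreover have "filterlim h (nhds (h u)) (nhds u)"
    using analytic_at_imp_isCont[OF c(2)] by (simp add: isCont_def tendsto_at_iff_tendsto_nhds)
  ultimately have "\<forall>\<^sub>F v in nhds u. P (c (h v))"
    by (rule eventually_compose_filterlim)
  with c(4) show ?thesis by eventually_elim simp
qed

lemma open_vimage_kap:
  assumes "open S" shows "open (kap b -` S)"
proof (subst open_subopen, intro ballI)
  fix u assume "u \<in> kap b -` S"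
  then have "\<forall>\<^sub>F q in nhds (kap b u). q \<in> S"
    using assms by (intro eventually_nhds_in_open) auto
  then have "\<forall>\<^sub>F v in nhds u. kap b v \<in> S" by (rule eventually_kap)
  then show "\<exists>T. open T \<and> u \<in> T \<and> T \<subseteq> kap b -` S"
    by (auto simp: eventually_nhds)
qed

lemma holo_at_imp_continuous_on: "(\<And>p. p \<in> S \<Longrightarrow> holo_at f p) \<Longrightarrow> continuous_on S f"
  unfolding continuous_on_def using holo_at_tendsto tendsto_within_subset by blast

lemma connected_vimage_kap:
  assumes "connected S" "Fin b \<notin> S"
  shows "connected (kap b -` S)"
proof -
  have "kap b -` S = tau b ` S"
  proof (intro equalityI subsetI)
    fix u assume "u \<in> kap b -` S"
    then show "u \<in> tau b ` S" by (intro image_eqI[of _ _ "kap b u"]) (auto simp: tau_kap)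
  next
    fix u assume "u \<in> tau b ` S"
    then obtain q where "q \<in> S" "u = tau b q" by blast
    moreover from this have "q \<noteq> Fin b" using assms(2) by auto
    ultimately show "u \<in> kap b -` S" by (simp add: kap_tau)
  qed
  moreover have "continuous_on S (tau b)"
    using assms(2) by (intro holo_at_imp_continuous_on holo_at_tau) auto
  ultimately show ?thesis using assms(1) connected_continuous_image by metis
qed

section \<open>Meromorphic functions on the projective line are rational\<close>

text \<open>The coordinate \<open>kap b\<close> puts the regular point \<open>b\<close> at infinity, so that the planar expansion applies:
  \<open>f\<close> has a limit there, and its poles are finitely many since they are discrete and bounded.\<close>

lemma rational_expansion:
  assumes "mero f" "holo_at f (Fin b)"
  obtains S P a where "finite S" "\<And>s. s \<in> S \<Longrightarrow> \<not> holo_at f (kap b s)"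
    "\<And>q. holo_at f q \<Longrightarrow> f q = a + (\<Sum>s\<in>S. poly (P s) (spole b s q))"
proof -
  define G where "G = f \<circ> kap b"
  define S where "S = {u. \<not> G analytic_on {u}}"
  have nholo: "\<not> holo_at f (kap b s)" if "s \<in> S" for s
    using that holo_at_kap by (auto simp: S_def G_def)
  have mer: "G meromorphic_on UNIV" unfolding G_def by (rule mero_kap[OF assms(1)])
  have inv: "((\<lambda>u. b + inverse u) \<longlongrightarrow> b) at_infinity"
    using tendsto_add[OF tendsto_const tendsto_inverse_0, of b] by simp
  have ev: "\<forall>\<^sub>F u in at_infinity. kap b u = Fin (b + inverse u)"
    unfolding eventually_at_infinity by (rule exI[of _ 1]) (auto simp: kap_def)
  have "\<forall>\<^sub>F v in nhds b. holo_at f (Fin v)"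
    using holo_at_eventually[OF assms(2)] by (simp add: eventually_nhds_chart charts_def)
  then have "\<forall>\<^sub>F u in at_infinity. holo_at f (Fin (b + inverse u))"
    using inv by (rule eventually_compose_filterlim)
  with ev have "\<forall>\<^sub>F u in at_infinity. holo_at f (kap b u)"
    by eventually_elim simp
  then obtain R where R: "\<And>u. R \<le> norm u \<Longrightarrow> holo_at f (kap b u)"
    by (auto simp: eventually_at_infinity)
  have "finite (cball 0 R \<inter> {u. \<not> G analytic_on {u}})"
    using meromorphic_on_imp_sparse_singularities[OF mer] 
    by (intro sparse_in_compact_finite) (auto intro: sparse_in_subset)
  moreover have "S \<subseteq> cball 0 R \<inter> {u. \<not> G analytic_on {u}}"
    using R nholo by (force simp: S_def)
  ultimately have fin: "finite S" using finite_subset by blast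
  have "isCont (f \<circ> Fin) b"
    using assms(2) holo_at_chart[of Fin f b] analytic_at_imp_isCont by (simp add: charts_def)
  from isCont_tendsto_compose[OF this inv] 
  have "((\<lambda>u. f (Fin (b + inverse u))) \<longlongrightarrow> f (Fin b)) at_infinity" by simp
  moreover have "\<forall>\<^sub>F u in at_infinity. f (Fin (b + inverse u)) = G u"
    using ev by eventually_elim (simp add: G_def)
  ultimately have "(G \<longlongrightarrow> f (Fin b)) at_infinity"
    by (rule Lim_transform_eventually)
  from partial_fractions[OF fin _ _ this] mer obtain P where P:
    "\<And>u. u \<notin> S \<Longrightarrow> G u = f (Fin b) + (\<Sum>s\<in>S. poly (P s) (inverse (u - s)))"
    "\<And>s. s \<in> S \<Longrightarrow> coeff (P s) 0 = 0"
    using meromorphic_on_subset[OF mer] by (auto simp: S_def)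
  have "f q = f (Fin b) + (\<Sum>s\<in>S. poly (P s) (spole b s q))" if "holo_at f q" for q
  proof (cases "q = Fin b")
    case True
    then show ?thesis using P(2) by (simp add: spole_base poly_0_coeff_0)
  next
    case False
    then obtain u where u: "q = kap b u" using kap_surj by blast
    then have "u \<notin> S" using that nholo by blast
    from P(1)[OF this] show ?thesis by (simp add: u spole_kap G_def)
  qed
  with fin nholo show ?thesis by (rule that)
qed

text \<open>Sort the partial fractions by the position of their poles.\<close>

lemma scalar_split:
  assumes "mero f" "holo_at f (Fin b)" "\<And>p. p \<notin> D \<Longrightarrow> p \<notin> E \<Longrightarrow> holo_at f p"
  obtains f1 f2 where "mero f1" "mero f2" "\<And>p. p \<notin> D \<Longrightarrow> holo_at f1 p" "\<And>p. p \<notin> E \<Longrightarrow> holo_at f2 p"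
    "\<And>q. holo_at f q \<Longrightarrow> f q = f1 q + f2 q"
proof -
  obtain S P a where S: "finite S" "\<And>s. s \<in> S \<Longrightarrow> \<not> holo_at f (kap b s)"
    "\<And>q. holo_at f q \<Longrightarrow> f q = a + (\<Sum>s\<in>S. poly (P s) (spole b s q))"
    using rational_expansion[OF assms(1,2)] by metis
  \<comment> \<open>the poles in \<open>D\<close>; the constant term goes with them\<close>
  define T where "T = {s\<in>S. kap b s \<in> D}"
  define f1 where "f1 = (\<lambda>q. a + (\<Sum>s\<in>T. poly (P s) (spole b s q)))"
  define f2 where "f2 = (\<lambda>q. \<Sum>s\<in>S - T. poly (P s) (spole b s q))"
  show ?thesis
  proof
    show "mero f1" "mero f2"
      unfolding f1_def f2_def by (intro mero_add mero_const mero_sum mero_poly mero_spole)+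
    show "holo_at f1 p" if "p \<notin> D" for p
      unfolding f1_def using that
      by (intro holo_at_add holo_at_const holo_at_sum holo_at_poly holo_at_spole) (auto simp: T_def)
    show "holo_at f2 p" if "p \<notin> E" for p
      unfolding f2_def using that assms(3) S(2)
      by (intro holo_at_sum holo_at_poly holo_at_spole) (auto simp: T_def)
    show "f q = f1 q + f2 q" if "holo_at f q" for q
    proof -
      have "T \<subseteq> S" by (auto simp: T_def)
      then show ?thesis
        using S(3)[OF that] sum.subset_diff[OF _ S(1), of T "\<lambda>s. poly (P s) (spole b s q)"]
        by (simp add: f1_def f2_def)
    qed
  qed
qed

lemma mero_maps_split:
  fixes \<mu> :: "cproj \<Rightarrow> 'g::complex_vector_space"
  assumes "\<mu> \<in> maps_regular_on F" "Fin b \<in> F" "- F \<subseteq> D \<union> E"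
  obtains \<mu>1 \<mu>2 where "\<mu>1 \<in> maps_regular_on (- D)" "\<mu>2 \<in> maps_regular_on (- E)" "\<mu> = madd \<mu>1 \<mu>2"
proof -
  obtain A where A: "finite A" "\<And>q. \<mu> q = (\<Sum>b\<in>A. coord b (\<mu> q) *\<^sub>C b)" "\<And>b. mero (\<lambda>q. coord b (\<mu> q))"
    "\<And>b p. regular_at \<mu> p \<Longrightarrow> holo_at (\<lambda>q. coord b (\<mu> q)) p"
    using maps_regular_on_pre_mero[OF assms(1)] by (rule pre_mero_expand) blast
  have holo: "holo_at (\<lambda>q. coord v (\<mu> q)) p" if "p \<in> F" for v p
    using A(4) maps_regular_onD[OF assms(1) that] by blast
  have "\<exists>f1 f2. mero f1 \<and> mero f2 \<and> (\<forall>p. p \<notin> D \<longrightarrow> holo_at f1 p) \<and> (\<forall>p. p \<notin> E \<longrightarrow> holo_at f2 p)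
      \<and> (\<forall>q. holo_at (\<lambda>q. coord v (\<mu> q)) q \<longrightarrow> coord v (\<mu> q) = f1 q + f2 q)" for v
    by (rule scalar_split[OF A(3)[of v] holo[OF assms(2)], of D E]) (use assms(3) holo in blast)+
  then obtain f1 f2 where f: "\<And>v. mero (f1 v)" "\<And>v. mero (f2 v)"
    "\<And>v p. p \<notin> D \<Longrightarrow> holo_at (f1 v) p" "\<And>v p. p \<notin> E \<Longrightarrow> holo_at (f2 v) p"
    "\<And>v q. holo_at (\<lambda>q. coord v (\<mu> q)) q \<Longrightarrow> coord v (\<mu> q) = f1 v q + f2 v q"
    by metis
  define \<kappa>1 where "\<kappa>1 = (\<lambda>q. \<Sum>v\<in>A. f1 v q *\<^sub>C v)"
  define \<kappa>2 where "\<kappa>2 = (\<lambda>q. \<Sum>v\<in>A. f2 v q *\<^sub>C v)"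
  have pre: "pre_mero \<kappa>1" "pre_mero \<kappa>2"
    unfolding \<kappa>1_def \<kappa>2_def by (intro pre_mero_sum A f)+
  have mem: "fill_in \<kappa>1 \<in> maps_regular_on (- D)" "fill_in \<kappa>2 \<in> maps_regular_on (- E)"
    using pre by (auto intro!: fill_in_maps_regular_on simp: \<kappa>1_def \<kappa>2_def regular_at_sum f)
  have mm: "\<mu> \<in> mero_maps" "fill_in \<kappa>1 \<in> mero_maps" "fill_in \<kappa>2 \<in> mero_maps"
    using assms(1) by (auto simp: maps_regular_on_def pre fill_in_mero_maps)
  have "\<mu> = madd (fill_in \<kappa>1) (fill_in \<kappa>2)"
  proof (rule mero_maps_eqI)
    fix p
    have "\<forall>\<^sub>F q in at p. regular_at \<mu> q"
      "\<forall>\<^sub>F q in at p. fill_in \<kappa>1 q = \<kappa>1 q" "\<forall>\<^sub>F q in at p. fill_in \<kappa>2 q = \<kappa>2 q"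
      "\<forall>\<^sub>F q in at p. madd (fill_in \<kappa>1) (fill_in \<kappa>2) q = fill_in \<kappa>1 q + fill_in \<kappa>2 q"
      by (intro pre_mero_eventually_regular fill_in_eventually madd_eventually pre mero_maps_pre mm)+
    then show "\<forall>\<^sub>F q in at p. \<mu> q = madd (fill_in \<kappa>1) (fill_in \<kappa>2) q"
    proof eventually_elim
      case (elim q)
      have "\<mu> q = (\<Sum>v\<in>A. (f1 v q + f2 v q) *\<^sub>C v)"
        by (subst A(2)) (use f(5) A(4) elim(1) in \<open>auto intro!: sum.cong\<close>)
      then show ?case
        using elim by (simp add: \<kappa>1_def \<kappa>2_def cvs.scale_left_distrib sum.distrib)
    qed
  qed (intro mm mero_maps_madd)+
  with mem show ?thesis by (rule that)
qed

section \<open>Differentiation along the boundary curve\<close>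

lemma curve_chart:
  assumes "positive_smooth_boundary D \<gamma>"
  obtains c e d where "c \<in> charts" "e > 0" "\<And>s. s \<in> {t - e<..<t + e} \<Longrightarrow> \<gamma> s = c (d 0 s)"
    "\<And>k s. s \<in> {t - e<..<t + e} \<Longrightarrow> (d k has_vector_derivative d (Suc k) s) (at s)"
    "d 1 t \<noteq> (0::complex)" "\<forall>\<^sub>F r in at_right 0. c (d 0 t + of_real r * (\<i> * d 1 t)) \<in> D"
  using assms unfolding positive_smooth_boundary_def by metis

text \<open>In a chart, \<open>f\<close> along the boundary is an analytic function of a smooth planar curve. The second derivative
  is used for the curves parallel to the boundary.\<close>

lemma boundary_local_derivatives:
  assumes psb: "positive_smooth_boundary D \<gamma>" and f: "holo_at f (\<gamma> t)"
  obtains g g' where "\<forall>\<^sub>F s in nhds t. ((\<lambda>s. f (\<gamma> s)) has_vector_derivative g s) (at s)"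
    "\<forall>\<^sub>F s in nhds t. (g has_vector_derivative g' s) (at s)" "isCont g' t"
proof -
  obtain c e d where d: "c \<in> charts" "e > 0" "\<And>s. s \<in> {t - e<..<t + e} \<Longrightarrow> \<gamma> s = c (d 0 s)"
    "\<And>k s. s \<in> {t - e<..<t + e} \<Longrightarrow> (d k has_vector_derivative d (Suc k) s) (at s)"
    using curve_chart[OF psb, of t] by metis
  have t: "t \<in> {t - e<..<t + e}" using d(2) by simp
  have "(f \<circ> c) analytic_on {d 0 t}"
    using f d(3)[OF t] holo_at_chart[OF d(1), of f "d 0 t"] by simp
  then obtain A where A: "open A" "d 0 t \<in> A" "(f \<circ> c) holomorphic_on A"
    by (auto simp: analytic_at)
  have A': "deriv (f \<circ> c) holomorphic_on A" "deriv (deriv (f \<circ> c)) holomorphic_on A"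
    using A by (auto intro!: holomorphic_deriv)
  define g where "g = (\<lambda>s. d 1 s * deriv (f \<circ> c) (d 0 s))"
  define g' where "g' = (\<lambda>s. d 1 s * (d 1 s * deriv (deriv (f \<circ> c)) (d 0 s)) + d 2 s * deriv (f \<circ> c) (d 0 s))"
  have cont: "isCont (d k) s" if "s \<in> {t - e<..<t + e}" for k s
    using d(4)[OF that] has_vector_derivative_continuous by blast
  have "\<forall>\<^sub>F s in nhds t. d 0 s \<in> A"
    using topological_tendstoD[OF _ A(1,2), of "d 0" "nhds t"] cont[OF t, of 0]
    by (simp add: isCont_def tendsto_at_iff_tendsto_nhds)
  moreover have "\<forall>\<^sub>F s in nhds t. s \<in> {t - e<..<t + e}"
    using t by (intro eventually_nhds_in_open) auto
  ultimately have ev: "\<forall>\<^sub>F s in nhds t. d 0 s \<in> A \<and> s \<in> {t - e<..<t + e}"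
    by eventually_elim simp
  have chain: "((\<lambda>s. F (d 0 s)) has_vector_derivative d 1 s * deriv F (d 0 s)) (at s)"
    if "F holomorphic_on A" "d 0 s \<in> A" "s \<in> {t - e<..<t + e}" for F s
  proof -
    have fd: "(F has_field_derivative deriv F (d 0 s)) (at (d 0 s))"
      using that A by (intro holomorphic_derivI)
    show ?thesis
      using field_vector_diff_chain_at[OF d(4)[OF that(3), of 0] fd] by (simp add: o_def)
  qed
  show ?thesis
  proof (rule that)
    show "\<forall>\<^sub>F s in nhds t. ((\<lambda>s. f (\<gamma> s)) has_vector_derivative g s) (at s)"
      using ev
    proof eventually_elim
      case (elim s)
      then have "((\<lambda>s. (f \<circ> c) (d 0 s)) has_vector_derivative g s) (at s)"
        unfolding g_def by (intro chain A) auto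
      then show ?case
        by (rule has_vector_derivative_transform_within_open[of _ _ _ "{t - e<..<t + e}"])
           (use elim d(3) in auto)
    qed
    show "\<forall>\<^sub>F s in nhds t. (g has_vector_derivative g' s) (at s)"
      using ev
    proof eventually_elim
      case (elim s)
      have "(d 1 has_vector_derivative d 2 s) (at s)"
        using d(4)[of s 1] elim by (simp add: numeral_2_eq_2)
      then show ?case
        unfolding g_def g'_def using elim by (intro has_vector_derivative_mult chain A') auto
    qed
    have "isCont F (d 0 t)" if "F holomorphic_on A" for F
      using that A continuous_on_eq_continuous_at holomorphic_on_imp_continuous_on by blast
    then show "isCont g' t"
      unfolding g'_def using A'
      by (intro isCont_add isCont_mult cont[OF t] isCont_o2[OF cont[OF t]]) blast+
  qed
qed

lemma boundary_derivative:
  assumes psb: "positive_smooth_boundary D \<gamma>" and f: "\<And>p. p \<in> range \<gamma> \<Longrightarrow> holo_at f p"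
  defines "x \<equiv> \<lambda>t. f (\<gamma> t)" and "x' \<equiv> \<lambda>t. vector_derivative (\<lambda>s. f (\<gamma> s)) (at t)"
  shows "(x has_vector_derivative x' t) (at t)" and "continuous_on UNIV x'"
    and "(x' has_vector_derivative vector_derivative x' (at t)) (at t)"
    and "continuous_on UNIV (\<lambda>t. vector_derivative x' (at t))"
proof -
  have *: "\<exists>g. (\<forall>\<^sub>F s in nhds t. (x has_vector_derivative x' s) (at s))
      \<and> (\<forall>\<^sub>F s in nhds t. (x' has_vector_derivative g s) (at s)) \<and> isCont g t" for t
  proof -
    obtain g g' where g: "\<forall>\<^sub>F s in nhds t. (x has_vector_derivative g s) (at s)"
      "\<forall>\<^sub>F s in nhds t. (g has_vector_derivative g' s) (at s)" "isCont g' t"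
      using boundary_local_derivatives[OF psb, of f t] f unfolding x_def by blast
    have eq: "\<forall>\<^sub>F s in nhds t. x' s = g s"
      using g(1) by eventually_elim (simp add: x'_def x_def[symmetric] vector_derivative_at)
    then have "\<forall>\<^sub>F s in nhds t. \<forall>\<^sub>F r in nhds s. x' r = g r"
      by (simp add: eventually_eventually)
    with g(2) have "\<forall>\<^sub>F s in nhds t. (x' has_vector_derivative g' s) (at s)"
    proof eventually_elim
      case (elim s)
      then show ?case
        using has_vector_derivative_cong_ev[of UNIV x' g s] eventually_nhds_x_imp_x[OF elim(2)] by simp
    qed
    moreover from g(1) eq have "\<forall>\<^sub>F s in nhds t. (x has_vector_derivative x' s) (at s)"
      by eventually_elim simp
    ultimately show ?thesis using g(3) by blast
  qed
  show "(x has_vector_derivative x' t) (at t)"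
    using *[of t] eventually_nhds_x_imp_x by blast
  have x'': "(x' has_vector_derivative vector_derivative x' (at t)) (at t)" for t
    using *[of t] eventually_nhds_x_imp_x vector_derivative_at by (metis (no_types, lifting))
  then show "(x' has_vector_derivative vector_derivative x' (at t)) (at t)" .
  show "continuous_on UNIV x'"
    using has_vector_derivative_continuous[OF x''] by (intro continuous_at_imp_continuous_on) blast
  have "isCont (\<lambda>t. vector_derivative x' (at t)) t" for t
  proof -
    obtain g where g: "\<forall>\<^sub>F s in nhds t. (x' has_vector_derivative g s) (at s)" "isCont g t"
      using *[of t] by blast
    have "\<forall>\<^sub>F s in nhds t. vector_derivative x' (at s) = g s"
      using g(1) by eventually_elim (rule vector_derivative_at)
    then show ?thesis using g(2) by (simp add: isCont_cong)
  qed
  then show "continuous_on UNIV (\<lambda>t. vector_derivative x' (at t))"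
    by (intro continuous_at_imp_continuous_on) blast
qed

text \<open>Differentiability of a curve in a vector space without topology: every functional has a
  continuous derivative along the curve, and finite rank makes this a condition on finitely many coordinates.\<close>

definition curve_deriv :: "(real \<Rightarrow> 'g::complex_vector_space) \<Rightarrow> (real \<Rightarrow> 'g) \<Rightarrow> bool"
  where "curve_deriv X X' \<longleftrightarrow> finite_rank X \<and> finite_rank X' \<and> (\<forall>l. functional l \<longrightarrow>
    (\<forall>t. ((\<lambda>s. l (X s)) has_vector_derivative l (X' t)) (at t)) \<and> continuous_on UNIV (\<lambda>t. l (X' t)))"

definition cbilinear :: "('g::complex_vector_space \<Rightarrow> 'g \<Rightarrow> complex) \<Rightarrow> bool"
  where "cbilinear \<beta> \<longleftrightarrow> (\<forall>x. functional (\<beta> x)) \<and> (\<forall>y. functional (\<lambda>x. \<beta> x y))"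

lemma cbilinear_expand:
  assumes "cbilinear \<beta>"
  shows "\<beta> (\<Sum>a\<in>A. f a *\<^sub>C a) (\<Sum>b\<in>B. g b *\<^sub>C b) = (\<Sum>a\<in>A. \<Sum>b\<in>B. f a * g b * \<beta> a b)"
proof -
  have l: "functional (\<beta> x)" and r: "functional (\<lambda>x. \<beta> x y)" for x y
    using assms by (auto simp: cbilinear_def)
  show ?thesis
    by (simp add: functional_sum[OF r] functional_scale[OF r] functional_sum[OF l] functional_scale[OF l]
        sum_distrib_left mult.assoc mult.left_commute sum.swap[of _ A B])
qed

lemma curve_derivD:
  assumes "curve_deriv X X'" "functional l"
  shows "((\<lambda>s. l (X s)) has_vector_derivative l (X' t)) (at t)"
    and "continuous_on UNIV (\<lambda>t. l (X' t))" "continuous_on UNIV (\<lambda>t. l (X t))"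
proof -
  show *: "((\<lambda>s. l (X s)) has_vector_derivative l (X' t)) (at t)" for t
    using assms unfolding curve_deriv_def by blast
  show "continuous_on UNIV (\<lambda>t. l (X' t))"
    using assms unfolding curve_deriv_def by blast
  show "continuous_on UNIV (\<lambda>t. l (X t))"
    using has_vector_derivative_continuous[OF *] by (intro continuous_at_imp_continuous_on) blast
qed

lemma curve_deriv_expand:
  assumes "curve_deriv X X'"
  obtains A where "finite A" "\<And>t. X t = (\<Sum>b\<in>A. coord b (X t) *\<^sub>C b)" "\<And>t. X' t = (\<Sum>b\<in>A. coord b (X' t) *\<^sub>C b)"
proof -
  have "finite_rank X" "finite_rank X'" using assms unfolding curve_deriv_def by blast+
  then show ?thesis using that by (rule finite_rank_expand2)
qed

text \<open>The Leibniz rule. Expanded in coordinates, an arbitrary bilinear map becomes a finite sum of products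
  of scalar functions.\<close>

lemma curve_deriv_bilinear:
  assumes X: "curve_deriv X X'" and Y: "curve_deriv Y Y'" and \<beta>: "cbilinear \<beta>"
  shows "((\<lambda>s. \<beta> (X s) (Y s)) has_vector_derivative \<beta> (X' t) (Y t) + \<beta> (X t) (Y' t)) (at t)"
    and "continuous_on UNIV (\<lambda>t. \<beta> (X' t) (Y t) + \<beta> (X t) (Y' t))"
    and "continuous_on UNIV (\<lambda>t. \<beta> (X t) (Y' t))"
proof -
  obtain A where A: "finite A" "\<And>t. X t = (\<Sum>b\<in>A. coord b (X t) *\<^sub>C b)" "\<And>t. X' t = (\<Sum>b\<in>A. coord b (X' t) *\<^sub>C b)"
    using X by (rule curve_deriv_expand) blast
  obtain B where B: "finite B" "\<And>t. Y t = (\<Sum>b\<in>B. coord b (Y t) *\<^sub>C b)" "\<And>t. Y' t = (\<Sum>b\<in>B. coord b (Y' t) *\<^sub>C b)"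
    using Y by (rule curve_deriv_expand) blast
  have eq: "\<beta> (X s) (Y t) = (\<Sum>a\<in>A. \<Sum>b\<in>B. coord a (X s) * coord b (Y t) * \<beta> a b)"
    "\<beta> (X' s) (Y t) = (\<Sum>a\<in>A. \<Sum>b\<in>B. coord a (X' s) * coord b (Y t) * \<beta> a b)"
    "\<beta> (X s) (Y' t) = (\<Sum>a\<in>A. \<Sum>b\<in>B. coord a (X s) * coord b (Y' t) * \<beta> a b)" for s t
    using cbilinear_expand[OF \<beta>, of "\<lambda>a. coord a (X s)" A "\<lambda>b. coord b (Y t)" B]
      cbilinear_expand[OF \<beta>, of "\<lambda>a. coord a (X' s)" A "\<lambda>b. coord b (Y t)" B]
      cbilinear_expand[OF \<beta>, of "\<lambda>a. coord a (X s)" A "\<lambda>b. coord b (Y' t)" B]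
    unfolding A(2,3)[symmetric] B(2,3)[symmetric] by blast+
  note dX = curve_derivD[OF X functional_coord] and dY = curve_derivD[OF Y functional_coord]
  have "((\<lambda>s. \<Sum>a\<in>A. \<Sum>b\<in>B. coord a (X s) * coord b (Y s) * \<beta> a b) has_vector_derivative
      (\<Sum>a\<in>A. \<Sum>b\<in>B. (coord a (X t) * coord b (Y' t) + coord a (X' t) * coord b (Y t)) * \<beta> a b)) (at t)"
    by (intro has_vector_derivative_sum has_vector_derivative_mult_left has_vector_derivative_mult dX dY)
  then show "((\<lambda>s. \<beta> (X s) (Y s)) has_vector_derivative \<beta> (X' t) (Y t) + \<beta> (X t) (Y' t)) (at t)"
    by (simp add: eq distrib_right sum.distrib add.commute)
  have 1: "continuous_on UNIV (\<lambda>t. \<beta> (X t) (Y' t))" and 2: "continuous_on UNIV (\<lambda>t. \<beta> (X' t) (Y t))"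
    unfolding eq by (intro continuous_intros dX dY)+
  then show "continuous_on UNIV (\<lambda>t. \<beta> (X' t) (Y t) + \<beta> (X t) (Y' t))"
    and "continuous_on UNIV (\<lambda>t. \<beta> (X t) (Y' t))"
    by (auto intro!: continuous_intros)
qed

lemma finite_rank_lie:
  assumes "finite_rank X" "finite_rank Y"
  shows "finite_rank (\<lambda>t. lie (X t) (Y t))"
proof -
  obtain A where A: "finite A" "\<And>t. X t = (\<Sum>b\<in>A. coord b (X t) *\<^sub>C b)" "\<And>t. Y t = (\<Sum>b\<in>A. coord b (Y t) *\<^sub>C b)"
    using assms by (rule finite_rank_expand2) blast
  have "(\<lambda>t. lie (X t) (Y t))
      = (\<lambda>t. \<Sum>x\<in>A \<times> A. (coord (fst x) (X t) * coord (snd x) (Y t)) *\<^sub>C lie (fst x) (snd x))"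
    by (subst A(2), subst A(3), subst lie_expand) (simp add: case_prod_unfold)
  then show ?thesis using A(1) by (simp add: finite_rank_sum)
qed

text \<open>A functional of the bracket is a bilinear map.\<close>

lemma curve_deriv_lie:
  assumes X: "curve_deriv X X'" and Y: "curve_deriv Y Y'"
  shows "curve_deriv (\<lambda>t. lie (X t) (Y t)) (\<lambda>t. lie (X' t) (Y t) + lie (X t) (Y' t))"
  unfolding curve_deriv_def
proof (intro conjI allI impI)
  show "finite_rank (\<lambda>t. lie (X t) (Y t))" "finite_rank (\<lambda>t. lie (X' t) (Y t) + lie (X t) (Y' t))"
    using X Y unfolding curve_deriv_def by (intro finite_rank_add finite_rank_lie; blast)+
  fix l :: "'a \<Rightarrow> complex" assume l: "functional l"
  have "cbilinear (\<lambda>x y. l (lie x y))"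
    unfolding cbilinear_def using l
    by (auto intro!: functionalI simp: lie_add_left lie_add_right lie_scaleC_left lie_scaleC_right
        functional_add[OF l] functional_scale[OF l])
  note b = curve_deriv_bilinear[OF X Y this]
  show "((\<lambda>s. l (lie (X s) (Y s))) has_vector_derivative l (lie (X' t) (Y t) + lie (X t) (Y' t))) (at t)" for t
    using b(1)[of t] by (simp add: functional_add[OF l])
  show "continuous_on UNIV (\<lambda>t. l (lie (X' t) (Y t) + lie (X t) (Y' t)))"
    using b(2) by (simp add: functional_add[OF l])
qed

lemma cbilinear_form: "cbilinear form"
  unfolding cbilinear_def
proof (intro conjI allI)
  show "functional (\<lambda>x. form x y)" for y :: 'a
    by (intro functionalI) (auto simp: form_add_left form_scaleC_left)
  moreover have "form x = (\<lambda>y. form y x)" for x :: 'a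
    by (rule ext) (rule form_commute)
  ultimately show "functional (form x)" for x :: 'a
    by metis
qed

lemma boundary_map_curve:
  assumes psb: "positive_smooth_boundary D \<gamma>" and \<alpha>: "\<alpha> \<in> maps_regular_on (range \<gamma>)"
  obtains \<alpha>' where "curve_deriv (\<lambda>t. \<alpha> (\<gamma> t)) \<alpha>'"
    "\<And>l t. functional l \<Longrightarrow> l (\<alpha>' t) = vector_derivative (\<lambda>s. l (\<alpha> (\<gamma> s))) (at t)"
proof -
  obtain A where A: "finite A" "\<And>q. \<alpha> q = (\<Sum>b\<in>A. coord b (\<alpha> q) *\<^sub>C b)"
    "\<And>b p. regular_at \<alpha> p \<Longrightarrow> holo_at (\<lambda>q. coord b (\<alpha> q)) p"
    using maps_regular_on_pre_mero[OF \<alpha>] by (rule pre_mero_expand) blast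
  have "holo_at (\<lambda>q. coord b (\<alpha> q)) p" if "p \<in> range \<gamma>" for b p
    using A(3) maps_regular_onD[OF \<alpha> that] by blast
  note bd = boundary_derivative[OF psb this]
  define x' where "x' = (\<lambda>b t. vector_derivative (\<lambda>s. coord b (\<alpha> (\<gamma> s))) (at t))"
  define \<alpha>' where "\<alpha>' = (\<lambda>t. \<Sum>b\<in>A. x' b t *\<^sub>C b)"
  have eq: "l (\<alpha> (\<gamma> t)) = (\<Sum>b\<in>A. coord b (\<alpha> (\<gamma> t)) * l b)" if l: "functional l" for l t
    by (subst A(2)) (simp add: functional_sum[OF l] functional_scale[OF l])
  have d: "((\<lambda>s. l (\<alpha> (\<gamma> s))) has_vector_derivative l (\<alpha>' t)) (at t)" if l: "functional l" for l t
    unfolding eq[OF l] \<alpha>'_def functional_sum[OF l] functional_scale[OF l] x'_def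
    by (intro has_vector_derivative_sum has_vector_derivative_mult_left bd) blast+
  have "curve_deriv (\<lambda>t. \<alpha> (\<gamma> t)) \<alpha>'"
    unfolding curve_deriv_def
  proof (intro conjI allI impI d)
    obtain B where "finite B" "range \<alpha> \<subseteq> cspan B"
      using maps_regular_on_pre_mero[OF \<alpha>] by (auto simp: pre_mero_def finite_rank_def)
    then show "finite_rank (\<lambda>t. \<alpha> (\<gamma> t))" unfolding finite_rank_def by blast
    show "finite_rank \<alpha>'" unfolding \<alpha>'_def by (rule finite_rank_sum[OF A(1)])
    show "continuous_on UNIV (\<lambda>t. l (\<alpha>' t))" if l: "functional l" for l
      unfolding \<alpha>'_def functional_sum[OF l] functional_scale[OF l] x'_def
      by (intro continuous_intros bd) blast+
  qed
  moreover have "l (\<alpha>' t) = vector_derivative (\<lambda>s. l (\<alpha> (\<gamma> s))) (at t)" if "functional l" for l t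
    using vector_derivative_at[OF d[OF that]] by simp
  ultimately show ?thesis by (rule that)
qed

section \<open>The boundary pairing\<close>

lemma boundary_pairing_eq:
  fixes \<nu> :: "cproj \<Rightarrow> 'a::quadratic_lie_algebra"
  assumes "curve_deriv (\<lambda>t. \<alpha> (\<gamma> t)) \<alpha>'"
  shows "boundary_pairing \<gamma> \<nu> \<alpha> = 1 / (2 * of_real pi * \<i>) * integral {0..1} (\<lambda>t. form (\<nu> (\<gamma> t)) (\<alpha>' t))"
proof -
  have "functional (form x)" for x :: 'a
    using cbilinear_form[where 'a = 'a] by (simp add: cbilinear_def)
  then have "vector_derivative (\<lambda>s. form x (\<alpha> (\<gamma> s))) (at t) = form x (\<alpha>' t)" for x t
    using curve_derivD(1)[OF assms] by (intro vector_derivative_at) blast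
  then show ?thesis by (simp add: boundary_pairing_def)
qed

definition loop_int :: "(real \<Rightarrow> cproj) \<Rightarrow> (cproj \<Rightarrow> complex) \<Rightarrow> (cproj \<Rightarrow> complex) \<Rightarrow> complex"
  where "loop_int \<gamma> f g = integral {0..1} (\<lambda>t. f (\<gamma> t) * vector_derivative (\<lambda>s. g (\<gamma> s)) (at t))"

lemma form_add_right: "form x (y + z) = form x y + form x z"
  by (metis form_add_left form_commute)

lemma form_uminus_right: "form x (- y) = - form x (y :: 'g::quadratic_lie_algebra)"
  using form_add_right[of x y "- y"] form_scaleC_left[of 0 0 x]
  by (simp add: form_commute[of x 0] eq_neg_iff_add_eq_0 add.commute)

context
  fixes D :: "cproj set" and \<gamma> :: "real \<Rightarrow> cproj"
  assumes psb: "positive_smooth_boundary D \<gamma>"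
begin

lemma pairing_integrable:
  assumes "curve_deriv X X'" "curve_deriv Y Y'"
  shows "(\<lambda>t. form (X t) (Y' t)) integrable_on {0..1}"
  by (intro integrable_continuous_real continuous_on_subset[OF curve_deriv_bilinear(3)[OF assms cbilinear_form]]) simp

lemma boundary_pairing_madd_left:
  assumes "\<mu> \<in> maps_regular_on (range \<gamma>)" "\<nu> \<in> maps_regular_on (range \<gamma>)" "\<alpha> \<in> maps_regular_on (range \<gamma>)"
  shows "boundary_pairing \<gamma> (madd \<mu> \<nu>) \<alpha> = boundary_pairing \<gamma> \<mu> \<alpha> + boundary_pairing \<gamma> \<nu> \<alpha>"
proof -
  obtain \<mu>' \<nu>' \<alpha>' where c: "curve_deriv (\<lambda>t. \<mu> (\<gamma> t)) \<mu>'" "curve_deriv (\<lambda>t. \<nu> (\<gamma> t)) \<nu>'" "curve_deriv (\<lambda>t. \<alpha> (\<gamma> t)) \<alpha>'"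
    using boundary_map_curve[OF psb] assms by metis
  have "madd \<mu> \<nu> (\<gamma> t) = \<mu> (\<gamma> t) + \<nu> (\<gamma> t)" for t
    using assms by (intro madd_regular maps_regular_onD) auto
  then show ?thesis
    unfolding boundary_pairing_eq[OF c(3)] form_add_left distrib_left[symmetric]
    by (simp add: form_add_left) (subst integral_add; use pairing_integrable c in blast)
qed

text \<open>The curve is closed.\<close>

lemma integral_boundary_exact:
  assumes "\<And>t. (F has_vector_derivative F' t) (at t)" "\<And>t. F (t + 1) = (F t :: complex)"
  shows "integral {0..1} F' = 0"
proof -
  have "(F' has_integral F 1 - F 0) {0..1}"
    by (rule fundamental_theorem_of_calculus) (auto intro: has_vector_derivative_at_within assms(1))
  then show ?thesis using assms(2)[of 0] by (simp add: integral_unique)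
qed

lemma \<gamma>_periodic: "\<gamma> (t + 1) = \<gamma> t"
  using psb by (simp add: positive_smooth_boundary_def)

text \<open>Integration by parts.\<close>

lemma boundary_pairing_antisym:
  assumes "\<mu> \<in> maps_regular_on (range \<gamma>)" "\<nu> \<in> maps_regular_on (range \<gamma>)"
  shows "boundary_pairing \<gamma> \<nu> \<mu> = - boundary_pairing \<gamma> \<mu> \<nu>"
proof -
  obtain \<mu>' \<nu>' where c: "curve_deriv (\<lambda>t. \<mu> (\<gamma> t)) \<mu>'" "curve_deriv (\<lambda>t. \<nu> (\<gamma> t)) \<nu>'"
    using boundary_map_curve[OF psb] assms by metis
  have "integral {0..1} (\<lambda>t. form (\<mu>' t) (\<nu> (\<gamma> t)) + form (\<mu> (\<gamma> t)) (\<nu>' t)) = 0"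
    by (rule integral_boundary_exact[OF curve_deriv_bilinear(1)[OF c cbilinear_form]]) (simp add: \<gamma>_periodic)
  also have "(\<lambda>t. form (\<mu>' t) (\<nu> (\<gamma> t))) = (\<lambda>t. form (\<nu> (\<gamma> t)) (\<mu>' t))"
    by (simp add: form_commute)
  then have "integral {0..1} (\<lambda>t. form (\<mu>' t) (\<nu> (\<gamma> t)) + form (\<mu> (\<gamma> t)) (\<nu>' t))
      = integral {0..1} (\<lambda>t. form (\<nu> (\<gamma> t)) (\<mu>' t)) + integral {0..1} (\<lambda>t. form (\<mu> (\<gamma> t)) (\<nu>' t))"
    using integral_add[OF pairing_integrable[OF c(2,1)] pairing_integrable[OF c]] by (simp add: fun_eq_iff)
  finally have "integral {0..1} (\<lambda>t. form (\<nu> (\<gamma> t)) (\<mu>' t)) = - integral {0..1} (\<lambda>t. form (\<mu> (\<gamma> t)) (\<nu>' t))"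
    by (simp add: eq_neg_iff_add_eq_0)
  then show ?thesis
    by (simp add: boundary_pairing_eq[OF c(1)] boundary_pairing_eq[OF c(2)])
qed

text \<open>The identity holds under the integral sign: by invariance of the form, the terms that contain the
  derivative of \<open>\<nu>\<close> cancel, and those with the derivative of \<open>\<alpha>\<close> agree.\<close>

lemma boundary_pairing_cocycle:
  assumes "\<mu> \<in> maps_regular_on (range \<gamma>)" "\<nu> \<in> maps_regular_on (range \<gamma>)" "\<alpha> \<in> maps_regular_on (range \<gamma>)"
  shows "boundary_pairing \<gamma> (mlie \<mu> \<nu>) \<alpha>
    = boundary_pairing \<gamma> \<mu> (mlie \<nu> \<alpha>) + boundary_pairing \<gamma> (mlie \<mu> \<alpha>) \<nu>"
proof -
  obtain \<mu>' \<nu>' \<alpha>' where c: "curve_deriv (\<lambda>t. \<mu> (\<gamma> t)) \<mu>'" "curve_deriv (\<lambda>t. \<nu> (\<gamma> t)) \<nu>'" "curve_deriv (\<lambda>t. \<alpha> (\<gamma> t)) \<alpha>'"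
    using boundary_map_curve[OF psb] assms by metis
  have br: "mlie \<mu> \<nu> (\<gamma> t) = lie (\<mu> (\<gamma> t)) (\<nu> (\<gamma> t))" "mlie \<nu> \<alpha> (\<gamma> t) = lie (\<nu> (\<gamma> t)) (\<alpha> (\<gamma> t))"
    "mlie \<mu> \<alpha> (\<gamma> t) = lie (\<mu> (\<gamma> t)) (\<alpha> (\<gamma> t))" for t
    using assms by (auto intro!: mlie_regular maps_regular_on_pre_mero intro: maps_regular_onD)
  have cna: "curve_deriv (\<lambda>t. mlie \<nu> \<alpha> (\<gamma> t)) (\<lambda>t. lie (\<nu>' t) (\<alpha> (\<gamma> t)) + lie (\<nu> (\<gamma> t)) (\<alpha>' t))"
    unfolding br by (intro curve_deriv_lie c)
  have cma: "curve_deriv (\<lambda>t. mlie \<mu> \<alpha> (\<gamma> t)) (\<lambda>t. lie (\<mu>' t) (\<alpha> (\<gamma> t)) + lie (\<mu> (\<gamma> t)) (\<alpha>' t))"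
    unfolding br by (intro curve_deriv_lie c)
  have alg: "form (lie m n) a' = form m (lie n' a + lie n a') + form (lie m a) n'" for m n n' a a'
    using form_invariant[of m n a'] form_invariant[of m a n'] lie_antisym[of a n']
    by (simp add: form_add_right form_uminus_right)
  have "integral {0..1} (\<lambda>t. form (mlie \<mu> \<nu> (\<gamma> t)) (\<alpha>' t))
      = integral {0..1} (\<lambda>t. form (\<mu> (\<gamma> t)) (lie (\<nu>' t) (\<alpha> (\<gamma> t)) + lie (\<nu> (\<gamma> t)) (\<alpha>' t)))
        + integral {0..1} (\<lambda>t. form (mlie \<mu> \<alpha> (\<gamma> t)) (\<nu>' t))"
    unfolding integral_add[OF pairing_integrable[OF c(1) cna] pairing_integrable[OF cma c(2)], symmetric]
    by (simp only: br alg[symmetric])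
  then show ?thesis
    unfolding boundary_pairing_eq[OF c(3)] boundary_pairing_eq[OF c(2)] boundary_pairing_eq[OF cna]
    by (simp only: distrib_left)
qed

text \<open>The coordinates of a map are regular wherever the map is; so it suffices to integrate
  \<open>f dg\<close> for scalar functions.\<close>

lemma boundary_pairing_zeroI:
  fixes \<mu> :: "cproj \<Rightarrow> 'g::quadratic_lie_algebra"
  assumes "\<mu> \<in> maps_regular_on S" "\<nu> \<in> maps_regular_on S" "range \<gamma> \<subseteq> S"
    and zero: "\<And>f g. mero f \<Longrightarrow> mero g \<Longrightarrow> (\<And>p. p \<in> S \<Longrightarrow> holo_at f p) \<Longrightarrow> (\<And>p. p \<in> S \<Longrightarrow> holo_at g p)
      \<Longrightarrow> loop_int \<gamma> f g = 0"
  shows "boundary_pairing \<gamma> \<mu> \<nu> = 0"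
proof -
  have reg: "\<mu> \<in> maps_regular_on (range \<gamma>)" "\<nu> \<in> maps_regular_on (range \<gamma>)"
    using assms(1-3) by (auto simp: maps_regular_on_def)
  obtain \<mu>' where cm: "curve_deriv (\<lambda>t. \<mu> (\<gamma> t)) \<mu>'"
    using boundary_map_curve[OF psb reg(1)] by metis
  obtain \<nu>' where cn: "curve_deriv (\<lambda>t. \<nu> (\<gamma> t)) \<nu>'"
    "\<And>l t. functional l \<Longrightarrow> l (\<nu>' t) = vector_derivative (\<lambda>s. l (\<nu> (\<gamma> s))) (at t)"
    using boundary_map_curve[OF psb reg(2)] by metis
  obtain A where A: "finite A" "\<And>t. \<mu> (\<gamma> t) = (\<Sum>b\<in>A. coord b (\<mu> (\<gamma> t)) *\<^sub>C b)"
    using cm by (rule curve_deriv_expand) blast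
  obtain B where B: "finite B" "\<And>t. \<nu>' t = (\<Sum>b\<in>B. coord b (\<nu>' t) *\<^sub>C b)"
    using cn(1) by (rule curve_deriv_expand) blast
  have "form (\<mu> (\<gamma> t)) (\<nu>' t) = (\<Sum>a\<in>A. \<Sum>b\<in>B. coord a (\<mu> (\<gamma> t)) * coord b (\<nu>' t) * form a b)" for t
    using cbilinear_expand[OF cbilinear_form, of "\<lambda>a. coord a (\<mu> (\<gamma> t))" A "\<lambda>b. coord b (\<nu>' t)" B]
    unfolding A(2)[symmetric] B(2)[symmetric] .
  moreover have int: "(\<lambda>t. coord a (\<mu> (\<gamma> t)) * coord b (\<nu>' t)) integrable_on {0..1}" for a b
    by (intro integrable_continuous_real continuous_intros continuous_on_subset[OF curve_derivD(3)[OF cm functional_coord]]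
        continuous_on_subset[OF curve_derivD(2)[OF cn(1) functional_coord]]) auto
  moreover have "integral {0..1} (\<lambda>t. coord a (\<mu> (\<gamma> t)) * coord b (\<nu>' t)) = 0" for a b
  proof -
    have "loop_int \<gamma> (\<lambda>q. coord a (\<mu> q)) (\<lambda>q. coord b (\<nu> q)) = 0"
      using assms(1,2) functional_coord
      by (intro zero) (auto simp: maps_regular_on_def mero_maps_iff pre_mero_def regular_at_iff)
    then show ?thesis by (simp add: loop_int_def cn(2)[OF functional_coord])
  qed
  ultimately have "integral {0..1} (\<lambda>t. form (\<mu> (\<gamma> t)) (\<nu>' t)) = 0"
    using A(1) B(1) by (simp add: integral_sum integrable_sum integrable_on_mult_left)
  then show ?thesis by (simp add: boundary_pairing_eq[OF cn(1)])
qed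

end

section \<open>Poles inside the curve\<close>

lemma pderiv_sum: "pderiv (\<Sum>i\<in>I. f i) = (\<Sum>i\<in>I. pderiv (f i))"
  by (induction I rule: infinite_finite_induct) (auto simp: pderiv_add)

lemma ex_antiderivative_poly: "\<exists>R. pderiv R = (P :: complex poly)"
proof
  have "pderiv (\<Sum>i\<le>degree P. monom (coeff P i / of_nat (Suc i)) (Suc i)) = (\<Sum>i\<le>degree P. monom (coeff P i) i)"
    by (simp add: pderiv_sum pderiv_monom del: of_nat_Suc)
  then show "pderiv (\<Sum>i\<le>degree P. monom (coeff P i / of_nat (Suc i)) (Suc i)) = P"
    by (simp add: poly_as_sum_of_monoms)
qed

context
  fixes D :: "cproj set" and \<gamma> :: "real \<Rightarrow> cproj"
  assumes psb: "positive_smooth_boundary D \<gamma>"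
begin

lemma loop_integrable:
  assumes "\<And>p. p \<in> range \<gamma> \<Longrightarrow> holo_at f p" "\<And>p. p \<in> range \<gamma> \<Longrightarrow> holo_at g p"
  shows "(\<lambda>t. f (\<gamma> t) * vector_derivative (\<lambda>s. g (\<gamma> s)) (at t)) integrable_on {0..1}"
proof -
  have "isCont (\<lambda>t. f (\<gamma> t)) t" for t
    using has_vector_derivative_continuous[OF boundary_derivative(1)[OF psb assms(1)]] by blast
  then have "continuous_on {0..1} (\<lambda>t. f (\<gamma> t))"
    by (intro continuous_at_imp_continuous_on) blast
  moreover have "continuous_on {0..1} (\<lambda>t. vector_derivative (\<lambda>s. g (\<gamma> s)) (at t))"
    using boundary_derivative(2)[OF psb assms(2)] continuous_on_subset by blast
  ultimately show ?thesis by (intro integrable_continuous_real continuous_intros)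
qed

lemma loop_int_sum_left:
  assumes "finite I" "\<And>i p. i \<in> I \<Longrightarrow> p \<in> range \<gamma> \<Longrightarrow> holo_at (f i) p" "\<And>p. p \<in> range \<gamma> \<Longrightarrow> holo_at g p"
  shows "loop_int \<gamma> (\<lambda>q. \<Sum>i\<in>I. f i q) g = (\<Sum>i\<in>I. loop_int \<gamma> (f i) g)"
  unfolding loop_int_def sum_distrib_right
  by (rule integral_sum[OF assms(1)]) (intro loop_integrable assms; assumption)

lemma loop_int_add_left:
  assumes "\<And>p. p \<in> range \<gamma> \<Longrightarrow> holo_at f p" "\<And>p. p \<in> range \<gamma> \<Longrightarrow> holo_at f' p" "\<And>p. p \<in> range \<gamma> \<Longrightarrow> holo_at g p"
  shows "loop_int \<gamma> (\<lambda>q. f q + f' q) g = loop_int \<gamma> f g + loop_int \<gamma> f' g"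
  unfolding loop_int_def distrib_right
  by (rule integral_add) (intro loop_integrable assms; assumption)+

lemma loop_int_swap:
  assumes f: "\<And>p. p \<in> range \<gamma> \<Longrightarrow> holo_at f p" and g: "\<And>p. p \<in> range \<gamma> \<Longrightarrow> holo_at g p"
  shows "loop_int \<gamma> f g = - loop_int \<gamma> g f"
proof -
  note df = boundary_derivative(1)[OF psb f] and dg = boundary_derivative(1)[OF psb g]
  have "integral {0..1} (\<lambda>t. f (\<gamma> t) * vector_derivative (\<lambda>s. g (\<gamma> s)) (at t)
      + vector_derivative (\<lambda>s. f (\<gamma> s)) (at t) * g (\<gamma> t)) = 0"
    by (rule integral_boundary_exact[OF psb, OF has_vector_derivative_mult[OF df dg]])
       (simp_all add: \<gamma>_periodic[OF psb])
  also have "(\<lambda>t. f (\<gamma> t) * vector_derivative (\<lambda>s. g (\<gamma> s)) (at t)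
      + vector_derivative (\<lambda>s. f (\<gamma> s)) (at t) * g (\<gamma> t))
    = (\<lambda>t. f (\<gamma> t) * vector_derivative (\<lambda>s. g (\<gamma> s)) (at t)
      + g (\<gamma> t) * vector_derivative (\<lambda>s. f (\<gamma> s)) (at t))"
    by (simp add: mult.commute)
  finally have "loop_int \<gamma> f g + loop_int \<gamma> g f = 0"
    unfolding loop_int_def using integral_add[OF loop_integrable[OF f g] loop_integrable[OF g f]] by simp
  then show ?thesis by (simp add: eq_neg_iff_add_eq_0)
qed

lemma loop_int_const_left:
  assumes g: "\<And>p. p \<in> range \<gamma> \<Longrightarrow> holo_at g p"
  shows "loop_int \<gamma> (\<lambda>_. a) g = 0"
  unfolding loop_int_def
  by (rule integral_boundary_exact[OF psb, of "\<lambda>t. a * g (\<gamma> t)"])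
     (auto intro!: has_vector_derivative_mult_right boundary_derivative[OF psb g] simp: \<gamma>_periodic[OF psb])

lemma loop_int_cong:
  "(\<And>p. p \<in> range \<gamma> \<Longrightarrow> f p = f' p) \<Longrightarrow> (\<And>p. p \<in> range \<gamma> \<Longrightarrow> g p = g' p) \<Longrightarrow> loop_int \<gamma> f g = loop_int \<gamma> f' g'"
  by (simp add: loop_int_def)

text \<open>The form is the differential of a polynomial in \<open>e\<close>.\<close>

lemma loop_int_same:
  assumes e: "\<And>p. p \<in> range \<gamma> \<Longrightarrow> holo_at e p"
  shows "loop_int \<gamma> (\<lambda>q. poly P (e q)) (\<lambda>q. poly Q (e q)) = 0"
proof -
  note de = boundary_derivative(1)[OF psb e]
  have chain: "((\<lambda>s. poly R (e (\<gamma> s))) has_vector_derivative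
      vector_derivative (\<lambda>s. e (\<gamma> s)) (at t) * poly (pderiv R) (e (\<gamma> t))) (at t)" for R t
    using field_vector_diff_chain_at[OF de poly_DERIV[of R "e (\<gamma> t)"]] by (simp add: o_def)
  obtain R where R: "pderiv R = P * pderiv Q" using ex_antiderivative_poly by blast
  have "poly P (e (\<gamma> t)) * vector_derivative (\<lambda>s. poly Q (e (\<gamma> s))) (at t)
      = vector_derivative (\<lambda>s. e (\<gamma> s)) (at t) * poly (pderiv R) (e (\<gamma> t))" for t
    using vector_derivative_at[OF chain[of Q t]] by (simp add: R)
  then have "loop_int \<gamma> (\<lambda>q. poly P (e q)) (\<lambda>q. poly Q (e q))
      = integral {0..1} (\<lambda>t. vector_derivative (\<lambda>s. e (\<gamma> s)) (at t) * poly (pderiv R) (e (\<gamma> t)))"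
    by (simp add: loop_int_def)
  also have "\<dots> = 0"
    by (rule integral_boundary_exact[OF psb chain]) (simp add: \<gamma>_periodic[OF psb])
  finally show ?thesis .
qed

lemma loop_int_uniform_limit:
  assumes f: "\<And>n p. p \<in> range \<gamma> \<Longrightarrow> holo_at (f n) p" and g: "\<And>p. p \<in> range \<gamma> \<Longrightarrow> holo_at g p"
    and lim: "uniform_limit (range \<gamma>) f h sequentially" and zero: "\<And>n. loop_int \<gamma> (f n) g = 0"
  shows "loop_int \<gamma> h g = 0"
proof -
  define v where "v = (\<lambda>t. vector_derivative (\<lambda>s. g (\<gamma> s)) (at t))"
  have contv: "continuous_on {0..1} v"
    unfolding v_def using boundary_derivative(2)[OF psb g] continuous_on_subset by blast
  have contf: "continuous_on {0..1} (\<lambda>t. f n (\<gamma> t))" for n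
    using has_vector_derivative_continuous[OF boundary_derivative(1)[OF psb f]]
    by (intro continuous_at_imp_continuous_on) blast
  have u: "uniform_limit {0..1} (\<lambda>n t. f n (\<gamma> t)) (\<lambda>t. h (\<gamma> t)) sequentially"
    using lim unfolding uniform_limit_iff by (auto elim!: eventually_mono)
  have conth: "continuous_on {0..1} (\<lambda>t. h (\<gamma> t))"
    by (rule uniform_limit_theorem[OF _ u]) (simp_all add: contf)
  have "uniform_limit {0..1} (\<lambda>n t. f n (\<gamma> t) * v t) (\<lambda>t. h (\<gamma> t) * v t) sequentially"
    by (intro uniform_lim_mult u uniform_limit_const compact_imp_bounded compact_continuous_image conth contv)
       (auto)
  then obtain I Lv where I: "\<And>n. ((\<lambda>t. f n (\<gamma> t) * v t) has_integral I n) {0..1}"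
    "((\<lambda>t. h (\<gamma> t) * v t) has_integral Lv) {0..1}" "I \<longlonglongrightarrow> Lv"
    by (rule uniform_limit_integral) (auto intro!: continuous_intros contf contv)
  have "I n = 0" for n
    using zero[of n] integral_unique[OF I(1)[of n]] by (simp add: loop_int_def v_def)
  then have "Lv = 0" using I(3) LIMSEQ_unique[OF _ tendsto_const] by (metis (full_types) LIMSEQ_const_iff ext)
  then show ?thesis using integral_unique[OF I(2)] by (simp add: loop_int_def v_def)
qed

lemma range_disjoint: "open D \<Longrightarrow> range \<gamma> \<inter> D = {}"
  using psb by (auto simp: positive_smooth_boundary_def frontier_def interior_open)

lemma bounded_image_mult:
  assumes "bounded (f ` X)" "bounded (g ` X)"
  shows "bounded ((\<lambda>x. f x * g x :: complex) ` X)"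
proof -
  obtain A B where "\<And>x. x \<in> X \<Longrightarrow> norm (f x) \<le> A" "\<And>x. x \<in> X \<Longrightarrow> norm (g x) \<le> B"
    using assms by (auto simp: bounded_iff)
  then have "norm (f x * g x) \<le> \<bar>A\<bar> * \<bar>B\<bar>" if "x \<in> X" for x
    using that by (force simp: norm_mult intro!: mult_mono)
  then show ?thesis by (auto simp: bounded_iff)
qed

lemma uniform_limit_poly:
  assumes "uniform_limit X f h sequentially" "bounded (h ` X)"
  shows "uniform_limit X (\<lambda>n x. poly P (f n x)) (\<lambda>x. poly P (h x :: complex)) sequentially
    \<and> bounded ((\<lambda>x. poly P (h x)) ` X)"
proof (induction P)
  case 0
  then show ?case by (auto intro!: uniform_limit_const simp: image_constant_conv)
next
  case (pCons a P)
  have "bounded ((\<lambda>x. h x * poly P (h x)) ` X)"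
    using assms(2) pCons by (intro bounded_image_mult) auto
  then show ?case
    using assms pCons
    by (auto intro!: uniform_limit_add uniform_limit_const uniform_lim_mult bounded_plus_comp simp: image_constant_conv)
qed

text \<open>A point outside \<open>D\<close> has distance at least \<open>3 * \<epsilon>\<close> from \<open>s0\<close>, hence at least \<open>2 * \<epsilon>\<close> from \<open>s\<close>.\<close>

lemma spole_bound:
  assumes "\<And>v. dist s0 v < 3 * \<epsilon> \<Longrightarrow> kap b v \<in> D" "dist s0 s < \<epsilon>" "q \<notin> D" "\<epsilon> > 0"
  shows "norm (spole b s q) \<le> 1 / (2 * \<epsilon>)"
proof (cases "q = Fin b")
  case True
  then show ?thesis using assms(4) by (simp add: spole_base)
next
  case False
  then obtain u where u: "q = kap b u" using kap_surj by blast
  then have "dist s0 u \<ge> 3 * \<epsilon>" using assms(1,3) by force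
  then have "2 * \<epsilon> \<le> norm (u - s)"
    using assms(2) dist_triangle[of s0 u s] by (simp add: dist_norm norm_minus_commute)
  then have "inverse (norm (u - s)) \<le> inverse (2 * \<epsilon>)"
    using assms(4) by (intro le_imp_inverse_le) auto
  then show ?thesis by (simp add: u spole_kap norm_inverse norm_divide inverse_eq_divide)
qed

text \<open>With \<open>\<delta> = s' - s\<close> and \<open>e = spole b s\<close>, the function with its pole at \<open>s'\<close> is \<open>e / (1 - \<delta> * e)\<close>.
  The geometric series converges uniformly, because \<open>norm \<delta> < 2 * \<epsilon>\<close> and \<open>norm e\<close> is at most \<open>1 / (2 * \<epsilon>)\<close> outside \<open>D\<close>.\<close>

lemma spole_geometric_limit:
  assumes ball: "\<And>v. dist s0 v < 3 * \<epsilon> \<Longrightarrow> kap b v \<in> D" and \<epsilon>: "\<epsilon> > 0"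
    and s: "dist s0 s < \<epsilon>" and s': "dist s0 s' < \<epsilon>"
  shows "uniform_limit (- D) (\<lambda>N q. \<Sum>k<N. (s' - s) ^ k * spole b s q ^ Suc k) (spole b s') sequentially"
proof -
  define \<delta> where "\<delta> = s' - s"
  define \<rho> where "\<rho> = norm \<delta> * (1 / (2 * \<epsilon>))"
  have "norm \<delta> < 2 * \<epsilon>"
    using s s' dist_triangle_half_r[of s0 s "2 * \<epsilon>" s'] by (simp add: \<delta>_def dist_norm norm_minus_commute)
  then have \<rho>: "0 \<le> \<rho>" "\<rho> < 1" using \<epsilon> by (auto simp: \<rho>_def field_simps)
  have small: "norm (\<delta> * spole b s q) \<le> \<rho>" if "q \<in> - D" for q
    unfolding norm_mult \<rho>_def using spole_bound[OF ball s _ \<epsilon>, of q] that by (intro mult_left_mono) auto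
  have limit: "suminf (\<lambda>k. \<delta> ^ k * spole b s q ^ Suc k) = spole b s' q" if "q \<in> - D" for q
  proof -
    have lt: "norm (\<delta> * spole b s q) < 1" using small[OF that] \<rho> by simp
    have "(\<lambda>k. spole b s q * (\<delta> * spole b s q) ^ k) sums (spole b s q * (1 / (1 - \<delta> * spole b s q)))"
      by (intro sums_mult geometric_sums lt)
    moreover have "spole b s q * (\<delta> * spole b s q) ^ k = \<delta> ^ k * spole b s q ^ Suc k" for k
      by (simp add: power_mult_distrib)
    moreover have "spole b s q * (1 / (1 - \<delta> * spole b s q)) = spole b s' q"
    proof (cases "q = Fin b")
      case False
      then obtain u where u: "q = kap b u" using kap_surj by blast
      have "kap b s \<in> D" "kap b s' \<in> D" using ball s s' \<epsilon> by auto
      then have ne: "u \<noteq> s" "u \<noteq> s'" using that u by auto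
      then have "1 - \<delta> * inverse (u - s) = (u - s') / (u - s)" by (simp add: \<delta>_def field_simps)
      then show ?thesis using ne by (simp add: u spole_kap field_simps)
    qed (simp add: spole_base)
    ultimately show ?thesis by (metis (no_types, lifting) sums_unique sums_cong)
  qed
  have "uniform_limit (- D) (\<lambda>N q. \<Sum>k<N. \<delta> ^ k * spole b s q ^ Suc k)
      (\<lambda>q. suminf (\<lambda>k. \<delta> ^ k * spole b s q ^ Suc k)) sequentially"
  proof (rule Weierstrass_m_test[where M = "\<lambda>k. \<rho> ^ k * (1 / (2 * \<epsilon>))"])
    fix k q assume q: "q \<in> - D"
    have "norm (\<delta> ^ k * spole b s q ^ Suc k) = norm (\<delta> * spole b s q) ^ k * norm (spole b s q)"
      by (simp add: norm_mult norm_power power_mult_distrib)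
    also have "\<dots> \<le> \<rho> ^ k * (1 / (2 * \<epsilon>))"
      using small[OF q] spole_bound[OF ball s _ \<epsilon>, of q] q \<rho> by (intro mult_mono power_mono) auto
    finally show "norm (\<delta> ^ k * spole b s q ^ Suc k) \<le> \<rho> ^ k * (1 / (2 * \<epsilon>))" .
  next
    show "summable (\<lambda>k. \<rho> ^ k * (1 / (2 * \<epsilon>)))"
      using \<rho> by (intro summable_mult2 summable_geometric) auto
  qed
  then show ?thesis
    unfolding \<delta>_def[symmetric] uniform_limit_iff by (simp only: limit cong: ball_cong)
qed

text \<open>The pole \<open>s\<close> is moved to \<open>r\<close> inside the connected set \<open>D\<close>. That the integral vanishes for all polynomials \<open>P\<close>
  is a locally constant property of \<open>s\<close>, and it holds for \<open>s = r\<close>.\<close>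

lemma loop_int_two_poles:
  assumes "open D" "connected D" and b: "Fin b \<notin> D" and s: "kap b s \<in> D" and r: "kap b r \<in> D"
  shows "loop_int \<gamma> (\<lambda>q. poly P (spole b s q)) (\<lambda>q. poly Q (spole b r q)) = 0"
proof -
  have rng: "range \<gamma> \<subseteq> - D" using range_disjoint[OF assms(1)] by blast
  have holo: "holo_at (\<lambda>q. poly P (spole b v q)) p" if "kap b v \<in> D" "p \<in> range \<gamma>" for P v p
    using that rng by (intro holo_at_poly holo_at_spole) auto
  let ?D1 = "kap b -` D"
  let ?T = "\<lambda>v. \<forall>P. loop_int \<gamma> (\<lambda>q. poly P (spole b v q)) (\<lambda>q. poly Q (spole b r q)) = 0"
  have "?T s"
  proof (rule connected_induction_simple[of ?D1 r s])
    show "connected ?D1" by (rule connected_vimage_kap[OF assms(2) b])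
    show "r \<in> ?D1" "s \<in> ?D1" using s r by auto
    show "?T r"
      using r rng by (intro allI loop_int_same holo_at_spole) auto
  next
    fix s0 assume "s0 \<in> ?D1"
    then obtain e where e: "e > 0" "ball s0 e \<subseteq> ?D1"
      using open_vimage_kap[OF assms(1)] open_contains_ball by blast
    define \<epsilon> where "\<epsilon> = e / 3"
    have \<epsilon>: "\<epsilon> > 0" and ball: "dist s0 v < 3 * \<epsilon> \<Longrightarrow> kap b v \<in> D" for v
      using e by (auto simp: \<epsilon>_def subset_iff)
    have sub: "ball s0 \<epsilon> \<subseteq> ?D1" using ball \<epsilon> by auto
    have step: "?T v'" if v: "v \<in> ball s0 \<epsilon>" and v': "v' \<in> ball s0 \<epsilon>" and T: "?T v" for v v'
    proof
      fix P
      define S where "S = (\<lambda>N. \<Sum>k<N. monom ((v' - v) ^ k) (Suc k))"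
      have "uniform_limit (- D) (\<lambda>N q. \<Sum>k<N. (v' - v) ^ k * spole b v q ^ Suc k) (spole b v') sequentially"
        by (rule spole_geometric_limit[OF ball \<epsilon>]) (use v v' in auto)
      then have "uniform_limit (- D) (\<lambda>N q. poly (S N) (spole b v q)) (spole b v') sequentially"
        by (simp add: S_def poly_sum poly_monom)
      moreover have "norm (spole b v' q) \<le> 1 / (2 * \<epsilon>)" if "q \<in> - D" for q
        by (rule spole_bound[OF ball _ _ \<epsilon>]) (use v' that in auto)
      then have "bounded (spole b v' ` (- D))"
        unfolding bounded_iff by blast
      ultimately have "uniform_limit (- D) (\<lambda>N q. poly P (poly (S N) (spole b v q)))
          (\<lambda>q. poly P (spole b v' q)) sequentially"
        by (rule uniform_limit_poly[THEN conjunct1])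
      then have "uniform_limit (- D) (\<lambda>N q. poly (P \<circ>\<^sub>p S N) (spole b v q))
          (\<lambda>q. poly P (spole b v' q)) sequentially"
        by (simp add: poly_pcompose)
      then have "uniform_limit (range \<gamma>) (\<lambda>N q. poly (P \<circ>\<^sub>p S N) (spole b v q))
          (\<lambda>q. poly P (spole b v' q)) sequentially"
        by (rule uniform_limit_on_subset[OF _ rng])
      then show "loop_int \<gamma> (\<lambda>q. poly P (spole b v' q)) (\<lambda>q. poly Q (spole b r q)) = 0"
      proof (rule loop_int_uniform_limit[rotated 2])
        show "holo_at (\<lambda>q. poly (P \<circ>\<^sub>p S N) (spole b v q)) p" if "p \<in> range \<gamma>" for N p
          using sub v that by (intro holo) auto
        show "holo_at (\<lambda>q. poly Q (spole b r q)) p" if "p \<in> range \<gamma>" for p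
          using r that by (rule holo)
        show "loop_int \<gamma> (\<lambda>q. poly (P \<circ>\<^sub>p S N) (spole b v q)) (\<lambda>q. poly Q (spole b r q)) = 0" for N
          using T by blast
      qed
    qed
    show "\<exists>T. openin (top_of_set ?D1) T \<and> s0 \<in> T \<and> (\<forall>x\<in>T. \<forall>y\<in>T. ?T x \<longrightarrow> ?T y)"
    proof (intro exI[of _ "ball s0 \<epsilon>"] conjI ballI impI)
      show "openin (top_of_set ?D1) (ball s0 \<epsilon>)"
        using sub by (simp only: openin_open_eq[OF open_vimage_kap[OF assms(1)]] open_ball simp_thms)
      show "s0 \<in> ball s0 \<epsilon>" using \<epsilon> by simp
      show "?T y" if "x \<in> ball s0 \<epsilon>" "y \<in> ball s0 \<epsilon>" "?T x" for x y
        using that by (rule step)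
    qed
  qed
  then show ?thesis by blast
qed

lemma finite_boundary_point: obtains b where "Fin b \<in> range \<gamma>"
proof -
  have "inj_on \<gamma> {0..<1}" using psb by (simp add: positive_smooth_boundary_def)
  then have "\<gamma> 0 \<noteq> \<gamma> (1/2)" using inj_onD[of \<gamma> "{0..<1}" 0 "1/2"] by auto
  then have "\<gamma> 0 \<noteq> Infty \<or> \<gamma> (1/2) \<noteq> Infty" by auto
  then show ?thesis using that by (metis cproj.exhaust rangeI)
qed

lemma loop_int_poles_inside:
  assumes "open D" "connected D" "mero f" "mero g"
    and f: "\<And>p. p \<notin> D \<Longrightarrow> holo_at f p" and g: "\<And>p. p \<notin> D \<Longrightarrow> holo_at g p"
  shows "loop_int \<gamma> f g = 0"
proof -
  have rng: "range \<gamma> \<subseteq> - D" using range_disjoint[OF assms(1)] by blast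
  obtain b where "Fin b \<in> range \<gamma>" by (rule finite_boundary_point)
  then have b: "Fin b \<notin> D" using rng by auto
  obtain S P a where S: "finite S" "\<And>s. s \<in> S \<Longrightarrow> \<not> holo_at f (kap b s)"
    "\<And>q. holo_at f q \<Longrightarrow> f q = a + (\<Sum>s\<in>S. poly (P s) (spole b s q))"
    using rational_expansion[OF assms(3) f[OF b]] by metis
  obtain S' P' a' where S': "finite S'" "\<And>s. s \<in> S' \<Longrightarrow> \<not> holo_at g (kap b s)"
    "\<And>q. holo_at g q \<Longrightarrow> g q = a' + (\<Sum>s\<in>S'. poly (P' s) (spole b s q))"
    using rational_expansion[OF assms(4) g[OF b]] by metis
  have SD: "kap b s \<in> D" if "s \<in> S" for s using S(2)[OF that] f by blast
  have S'D: "kap b s \<in> D" if "s \<in> S'" for s using S'(2)[OF that] g by blast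
  have pole: "holo_at (\<lambda>q. poly P (spole b v q)) p" if "kap b v \<in> D" "p \<in> range \<gamma>" for P v p
    using that rng by (intro holo_at_poly holo_at_spole) auto
  have hg: "holo_at g p" if "p \<in> range \<gamma>" for p using that rng g by auto
  have hf: "holo_at f p" if "p \<in> range \<gamma>" for p using that rng f by auto
  have one: "loop_int \<gamma> (\<lambda>q. poly (P s) (spole b s q)) g = 0" if s: "s \<in> S" for s
  proof -
    let ?e = "\<lambda>q. poly (P s) (spole b s q)"
    have e: "holo_at ?e p" if "p \<in> range \<gamma>" for p using SD[OF s] that by (rule pole)
    have "loop_int \<gamma> ?e g = - loop_int \<gamma> g ?e" by (rule loop_int_swap) (use e hg in auto)
    also have "loop_int \<gamma> g ?e = loop_int \<gamma> (\<lambda>q. a' + (\<Sum>r\<in>S'. poly (P' r) (spole b r q))) ?e"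
      using S'(3) hg by (intro loop_int_cong) auto
    also have "\<dots> = loop_int \<gamma> (\<lambda>q. a') ?e + (\<Sum>r\<in>S'. loop_int \<gamma> (\<lambda>q. poly (P' r) (spole b r q)) ?e)"
      using S'(1) S'D pole e
      by (subst loop_int_add_left) (auto intro!: holo_at_const holo_at_sum loop_int_sum_left)
    also have "\<dots> = 0"
      using loop_int_two_poles[OF assms(1,2) b _ SD[OF s]] S'D e by (simp add: loop_int_const_left)
    finally show ?thesis by simp
  qed
  have "loop_int \<gamma> f g = loop_int \<gamma> (\<lambda>q. a + (\<Sum>s\<in>S. poly (P s) (spole b s q))) g"
    using S(3) hf by (intro loop_int_cong) auto
  also have "\<dots> = loop_int \<gamma> (\<lambda>q. a) g + (\<Sum>s\<in>S. loop_int \<gamma> (\<lambda>q. poly (P s) (spole b s q)) g)"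
    using S(1) SD pole hg
    by (subst loop_int_add_left) (auto intro!: holo_at_const holo_at_sum loop_int_sum_left)
  also have "\<dots> = 0"
    using one hg by (simp add: loop_int_const_left)
  finally show ?thesis .
qed

end

section \<open>Curves parallel to the boundary\<close>

lemma periodic_reduce:
  fixes \<Gamma> :: "real \<Rightarrow> 'a"
  assumes "\<And>t. \<Gamma> (t + 1) = \<Gamma> t"
  shows "\<Gamma> (t + of_int k) = \<Gamma> t"
proof -
  have nat: "\<Gamma> (t + of_nat n) = \<Gamma> t" for t n
  proof (induction n)
    case (Suc n)
    have "t + of_nat (Suc n) = t + of_nat n + 1" by simp
    then have "\<Gamma> (t + of_nat (Suc n)) = \<Gamma> (t + of_nat n + 1)" by (rule arg_cong)
    then show ?case using assms Suc by simp
  qed simp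
  show ?thesis
  proof (cases "k \<ge> 0")
    case True
    then show ?thesis using nat[of t "nat k"] by simp
  next
    case False
    then show ?thesis using nat[of "t + of_int k" "nat (- k)"] by simp
  qed
qed

lemma periodic_inj:
  fixes \<Gamma> :: "real \<Rightarrow> 'a"
  assumes per: "\<And>t. \<Gamma> (t + 1) = \<Gamma> t" and inj: "inj_on \<Gamma> {0..<1}"
    and eq: "\<Gamma> s = \<Gamma> t" and near: "\<bar>s - t\<bar> < 1"
  shows "s = t"
proof -
  have "\<Gamma> (frac x) = \<Gamma> x" for x
    using periodic_reduce[of \<Gamma> x "- \<lfloor>x\<rfloor>", OF per] by (simp add: frac_def)
  then have "\<Gamma> (frac s) = \<Gamma> (frac t)" using eq by simp
  then have "frac s = frac t"
    using inj by (auto simp: inj_on_def frac_lt_1)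
  then have "s - t = of_int (\<lfloor>s\<rfloor> - \<lfloor>t\<rfloor>)" by (simp add: frac_def)
  moreover from this have "\<bar>\<lfloor>s\<rfloor> - \<lfloor>t\<rfloor>\<bar> < 1" using near by linarith
  ultimately show ?thesis by simp
qed

text \<open>The displacement \<open>S\<close> cannot be nearly tangential, that is close to \<open>x * A\<close> with \<open>x\<close> real, and
  nearly normal, that is close to \<open>r * \<omega> * A\<close> with \<open>\<omega>\<close> near \<open>\<i>\<close>, at the same time: the imaginary part of the quotient
  by \<open>A\<close> forces \<open>x\<close> to be large compared to \<open>r\<close>, and the real part forces it to be small.\<close>

lemma transversal_estimate:
  fixes A T S \<omega> :: complex and x r :: real
  assumes "A \<noteq> 0" "norm (S - of_real x * A) \<le> norm A / 8 * \<bar>x\<bar>" "norm (T - A) \<le> norm A / 8"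
    and "norm (\<omega> - \<i>) < 1/2" "S = of_real r * \<omega> * T" "0 < r"
  shows False
proof -
  have \<omega>: "norm \<omega> \<le> 3/2" "Im \<omega> \<ge> 1/2" "\<bar>Re \<omega>\<bar> \<le> 1/2"
  proof -
    have "norm \<omega> \<le> norm (\<omega> - \<i>) + norm \<i>" using norm_triangle_ineq[of "\<omega> - \<i>" \<i>] by simp
    then show "norm \<omega> \<le> 3/2" using assms(4) by simp
    show "Im \<omega> \<ge> 1/2" "\<bar>Re \<omega>\<bar> \<le> 1/2"
      using abs_Im_le_cmod[of "\<omega> - \<i>"] abs_Re_le_cmod[of "\<omega> - \<i>"] assms(4) by auto
  qed
  have "norm (of_real r * \<omega> * (T - A)) \<le> r * (3/2) * (norm A / 8)"
    unfolding norm_mult using assms(3,6) \<omega>(1) by (intro mult_mono) auto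
  moreover have "(of_real r * \<omega> - of_real x) * A = (S - of_real x * A) - of_real r * \<omega> * (T - A)"
    by (simp add: assms(5) algebra_simps)
  then have "norm ((of_real r * \<omega> - of_real x) * A) = norm ((S - of_real x * A) - of_real r * \<omega> * (T - A))"
    by (rule arg_cong)
  ultimately have "norm ((of_real r * \<omega> - of_real x) * A) \<le> norm A / 8 * \<bar>x\<bar> + r * (3/2) * (norm A / 8)"
    using norm_triangle_ineq4[of "S - of_real x * A" "of_real r * \<omega> * (T - A)"] assms(2) by linarith
  moreover have "norm A / 8 * \<bar>x\<bar> + r * (3/2) * (norm A / 8) = (\<bar>x\<bar> / 8 + r * (3/2) / 8) * norm A"
    by (simp add: algebra_simps)
  ultimately have "norm (of_real r * \<omega> - of_real x) * norm A \<le> (\<bar>x\<bar> / 8 + r * (3/2) / 8) * norm A"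
    by (simp only: norm_mult[of _ A])
  then have le: "norm (of_real r * \<omega> - of_real x) \<le> \<bar>x\<bar> / 8 + r * 3 / 16"
    using assms(1) by simp
  have "r * (1/2) \<le> r * Im \<omega>" using \<omega>(2) assms(6) by (intro mult_left_mono) auto
  also have "\<dots> \<le> \<bar>x\<bar> / 8 + r * 3 / 16"
    using abs_Im_le_cmod[of "of_real r * \<omega> - of_real x"] le by simp
  finally have 1: "r * 5 / 2 \<le> \<bar>x\<bar>" by simp
  have "\<bar>r * Re \<omega>\<bar> \<le> r * (1/2)"
    using \<omega>(3) assms(6) by (simp add: abs_mult)
  moreover have "\<bar>r * Re \<omega> - x\<bar> \<le> \<bar>x\<bar> / 8 + r * 3 / 16"
    using abs_Re_le_cmod[of "of_real r * \<omega> - of_real x"] le by simp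
  ultimately have "\<bar>x\<bar> \<le> r / 2 + \<bar>x\<bar> / 8 + r * 3 / 16" by linarith
  with 1 assms(6) show False by linarith
qed

text \<open>A closed planar curve with \<open>U\<close> on its left. The last assumption allows steps into \<open>U\<close> in directions that
  are only close to the normal, since a change of coordinates preserves the normal direction only to first order.\<close>

locale inner_boundary =
  fixes U :: "complex set" and \<Gamma> \<Gamma>' \<Gamma>'' :: "real \<Rightarrow> complex"
  assumes fr: "frontier U \<subseteq> range \<Gamma>"
    and d1: "\<And>t. (\<Gamma> has_vector_derivative \<Gamma>' t) (at t)"
    and d2: "\<And>t. (\<Gamma>' has_vector_derivative \<Gamma>'' t) (at t)"
    and cont2: "continuous_on UNIV \<Gamma>''"
    and nonzero: "\<And>t. \<Gamma>' t \<noteq> 0"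
    and per: "\<And>t. \<Gamma> (t + 1) = \<Gamma> t"
    and inj: "inj_on \<Gamma> {0..<1}"
    and inner: "\<And>t. \<forall>\<^sub>F r in at_right 0. \<exists>\<omega>. norm (\<omega> - \<i>) < 1/2 \<and> \<Gamma> t + of_real r * \<omega> * \<Gamma>' t \<in> U"
begin

lemma cont: "isCont \<Gamma> t" "isCont \<Gamma>' t"
  using d1 d2 has_vector_derivative_continuous by blast+

lemma cont_on: "continuous_on S \<Gamma>" "continuous_on S \<Gamma>'" "continuous_on S \<Gamma>''"
  using cont continuous_on_subset[OF cont2] by (auto intro!: continuous_at_imp_continuous_on)

text \<open>A point reached from \<open>\<Gamma> s\<close> by a short step close to the normal is not on the curve: neither on the
  part near \<open>\<Gamma> t\<close>, by the preceding estimate, nor on the rest, which keeps a positive distance from \<open>\<Gamma> t\<close>. The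
  points of this kind form a connected set, which therefore does not meet the frontier of \<open>U\<close>; and it contains a point
  of \<open>U\<close>.\<close>

lemma local_strip:
  "\<exists>\<delta>>0. \<forall>s r. \<bar>s - t\<bar> < \<delta> \<longrightarrow> 0 < r \<longrightarrow> r < \<delta> \<longrightarrow> \<Gamma> s + of_real r * \<i> * \<Gamma>' s \<in> U"
proof -
  define A where "A = \<Gamma>' t"
  have A: "A \<noteq> 0" using nonzero by (simp add: A_def)
  have "norm A / 8 > 0" using A by simp
  then obtain \<eta>0 where \<eta>0: "\<eta>0 > 0" "\<And>s. \<bar>s - t\<bar> < \<eta>0 \<Longrightarrow> norm (\<Gamma>' s - A) < norm A / 8"
    using cont(2)[of t] unfolding continuous_at_eps_delta A_def dist_norm real_norm_def by blast
  \<comment> \<open>half a period on both sides of \<open>t\<close> is left for the rest of the curve\<close>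
  define \<eta> where "\<eta> = min (\<eta>0 / 2) (1/4)"
  have \<eta>: "0 < \<eta>" "\<eta> < 1/2" "\<And>s. \<bar>s - t\<bar> \<le> \<eta> \<Longrightarrow> norm (\<Gamma>' s - A) \<le> norm A / 8"
  proof -
    show "0 < \<eta>" "\<eta> < 1/2" using \<eta>0(1) by (auto simp: \<eta>_def)
    fix s assume "\<bar>s - t\<bar> \<le> \<eta>"
    then have "\<bar>s - t\<bar> < \<eta>0" using \<eta>0(1) by (auto simp: \<eta>_def)
    then show "norm (\<Gamma>' s - A) \<le> norm A / 8" by (rule less_imp_le[OF \<eta>0(2)])
  qed
  have lin: "norm (\<Gamma> y - \<Gamma> x - of_real (y - x) * A) \<le> norm A / 8 * \<bar>y - x\<bar>"
    if "\<bar>x - t\<bar> \<le> \<eta>" "\<bar>y - t\<bar> \<le> \<eta>" for x y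
  proof -
    have "norm (\<Gamma> y - \<Gamma> x - (y - x) *\<^sub>R \<Gamma>' t) \<le> norm (y - x) * (norm A / 8)"
    proof (rule vector_differentiable_bound_linearization[where S = "{t - \<eta>..t + \<eta>}"])
      show "closed_segment x y \<subseteq> {t - \<eta>..t + \<eta>}"
        using that by (auto simp: closed_segment_eq_real_ivl split: if_splits)
    qed (use \<eta> in \<open>auto simp: A_def abs_le_iff intro: has_vector_derivative_at_within[OF d1]\<close>)
    then show ?thesis by (simp add: scaleR_conv_of_real A_def mult.commute)
  qed
  define C where "C = {t - 1/2..t + 1/2} - {t - \<eta><..<t + \<eta>}"
  have "compact C" unfolding C_def by (intro compact_diff) auto
  then have "closed (\<Gamma> ` C)" by (intro compact_imp_closed compact_continuous_image cont_on)
  moreover have "\<Gamma> t \<notin> \<Gamma> ` C"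
  proof
    assume "\<Gamma> t \<in> \<Gamma> ` C"
    then obtain x where x: "x \<in> C" "\<Gamma> x = \<Gamma> t" by auto
    then have "\<bar>x - t\<bar> < 1" by (auto simp: C_def)
    then have "x = t" using periodic_inj[of \<Gamma> x t, OF per inj x(2)] by blast
    then show False using x(1) \<eta>(1) by (simp add: C_def)
  qed
  ultimately have "open (- \<Gamma> ` C)" "\<Gamma> t \<in> - \<Gamma> ` C" by (auto simp: open_Compl)
  then obtain m where m: "m > 0" "ball (\<Gamma> t) m \<subseteq> - \<Gamma> ` C"
    using open_contains_ball by blast
  \<comment> \<open>a step into the strip has length at most \<open>45/16 * norm A * \<delta>\<close>, so that it stays within \<open>m\<close> of \<open>\<Gamma> t\<close>\<close>
  define \<delta> where "\<delta> = min \<eta> (m / (4 * norm A))"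
  have \<delta>: "\<delta> > 0" "\<delta> \<le> \<eta>" "\<delta> * (4 * norm A) \<le> m"
    using \<eta>(1) m(1) A by (auto simp: \<delta>_def min_def field_simps)
  define Z where "Z = (\<lambda>(s, r, \<omega>). \<Gamma> s + of_real r * \<omega> * \<Gamma>' s) ` ({t - \<delta><..<t + \<delta>} \<times> {0<..<\<delta>} \<times> ball \<i> (1/2))"
  have "Z \<inter> range \<Gamma> = {}"
  proof (rule ccontr)
    assume "Z \<inter> range \<Gamma> \<noteq> {}"
    then obtain s r \<omega> y where z': "s \<in> {t - \<delta><..<t + \<delta>}" "r \<in> {0<..<\<delta>}" "\<omega> \<in> ball \<i> (1/2)"
      "\<Gamma> s + of_real r * \<omega> * \<Gamma>' s = \<Gamma> y"
      unfolding Z_def by fast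
    then have z: "\<bar>s - t\<bar> < \<delta>" "0 < r" "r < \<delta>" "norm (\<omega> - \<i>) < 1/2"
      "\<Gamma> s + of_real r * \<omega> * \<Gamma>' s = \<Gamma> y"
      by (auto simp: dist_norm norm_minus_commute)
    \<comment> \<open>shift the parameter by a period so that it lies within \<open>1/2\<close> of \<open>t\<close>\<close>
    define x where "x = y + of_int (- \<lfloor>y - t + 1/2\<rfloor>)"
    have x: "\<Gamma> x = \<Gamma> y" "\<bar>x - t\<bar> \<le> 1/2"
      using periodic_reduce[of \<Gamma> y "- \<lfloor>y - t + 1/2\<rfloor>", OF per] unfolding x_def by (simp, linarith)
    have ds: "norm (\<Gamma>' s - A) \<le> norm A / 8" using \<eta>(3) z(1) \<delta>(2) by simp
    have "norm (\<Gamma>' s) \<le> norm A * (9/8)"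
      using norm_triangle_ineq2[of "\<Gamma>' s" A] ds by simp
    moreover have "norm \<omega> \<le> 3/2"
      using norm_triangle_ineq2[of \<omega> \<i>] z(4) by simp
    ultimately have "norm (of_real r * \<omega> * \<Gamma>' s) \<le> \<delta> * (3/2) * (norm A * (9/8))"
      unfolding norm_mult using z(2,3) by (intro mult_mono) auto
    moreover have "norm (\<Gamma> s - \<Gamma> t) \<le> \<delta> * (norm A * (9/8))"
    proof -
      have "norm (\<Gamma> s - \<Gamma> t - of_real (s - t) * A) \<le> norm A / 8 * \<bar>s - t\<bar>"
        using lin[of t s] z(1) \<delta>(2) \<eta>(1) by simp
      then have "norm (\<Gamma> s - \<Gamma> t) \<le> norm A / 8 * \<bar>s - t\<bar> + norm (of_real (s - t) * A)"
        using norm_triangle_ineq2[of "\<Gamma> s - \<Gamma> t" "of_real (s - t) * A"] by linarith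
      also have "\<dots> = \<bar>s - t\<bar> * (norm A * (9/8))"
        unfolding norm_mult norm_of_real by (simp add: algebra_simps)
      also have "\<dots> \<le> \<delta> * (norm A * (9/8))" using z(1) by (intro mult_right_mono) auto
      finally show ?thesis .
    qed
    ultimately have "norm ((\<Gamma> s - \<Gamma> t) + of_real r * \<omega> * \<Gamma>' s) \<le> \<delta> * (norm A * (45/16))"
      using norm_triangle_ineq[of "\<Gamma> s - \<Gamma> t" "of_real r * \<omega> * \<Gamma>' s"] by (simp add: algebra_simps)
    also have "\<dots> < \<delta> * (norm A * 4)" using \<delta>(1) A by simp
    also have "\<dots> \<le> m" using \<delta>(3) by (simp add: algebra_simps)
    finally have "norm (\<Gamma> x - \<Gamma> t) < m"
      using z(5) x(1) by (simp add: algebra_simps)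
    then have "\<Gamma> x \<in> ball (\<Gamma> t) m" by (simp add: dist_norm norm_minus_commute)
    then have "\<Gamma> x \<in> - \<Gamma> ` C" using m(2) by blast
    then have "x \<notin> C" by blast
    then have "\<bar>x - t\<bar> \<le> \<eta>" using x(2) by (auto simp: C_def abs_le_iff abs_less_iff)
    then have "norm (\<Gamma> x - \<Gamma> s - of_real (x - s) * A) \<le> norm A / 8 * \<bar>x - s\<bar>"
      using z(1) \<delta>(2) by (intro lin) auto
    moreover have "\<Gamma> x - \<Gamma> s = of_real r * \<omega> * \<Gamma>' s" using z(5) x(1) by (simp add: algebra_simps)
    ultimately show False
      using transversal_estimate[OF A _ ds z(4) _ z(2), of "\<Gamma> x - \<Gamma> s" "x - s"] by simp
  qed
  with fr have disj: "Z \<inter> frontier U = {}" by blast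
  have conn: "connected Z"
    unfolding Z_def
    by (intro connected_continuous_image connected_Times connected_Ioo)
       (auto intro!: continuous_intros continuous_on_compose2[OF cont_on(1)[of UNIV]]
         continuous_on_compose2[OF cont_on(2)[of UNIV]] simp: case_prod_unfold)
  have "\<forall>\<^sub>F r in at_right 0. r \<in> {0<..<\<delta>}"
    using \<delta>(1) by (rule eventually_at_right_real)
  with inner[of t] have "\<forall>\<^sub>F r in at_right 0. r \<in> {0<..<\<delta>} \<and> (\<exists>\<omega>. norm (\<omega> - \<i>) < 1/2 \<and> \<Gamma> t + of_real r * \<omega> * \<Gamma>' t \<in> U)"
    by eventually_elim simp
  then obtain r \<omega> where "r \<in> {0<..<\<delta>}" "norm (\<omega> - \<i>) < 1/2" "\<Gamma> t + of_real r * \<omega> * \<Gamma>' t \<in> U"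
    using eventually_happens[of _ "at_right (0::real)"] trivial_limit_at_right_real by blast
  moreover from this have "\<Gamma> t + of_real r * \<omega> * \<Gamma>' t \<in> Z"
    unfolding Z_def using \<delta>(1)
    by (intro image_eqI[of _ _ "(t, r, \<omega>)"]) (auto simp: dist_norm norm_minus_commute)
  ultimately have "Z \<inter> U \<noteq> {}" by blast
  then have "Z \<subseteq> U" using connected_Int_frontier[OF conn] disj by blast
  moreover have "\<Gamma> s + of_real r * \<i> * \<Gamma>' s \<in> Z" if "\<bar>s - t\<bar> < \<delta>" "0 < r" "r < \<delta>" for s r
    unfolding Z_def using that by (intro image_eqI[of _ _ "(s, r, \<i>)"]) (auto simp: abs_less_iff)
  ultimately show ?thesis using \<delta>(1) by (intro exI[of _ \<delta>]) blast
qed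

lemma uniform_strip:
  "\<exists>\<delta>>0. \<forall>s\<in>{0..1}. \<forall>r. 0 < r \<longrightarrow> r < \<delta> \<longrightarrow> \<Gamma> s + of_real r * \<i> * \<Gamma>' s \<in> U"
proof -
  obtain \<delta> where \<delta>: "\<And>t. \<delta> t > 0"
    "\<And>t s r. \<bar>s - t\<bar> < \<delta> t \<Longrightarrow> 0 < r \<Longrightarrow> r < \<delta> t \<Longrightarrow> \<Gamma> s + of_real r * \<i> * \<Gamma>' s \<in> U"
    using local_strip by metis
  have "{0..1} \<subseteq> (\<Union>t\<in>{0..1}. ball t (\<delta> t))" using \<delta>(1) by force
  then obtain T where T: "T \<subseteq> {0..1}" "finite T" "{0..1} \<subseteq> (\<Union>t\<in>T. ball t (\<delta> t))"
    using compactE_image[of "{0..1::real}" "{0..1}" "\<lambda>t. ball t (\<delta> t)"] by auto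
  then have "T \<noteq> {}" by auto
  define \<epsilon> where "\<epsilon> = Min (\<delta> ` T)"
  have "\<epsilon> > 0" using T(2) \<open>T \<noteq> {}\<close> \<delta>(1) by (simp add: \<epsilon>_def)
  moreover have "\<Gamma> s + of_real r * \<i> * \<Gamma>' s \<in> U" if "s \<in> {0..1}" "0 < r" "r < \<epsilon>" for s r
  proof -
    have "s \<in> (\<Union>t\<in>T. ball t (\<delta> t))" using T(3) that(1) by blast
    then obtain t where t: "t \<in> T" "\<bar>s - t\<bar> < \<delta> t" by (auto simp: dist_real_def abs_minus_commute)
    then have "\<epsilon> \<le> \<delta> t" using T(2) by (simp add: \<epsilon>_def)
    then show ?thesis using \<delta>(2)[OF t(2)] that by simp
  qed
  ultimately show ?thesis by blast
qed

text \<open>The integrand has a primitive in \<open>U\<close>, so the integrals over the inner parallel curves vanish. They depend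
  continuously on the distance \<open>r\<close>, up to \<open>r = 0\<close>.\<close>

lemma integral_zero:
  assumes k: "continuous_on (U \<union> range \<Gamma>) k"
    and H: "\<And>u. u \<in> U \<Longrightarrow> (H has_field_derivative k u) (at u)"
  shows "integral {0..1} (\<lambda>s. k (\<Gamma> s) * \<Gamma>' s) = 0"
proof -
  obtain \<delta> where \<delta>: "\<delta> > 0" "\<And>s r. s \<in> {0..1} \<Longrightarrow> 0 < r \<Longrightarrow> r < \<delta> \<Longrightarrow> \<Gamma> s + of_real r * \<i> * \<Gamma>' s \<in> U"
    using uniform_strip by metis
  have perd: "\<Gamma>' (t + 1) = \<Gamma>' t" for t
  proof -
    have "((\<lambda>s. \<Gamma> (s + 1)) has_vector_derivative \<Gamma>' (t + 1)) (at t)"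
    proof -
      have "((\<lambda>s. s + 1) has_vector_derivative 1) (at t)"
        by (auto intro!: derivative_eq_intros simp: has_vector_derivative_def)
      from vector_diff_chain_at[OF this d1] show ?thesis by (simp add: o_def)
    qed
    then show ?thesis using d1[of t] vector_derivative_unique_at by (simp add: per)
  qed
  define I where "I = (\<lambda>r::real. integral {0..1} (\<lambda>s. k (\<Gamma> s + of_real r * \<i> * \<Gamma>' s) * (\<Gamma>' s + of_real r * \<i> * \<Gamma>'' s)))"
  have zero: "I r = 0" if r: "0 < r" "r < \<delta>" for r
  proof -
    define \<Lambda> where "\<Lambda> = (\<lambda>s. \<Gamma> s + of_real r * \<i> * \<Gamma>' s)"
    have "((\<lambda>s. H (\<Lambda> s)) has_vector_derivative k (\<Lambda> s) * (\<Gamma>' s + of_real r * \<i> * \<Gamma>'' s)) (at s within {0..1})"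
      if "s \<in> {0..1}" for s
    proof -
      have "(\<Lambda> has_vector_derivative \<Gamma>' s + of_real r * \<i> * \<Gamma>'' s) (at s)"
        unfolding \<Lambda>_def by (intro has_vector_derivative_add has_vector_derivative_mult_right d1 d2)
      moreover have "(H has_field_derivative k (\<Lambda> s)) (at (\<Lambda> s))"
        using \<delta>(2)[OF that r] by (intro H) (simp add: \<Lambda>_def)
      ultimately have "(H \<circ> \<Lambda> has_vector_derivative (\<Gamma>' s + of_real r * \<i> * \<Gamma>'' s) * k (\<Lambda> s)) (at s)"
        by (rule field_vector_diff_chain_at)
      then show ?thesis by (simp add: o_def mult.commute has_vector_derivative_at_within)
    qed
    then have "((\<lambda>s. k (\<Lambda> s) * (\<Gamma>' s + of_real r * \<i> * \<Gamma>'' s)) has_integral H (\<Lambda> 1) - H (\<Lambda> 0)) {0..1}"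
      by (intro fundamental_theorem_of_calculus) auto
    moreover have "\<Lambda> 1 = \<Lambda> 0" using per[of 0] perd[of 0] by (simp add: \<Lambda>_def)
    ultimately show ?thesis by (simp add: I_def \<Lambda>_def integral_unique)
  qed
  have "continuous_on {0..<\<delta>} I"
  proof -
    have maps: "\<Gamma> s + of_real r * \<i> * \<Gamma>' s \<in> U \<union> range \<Gamma>" if "r \<in> {0..<\<delta>}" "s \<in> {0..1}" for r s
      using \<delta>(2)[OF that(2), of r] that(1) by (cases "r = 0") auto
    have c: "continuous_on ({0..<\<delta>} \<times> {0..1}) (\<lambda>p. \<Gamma> (snd p))"
      "continuous_on ({0..<\<delta>} \<times> {0..1}) (\<lambda>p. \<Gamma>' (snd p))"
      "continuous_on ({0..<\<delta>} \<times> {0..1}) (\<lambda>p. \<Gamma>'' (snd p))"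
      by (rule continuous_on_compose2[OF cont_on(1)[of UNIV]] continuous_on_compose2[OF cont_on(2)[of UNIV]]
          continuous_on_compose2[OF cont_on(3)[of UNIV]]; auto intro!: continuous_intros)+
    have "continuous_on ({0..<\<delta>} \<times> {0..1}) (\<lambda>p. k (\<Gamma> (snd p) + of_real (fst p) * \<i> * \<Gamma>' (snd p)))"
    proof (rule continuous_on_compose2[OF k])
      show "continuous_on ({0..<\<delta>} \<times> {0..1}) (\<lambda>p. \<Gamma> (snd p) + of_real (fst p) * \<i> * \<Gamma>' (snd p))"
        by (intro continuous_intros c)
      show "(\<lambda>p. \<Gamma> (snd p) + of_real (fst p) * \<i> * \<Gamma>' (snd p)) ` ({0..<\<delta>} \<times> {0..1}) \<subseteq> U \<union> range \<Gamma>"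
        by (intro image_subsetI maps) auto
    qed
    then have "continuous_on ({0..<\<delta>} \<times> {0..1})
        (\<lambda>(r, s). k (\<Gamma> s + of_real r * \<i> * \<Gamma>' s) * (\<Gamma>' s + of_real r * \<i> * \<Gamma>'' s))"
      unfolding case_prod_unfold by (intro continuous_intros c)
    from integral_continuous_on_param[where a = 0 and b = "1 :: real", unfolded cbox_interval, OF this]
    show ?thesis unfolding I_def .
  qed
  then have "(I \<longlongrightarrow> I 0) (at 0 within {0..<\<delta>})"
    using \<delta>(1) by (auto simp: continuous_on_def)
  then have "(I \<longlongrightarrow> I 0) (at 0 within {0..\<delta> / 2})"
    by (rule tendsto_within_subset) (use \<delta>(1) in auto)
  then have "(I \<longlongrightarrow> I 0) (at_right 0)"
    using at_within_Icc_at_right[of 0 "\<delta> / 2"] \<delta>(1) by simp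
  moreover have "\<forall>\<^sub>F r in at_right 0. I r = 0"
    using eventually_at_right_real[OF \<delta>(1)] by eventually_elim (use zero in auto)
  ultimately have "I 0 = 0"
    using tendsto_cong[of I "\<lambda>_. 0" "at_right 0"] tendsto_unique[OF trivial_limit_at_right_real _ tendsto_const] by metis
  then show ?thesis by (simp add: I_def)
qed

end

section \<open>Poles outside the curve\<close>

lemma deriv_tau_chart:
  assumes "c \<in> charts" "c u \<noteq> Fin b"
  shows "deriv (tau b \<circ> c) u \<noteq> 0"
proof (cases "c = Fin")
  case True
  then have "u - b \<noteq> 0" using assms(2) by auto
  then have "((\<lambda>z. inverse (z - b)) has_field_derivative - (inverse (u - b) * inverse (u - b))) (at u)"
    by (auto intro!: derivative_eq_intros)
  then show ?thesis
    using \<open>u - b \<noteq> 0\<close> DERIV_imp_deriv by (force simp: True tau_def o_def)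
next
  case False
  then have c: "c = inf_chart" using assms(1) by (simp add: charts_def)
  have ne: "1 - b * u \<noteq> 0"
    using assms(2) by (auto simp: c inf_chart_def field_simps split: if_splits)
  have "((\<lambda>w. w / (1 - b * w)) has_field_derivative 1 / ((1 - b * u) * (1 - b * u))) (at u)"
    using ne by (auto intro!: derivative_eq_intros simp: field_simps)
  then have "deriv (\<lambda>w. w / (1 - b * w)) u = 1 / ((1 - b * u) * (1 - b * u))" by (rule DERIV_imp_deriv)
  then show ?thesis using ne by (simp add: c tau_inf_chart o_def)
qed

text \<open>A holomorphic map with nonzero derivative maps the straight normal segment to a curve that leaves
  in the normal direction.\<close>

lemma inner_normal_direction:
  assumes F: "(F has_field_derivative F') (at z)" and "F' \<noteq> 0" "v \<noteq> 0"
  shows "\<forall>\<^sub>F r in at_right (0::real). norm ((F (z + of_real r * (\<i> * v)) - F z) / (of_real r * (F' * v)) - \<i>) < 1/2"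
proof -
  have lim: "((\<lambda>h. (F (z + h) - F z) / h) \<longlongrightarrow> F') (at 0)"
    using F by (simp add: DERIV_def)
  have "filterlim (\<lambda>r. of_real r * (\<i> * v)) (at 0) (at_right (0::real))"
    unfolding filterlim_at
  proof
    have "((\<lambda>r::real. of_real r * (\<i> * v)) \<longlongrightarrow> of_real 0 * (\<i> * v)) (at_right 0)"
      by (intro tendsto_intros)
    then show "((\<lambda>r::real. of_real r * (\<i> * v)) \<longlongrightarrow> 0) (at_right 0)" by simp
    have "\<forall>\<^sub>F r in at_right (0::real). 0 < r" by (rule eventually_at_right_less)
    then show "\<forall>\<^sub>F r in at_right (0::real). of_real r * (\<i> * v) \<in> UNIV \<and> of_real r * (\<i> * v) \<noteq> 0"
      by eventually_elim (use assms(3) in simp)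
  qed
  from filterlim_compose[OF lim this]
  have "((\<lambda>r::real. (F (z + of_real r * (\<i> * v)) - F z) / (of_real r * (\<i> * v)) * (\<i> / F')) \<longlongrightarrow> F' * (\<i> / F')) (at_right 0)"
    by (intro tendsto_mult tendsto_const)
  moreover have "(F (z + of_real r * (\<i> * v)) - F z) / (of_real r * (\<i> * v)) * (\<i> / F')
      = (F (z + of_real r * (\<i> * v)) - F z) / (of_real r * (F' * v))" for r
    by (simp add: divide_simps)
  moreover have "F' * (\<i> / F') = \<i>" using assms(2) by simp
  ultimately have "((\<lambda>r::real. (F (z + of_real r * (\<i> * v)) - F z) / (of_real r * (F' * v))) \<longlongrightarrow> \<i>) (at_right 0)"
    by (simp only:)
  from tendstoD[OF this, of "1/2"] show ?thesis by (simp add: dist_norm)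
qed

context
  fixes D :: "cproj set" and \<gamma> :: "real \<Rightarrow> cproj"
  assumes psb: "positive_smooth_boundary D \<gamma>"
begin

text \<open>As \<open>Fin b\<close> lies in \<open>D\<close>, the whole boundary is a curve in the domain of one coordinate.\<close>

lemma planar_boundary:
  assumes D: "open D" and b: "Fin b \<in> D"
  defines "\<Gamma> \<equiv> \<lambda>t. tau b (\<gamma> t)"
  defines "\<Gamma>' \<equiv> \<lambda>t. vector_derivative \<Gamma> (at t)"
  shows "inner_boundary (kap b -` D) \<Gamma> \<Gamma>' (\<lambda>t. vector_derivative \<Gamma>' (at t))"
proof -
  have off: "\<gamma> t \<noteq> Fin b" for t using range_disjoint[OF psb D] b by (metis disjoint_iff rangeI)
  have holo: "holo_at (tau b) p" if "p \<in> range \<gamma>" for p using that off holo_at_tau by auto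
  have bd: "(\<Gamma> has_vector_derivative \<Gamma>' t) (at t)" "(\<Gamma>' has_vector_derivative vector_derivative \<Gamma>' (at t)) (at t)"
    "continuous_on UNIV (\<lambda>t. vector_derivative \<Gamma>' (at t))" for t
    unfolding \<Gamma>'_def \<Gamma>_def by (rule boundary_derivative[OF psb holo]; assumption)+
  have kap: "kap b (\<Gamma> t) = \<gamma> t" for t using off by (simp add: \<Gamma>_def kap_tau)
  show ?thesis
  proof
    show "frontier (kap b -` D) \<subseteq> range \<Gamma>"
    proof
      fix u assume u: "u \<in> frontier (kap b -` D)"
      have "closure (kap b -` D) \<subseteq> - kap b -` (- closure D)"
        using closure_subset[of D] open_vimage_kap[of "- closure D" b]
        by (intro closure_minimal) (auto simp: closed_def)
      then have "kap b u \<in> closure D"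
        using u by (auto simp: frontier_def)
      moreover have "kap b u \<notin> D"
        using u open_vimage_kap[OF D, of b] by (simp add: frontier_def interior_open)
      ultimately have "kap b u \<in> range \<gamma>"
        using psb D by (simp add: positive_smooth_boundary_def frontier_def interior_open)
      then obtain t where "kap b u = \<gamma> t" by blast
      then have "\<Gamma> t = u" using tau_kap[of b u] by (simp add: \<Gamma>_def)
      then show "u \<in> range \<Gamma>" by blast
    qed
    show "(\<Gamma> has_vector_derivative \<Gamma>' t) (at t)" for t by (rule bd)
    show "(\<Gamma>' has_vector_derivative vector_derivative \<Gamma>' (at t)) (at t)" for t by (rule bd)
    show "continuous_on UNIV (\<lambda>t. vector_derivative \<Gamma>' (at t))" by (rule bd)
    show "\<Gamma> (t + 1) = \<Gamma> t" for t by (simp add: \<Gamma>_def \<gamma>_periodic[OF psb])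
    show "inj_on \<Gamma> {0..<1}"
    proof (rule inj_onI)
      fix x y assume xy: "x \<in> {0..<1}" "y \<in> {0..<1}" "\<Gamma> x = \<Gamma> y"
      have "\<gamma> x = \<gamma> y" using kap[of x] kap[of y] xy(3) by simp
      then show "x = y" using psb xy(1,2) unfolding positive_smooth_boundary_def by (metis inj_onD)
    qed
  next
    fix t
    obtain c e d where d: "c \<in> charts" "e > 0" "\<And>s. s \<in> {t - e<..<t + e} \<Longrightarrow> \<gamma> s = c (d 0 s)"
      "\<And>k s. s \<in> {t - e<..<t + e} \<Longrightarrow> (d k has_vector_derivative d (Suc k) s) (at s)"
      "d 1 t \<noteq> (0::complex)" "\<forall>\<^sub>F r in at_right 0. c (d 0 t + of_real r * (\<i> * d 1 t)) \<in> D"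
      using psb by (rule curve_chart[of D \<gamma> t]) blast
    have t: "t \<in> {t - e<..<t + e}" using d(2) by simp
    define F where "F = tau b \<circ> c"
    have cne: "c (d 0 t) \<noteq> Fin b" using off[of t] d(3)[OF t] by simp
    have "F analytic_on {d 0 t}"
      using holo_at_tau[OF cne] by (simp add: F_def holo_at_chart[OF d(1)])
    then have F: "(F has_field_derivative deriv F (d 0 t)) (at (d 0 t))"
      using analytic_on_imp_differentiable_at DERIV_deriv_iff_field_differentiable by blast
    have F0: "deriv F (d 0 t) \<noteq> 0" unfolding F_def by (rule deriv_tau_chart[OF d(1) cne])
    have "(F \<circ> d 0 has_vector_derivative d 1 t * deriv F (d 0 t)) (at t)"
      using field_vector_diff_chain_at[OF d(4)[OF t, of 0] F] by simp
    then have "(\<Gamma> has_vector_derivative d 1 t * deriv F (d 0 t)) (at t)"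
      by (rule has_vector_derivative_transform_within_open[of _ _ _ "{t - e<..<t + e}"])
         (use t d(3) in \<open>auto simp: F_def \<Gamma>_def\<close>)
    then have \<Gamma>': "\<Gamma>' t = deriv F (d 0 t) * d 1 t"
      by (simp add: \<Gamma>'_def vector_derivative_at mult.commute)
    then show "\<Gamma>' t \<noteq> 0" using F0 d(5) by simp
    have \<Gamma>t: "\<Gamma> t = F (d 0 t)" using d(3)[OF t] by (simp add: \<Gamma>_def F_def)
    have pos: "\<forall>\<^sub>F r in at_right (0::real). 0 < r" by (rule eventually_at_right_less)
    have ne: "\<forall>\<^sub>F w in nhds (d 0 t). c w \<noteq> Fin b"
    proof (cases "\<exists>w0. c w0 = Fin b")
      case True
      then obtain w0 where w0: "c w0 = Fin b" by blast
      with cne have "d 0 t \<noteq> w0" by auto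
      then have "\<forall>\<^sub>F w in nhds (d 0 t). w \<noteq> w0" by (rule t1_space_nhds)
      then show ?thesis by eventually_elim (use w0 chart_inject[OF d(1)] in metis)
    qed simp
    have "((\<lambda>r::real. d 0 t + of_real r * (\<i> * d 1 t)) \<longlongrightarrow> d 0 t + of_real 0 * (\<i> * d 1 t)) (at_right 0)"
      by (intro tendsto_intros)
    then have "((\<lambda>r::real. d 0 t + of_real r * (\<i> * d 1 t)) \<longlongrightarrow> d 0 t) (at_right 0)"
      by simp
    with ne have "\<forall>\<^sub>F r in at_right (0::real). c (d 0 t + of_real r * (\<i> * d 1 t)) \<noteq> Fin b"
      by (rule eventually_compose_filterlim)
    with pos d(6) inner_normal_direction[OF F F0 d(5)]
    show "\<forall>\<^sub>F r in at_right 0. \<exists>\<omega>. norm (\<omega> - \<i>) < 1/2 \<and> \<Gamma> t + of_real r * \<omega> * \<Gamma>' t \<in> kap b -` D"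
    proof eventually_elim
      case (elim r)
      define w where "w = d 0 t + of_real r * (\<i> * d 1 t)"
      define \<omega> where "\<omega> = (F w - F (d 0 t)) / (of_real r * (deriv F (d 0 t) * d 1 t))"
      have "\<Gamma> t + of_real r * \<omega> * \<Gamma>' t = tau b (c w)"
        using elim(1) F0 d(5) unfolding \<omega>_def \<Gamma>' \<Gamma>t by (simp add: F_def)
      moreover have "kap b (tau b (c w)) \<in> D" using elim by (simp add: kap_tau w_def)
      moreover have "norm (\<omega> - \<i>) < 1/2" using elim(3) by (simp add: \<omega>_def w_def)
      ultimately show ?case by (intro exI[of _ \<omega>]) simp
    qed
  qed
qed

text \<open>Pulled back to the unit disc, which is convex, the form \<open>f dg\<close> has a primitive.\<close>

lemma primitive_on_disc:
  assumes D: "open D" "biholomorphic_to_disc D"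
    and f: "\<And>p. p \<in> D \<Longrightarrow> holo_at f p" and g: "\<And>p. p \<in> D \<Longrightarrow> holo_at g p"
  obtains H where "\<And>u. kap b u \<in> D \<Longrightarrow>
    (H has_field_derivative (f \<circ> kap b) u * deriv (g \<circ> kap b) u) (at u)"
proof -
  obtain \<phi> \<psi> where bi: "\<phi> ` ball 0 1 = D" "\<psi> ` D = ball 0 1" "\<And>p. p \<in> D \<Longrightarrow> \<phi> (\<psi> p) = p"
    "\<And>u. u \<in> ball 0 1 \<Longrightarrow> \<exists>c\<in>charts. \<exists>h. \<exists>e>0. h holomorphic_on ball u e \<and> (\<forall>v\<in>ball u e. \<phi> v = c (h v))"
    "\<And>c. c \<in> charts \<Longrightarrow> (\<psi> \<circ> c) holomorphic_on (c -` D)"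
    using D(2) unfolding biholomorphic_to_disc_def by metis
  have pull: "(F \<circ> \<phi>) holomorphic_on ball 0 1" if F: "\<And>p. p \<in> D \<Longrightarrow> holo_at F p" for F
  proof -
    have "(F \<circ> \<phi>) analytic_on {u}" if u: "u \<in> ball 0 1" for u
    proof -
      obtain c h e where c: "c \<in> charts" "e > 0" "h holomorphic_on ball u e" "\<And>v. v \<in> ball u e \<Longrightarrow> \<phi> v = c (h v)"
        using bi(4)[OF u] by metis
      have "h analytic_on {u}" using c by (auto simp: analytic_at intro!: exI[of _ "ball u e"])
      moreover have "(F \<circ> c) analytic_on {h u}"
      proof -
        have "\<phi> u = c (h u)" using c(2,4) by simp
        moreover have "\<phi> u \<in> D" using bi(1) u by blast
        ultimately show ?thesis using F[of "\<phi> u"] holo_at_chart[OF c(1), of F "h u"] by simp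
      qed
      ultimately have "((F \<circ> c) \<circ> h) analytic_on {u}" by (intro analytic_on_compose) auto
      moreover have "\<forall>\<^sub>F v in nhds u. v \<in> ball u e" using c(2) by (intro eventually_nhds_in_open) auto
      then have "\<forall>\<^sub>F v in nhds u. ((F \<circ> c) \<circ> h) v = (F \<circ> \<phi>) v"
        by eventually_elim (use c(4) in auto)
      ultimately show ?thesis using analytic_at_cong[of "(F \<circ> c) \<circ> h" "F \<circ> \<phi>" u u] by simp
    qed
    then have "(F \<circ> \<phi>) analytic_on ball 0 1" using analytic_on_analytic_at by blast
    then show ?thesis by (rule analytic_imp_holomorphic)
  qed
  have "(\<lambda>u. (f \<circ> \<phi>) u * deriv (g \<circ> \<phi>) u) holomorphic_on ball 0 1"
    by (rule holomorphic_on_mult[OF pull[OF f] holomorphic_deriv[OF pull[OF g] open_ball]])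
  then obtain P where P: "\<And>u. u \<in> ball 0 1 \<Longrightarrow>
      (P has_field_derivative (f \<circ> \<phi>) u * deriv (g \<circ> \<phi>) u) (at u within ball 0 1)"
    by (rule holomorphic_convex_primitive'[OF convex_ball open_ball]) blast
  show ?thesis
  proof
    fix u assume u: "kap b u \<in> D"
    define \<theta> where "\<theta> = \<psi> \<circ> kap b"
    have \<theta>u: "\<theta> u \<in> ball 0 1" "\<phi> (\<theta> u) = kap b u" using bi(2,3) u by (auto simp: \<theta>_def)
    obtain c h where c: "c \<in> charts" "h analytic_on {u}" "kap b u = c (h u)" "\<forall>\<^sub>F v in nhds u. kap b v = c (h v)"
      using kap_local_chart by metis
    have "(\<psi> \<circ> c) analytic_on {h u}"
      using bi(5)[OF c(1)] open_vimage_chart[OF c(1) D(1)] c(3) u by (auto simp: analytic_at)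
    then have "((\<psi> \<circ> c) \<circ> h) analytic_on {u}" using c(2) by (intro analytic_on_compose) auto
    moreover have "\<forall>\<^sub>F v in nhds u. ((\<psi> \<circ> c) \<circ> h) v = \<theta> v"
      using c(4) by eventually_elim (simp add: \<theta>_def)
    ultimately have "\<theta> analytic_on {u}" using analytic_at_cong[of "(\<psi> \<circ> c) \<circ> h" \<theta> u u] by simp
    then have d\<theta>: "(\<theta> has_field_derivative deriv \<theta> u) (at u)"
      using analytic_on_imp_differentiable_at DERIV_deriv_iff_field_differentiable by blast
    have dg: "((g \<circ> \<phi>) has_field_derivative deriv (g \<circ> \<phi>) (\<theta> u)) (at (\<theta> u))"
      using pull[OF g] \<theta>u(1) by (intro holomorphic_derivI) auto
    have "((g \<circ> \<phi>) \<circ> \<theta> has_field_derivative deriv (g \<circ> \<phi>) (\<theta> u) * deriv \<theta> u) (at u)"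
      using DERIV_chain[OF dg d\<theta>] .
    moreover have "\<forall>\<^sub>F v in nhds u. ((g \<circ> \<phi>) \<circ> \<theta>) v = (g \<circ> kap b) v"
    proof -
      have "\<forall>\<^sub>F v in nhds u. v \<in> kap b -` D"
        using u by (intro eventually_nhds_in_open open_vimage_kap D) auto
      then show ?thesis by eventually_elim (use bi(3) in \<open>auto simp: \<theta>_def\<close>)
    qed
    ultimately have "((g \<circ> kap b) has_field_derivative deriv (g \<circ> \<phi>) (\<theta> u) * deriv \<theta> u) (at u)"
      using DERIV_cong_ev by blast
    then have "deriv (g \<circ> kap b) u = deriv (g \<circ> \<phi>) (\<theta> u) * deriv \<theta> u" by (rule DERIV_imp_deriv)
    moreover have "(P has_field_derivative (f \<circ> \<phi>) (\<theta> u) * deriv (g \<circ> \<phi>) (\<theta> u)) (at (\<theta> u))"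
      using P[OF \<theta>u(1)] at_within_open[OF \<theta>u(1) open_ball] by simp
    from DERIV_chain[OF this d\<theta>]
    have "(P \<circ> \<theta> has_field_derivative (f \<circ> \<phi>) (\<theta> u) * deriv (g \<circ> \<phi>) (\<theta> u) * deriv \<theta> u) (at u)" .
    ultimately show "(P \<circ> (\<psi> \<circ> kap b) has_field_derivative (f \<circ> kap b) u * deriv (g \<circ> kap b) u) (at u)"
      using \<theta>u(2) by (simp add: \<theta>_def[symmetric] mult.assoc)
  qed
qed

lemma finite_point_inside:
  assumes "biholomorphic_to_disc D"
  obtains b where "Fin b \<in> D"
proof -
  obtain \<phi> \<psi> where "\<phi> ` ball 0 1 = D" "\<And>u. u \<in> ball 0 1 \<Longrightarrow> \<psi> (\<phi> u) = (u :: complex)"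
    using assms unfolding biholomorphic_to_disc_def by metis
  moreover have "(0::complex) \<in> ball 0 1" "(1/2::complex) \<in> ball 0 1" by (auto simp: norm_divide)
  ultimately have "\<phi> 0 \<in> D" "\<phi> (1/2) \<in> D" "\<psi> (\<phi> 0) = 0" "\<psi> (\<phi> (1/2)) = 1/2" by blast+
  then have "\<phi> 0 \<noteq> \<phi> (1/2)" by auto
  then have "\<phi> 0 \<noteq> Infty \<or> \<phi> (1/2) \<noteq> Infty" by auto
  then show ?thesis using that \<open>\<phi> 0 \<in> D\<close> \<open>\<phi> (1/2) \<in> D\<close> by (metis cproj.exhaust)
qed

lemma loop_int_poles_outside:
  assumes D: "open D" "biholomorphic_to_disc D"
    and f: "\<And>p. p \<in> D \<union> range \<gamma> \<Longrightarrow> holo_at f p" and g: "\<And>p. p \<in> D \<union> range \<gamma> \<Longrightarrow> holo_at g p"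
  shows "loop_int \<gamma> f g = 0"
proof -
  obtain b where b: "Fin b \<in> D" using finite_point_inside[OF D(2)] .
  define \<Gamma> where "\<Gamma> = (\<lambda>t. tau b (\<gamma> t))"
  define \<Gamma>' where "\<Gamma>' = (\<lambda>t. vector_derivative \<Gamma> (at t))"
  interpret inner_boundary "kap b -` D" \<Gamma> \<Gamma>' "\<lambda>t. vector_derivative \<Gamma>' (at t)"
    unfolding \<Gamma>'_def \<Gamma>_def by (rule planar_boundary[OF D(1) b])
  define k where "k = (\<lambda>u. (f \<circ> kap b) u * deriv (g \<circ> kap b) u)"
  have off: "\<gamma> t \<noteq> Fin b" for t using range_disjoint[OF psb D(1)] b by (metis disjoint_iff rangeI)
  have kap: "kap b (\<Gamma> t) = \<gamma> t" for t using off by (simp add: \<Gamma>_def kap_tau)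
  have an: "(F \<circ> kap b) analytic_on (kap b -` D \<union> range \<Gamma>)"
    if "\<And>p. p \<in> D \<union> range \<gamma> \<Longrightarrow> holo_at F p" for F
    using that kap by (subst analytic_on_analytic_at) (auto intro!: holo_at_kap)
  obtain H where H: "\<And>u. kap b u \<in> D \<Longrightarrow> (H has_field_derivative k u) (at u)"
    unfolding k_def using primitive_on_disc[OF D, of f g b] f g by blast
  have "k analytic_on (kap b -` D \<union> range \<Gamma>)"
    unfolding k_def by (intro analytic_intros analytic_deriv an f g)
  then have "continuous_on (kap b -` D \<union> range \<Gamma>) k"
    by (intro holomorphic_on_imp_continuous_on analytic_imp_holomorphic)
  from integral_zero[OF this, of H] H have "integral {0..1} (\<lambda>s. k (\<Gamma> s) * \<Gamma>' s) = 0" by simp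
  moreover have "vector_derivative (\<lambda>s. g (\<gamma> s)) (at t) = deriv (g \<circ> kap b) (\<Gamma> t) * \<Gamma>' t" for t
  proof -
    have "(g \<circ> kap b) analytic_on {\<Gamma> t}" using analytic_on_subset[OF an[OF g]] by auto
    then have "((g \<circ> kap b) has_field_derivative deriv (g \<circ> kap b) (\<Gamma> t)) (at (\<Gamma> t))"
      using analytic_on_imp_differentiable_at DERIV_deriv_iff_field_differentiable by blast
    from field_vector_diff_chain_at[OF d1 this]
    have "((\<lambda>s. g (\<gamma> s)) has_vector_derivative \<Gamma>' t * deriv (g \<circ> kap b) (\<Gamma> t)) (at t)"
      by (simp add: o_def kap)
    then show ?thesis by (simp add: vector_derivative_at mult.commute)
  qed
  ultimately show ?thesis
    by (simp add: loop_int_def k_def kap mult.assoc)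
qed

end

section \<open>Linear operators on a quotient\<close>

text \<open>The operators act on cosets; the lemmas of this section translate their linearity into statements on
  representing vectors.\<close>

definition qlinear :: "('x \<Rightarrow>\<^sub>0 complex) set \<Rightarrow> ('x \<Rightarrow>\<^sub>0 complex) set set
    \<Rightarrow> (('x \<Rightarrow>\<^sub>0 complex) set \<Rightarrow> ('x \<Rightarrow>\<^sub>0 complex) set) \<Rightarrow> bool"
  where "qlinear R M T \<longleftrightarrow> (\<forall>m\<in>M. T m \<in> M) \<and> (\<forall>m\<in>M. \<forall>m'\<in>M. T (qadd R m m') = qadd R (T m) (T m'))
    \<and> (\<forall>c. \<forall>m\<in>M. T (qscale R c m) = qscale R c (T m))"

context
  fixes X :: "'x set" and R :: "('x \<Rightarrow>\<^sub>0 complex) set"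
    and T :: "('x \<Rightarrow>\<^sub>0 complex) set \<Rightarrow> ('x \<Rightarrow>\<^sub>0 complex) set"
  assumes T: "qlinear R (quot X R) T"
begin

lemma qlinear_closed: "m \<in> quot X R \<Longrightarrow> T m \<in> quot X R"
  using T by (simp add: qlinear_def)

lemma qlinear_add:
  assumes "m \<in> quot X R" "a \<in> quot X R" "b \<in> quot X R" "coset_rep R m = coset_rep R a + coset_rep R b"
  shows "coset_rep R (T m) = coset_rep R (T a) + coset_rep R (T b)"
proof -
  have "m = qadd R a b"
    using assms coset_rep_inject[OF assms(1) quot_qadd[OF assms(2,3)]] by (simp add: coset_rep_qadd)
  then have "T m = qadd R (T a) (T b)" using assms T by (simp add: qlinear_def)
  then show ?thesis
    using coset_rep_qadd[OF qlinear_closed[OF assms(2)] qlinear_closed[OF assms(3)]] by simp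
qed

lemma qlinear_scale:
  assumes "m \<in> quot X R" "a \<in> quot X R" "coset_rep R m = c *\<^sub>C coset_rep R a"
  shows "coset_rep R (T m) = c *\<^sub>C coset_rep R (T a)"
proof -
  have "m = qscale R c a"
    using assms(3) coset_rep_inject[OF assms(1) quot_qscale[OF assms(2,2)], of c]
    by (simp add: coset_rep_qscale[OF assms(2)])
  then have "T m = qscale R c (T a)" using assms T by (simp add: qlinear_def)
  then show ?thesis using coset_rep_qscale[OF qlinear_closed[OF assms(2)]] by simp
qed

lemma qlinear_diff:
  assumes "m \<in> quot X R" "a \<in> quot X R" "b \<in> quot X R" "coset_rep R m = coset_rep R a - coset_rep R b"
  shows "coset_rep R (T m) = coset_rep R (T a) - coset_rep R (T b)"
  using qlinear_add[of a m b] assms by simp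

lemma qlinear_combination:
  assumes "m \<in> quot X R" "a \<in> quot X R" "b \<in> quot X R" "d \<in> quot X R"
    and "coset_rep R m = coset_rep R a + coset_rep R b + c *\<^sub>C coset_rep R d"
  shows "coset_rep R (T m) = coset_rep R (T a) + coset_rep R (T b) + c *\<^sub>C coset_rep R (T d)"
proof -
  note ab = quot_qadd[OF assms(2,3)] and cd = quot_qscale[OF assms(4,4), of c]
  note reps = coset_rep_qadd[OF assms(2,3)] coset_rep_qscale[OF assms(4), of c]
  have "coset_rep R (T m) = coset_rep R (T (qadd R a b)) + coset_rep R (T (qscale R c d))"
    by (rule qlinear_add[OF assms(1) ab cd]) (simp only: assms(5) reps)
  moreover have "coset_rep R (T (qadd R a b)) = coset_rep R (T a) + coset_rep R (T b)"
    by (rule qlinear_add[OF ab assms(2,3) reps(1)])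
  moreover have "coset_rep R (T (qscale R c d)) = c *\<^sub>C coset_rep R (T d)"
    by (rule qlinear_scale[OF cd assms(4) reps(2)])
  ultimately show ?thesis by simp
qed

lemma qlinear_sum:
  assumes "finite I" "\<And>i. i \<in> I \<Longrightarrow> b i \<in> quot X R" "m \<in> quot X R"
    and "coset_rep R m = (\<Sum>i\<in>I. coset_rep R (b i))"
  shows "coset_rep R (T m) = (\<Sum>i\<in>I. coset_rep R (T (b i)))"
proof -
  have "\<exists>s\<in>quot X R. coset_rep R s = (\<Sum>i\<in>I. coset_rep R (b i))
      \<and> coset_rep R (T s) = (\<Sum>i\<in>I. coset_rep R (T (b i)))"
    using assms(1,2)
  proof (induction I)
    case empty
    have z: "cls R 0 \<in> quot X R" by (rule cls_zero_in_quot)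
    have r0: "coset_rep R (cls R 0) = 0" by (simp add: coset_rep_cls coset_proj_zero)
    have "coset_rep R (T (cls R 0)) = 0"
      using qlinear_scale[OF z z, of 0] r0 by simp
    then show ?case using z r0 by (intro bexI[of _ "cls R 0"]) auto
  next
    case (insert i I)
    then obtain s where s: "s \<in> quot X R" "coset_rep R s = (\<Sum>i\<in>I. coset_rep R (b i))"
      "coset_rep R (T s) = (\<Sum>i\<in>I. coset_rep R (T (b i)))" by auto
    have bi: "b i \<in> quot X R" and q: "qadd R (b i) s \<in> quot X R"
      using insert s by (auto intro: quot_qadd)
    have "coset_rep R (T (qadd R (b i) s)) = coset_rep R (T (b i)) + coset_rep R (T s)"
      by (rule qlinear_add[OF q bi s(1) coset_rep_qadd[OF bi s(1)]])
    then show ?case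
      using insert.hyps s q coset_rep_qadd[OF bi s(1)] by (intro bexI[of _ "qadd R (b i) s"]) simp_all
  qed
  then obtain s where s: "s \<in> quot X R" "coset_rep R s = (\<Sum>i\<in>I. coset_rep R (b i))"
      "coset_rep R (T s) = (\<Sum>i\<in>I. coset_rep R (T (b i)))" by blast
  then have "m = s" using coset_rep_inject[OF assms(3) s(1)] assms(4) by simp
  then show ?thesis using s by simp
qed

lemma qlinear_diff_sum:
  assumes "finite I" "\<And>i. i \<in> I \<Longrightarrow> b i \<in> quot X R" "m \<in> quot X R" "a \<in> quot X R"
    and "coset_rep R m = coset_rep R a - (\<Sum>i\<in>I. coset_rep R (b i))"
  shows "coset_rep R (T m) = coset_rep R (T a) - (\<Sum>i\<in>I. coset_rep R (T (b i)))"
proof -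
  have q: "qdiff R a m \<in> quot X R" using assms by (intro quot_qdiff)
  note rq = coset_rep_qdiff[OF assms(4,3)]
  have "coset_rep R (T (qdiff R a m)) = (\<Sum>i\<in>I. coset_rep R (T (b i)))"
    by (rule qlinear_sum[OF assms(1,2) q]) (simp_all add: rq assms(5))
  moreover have "coset_rep R (T (qdiff R a m)) = coset_rep R (T a) - coset_rep R (T m)"
    by (rule qlinear_diff[OF q assms(4,3) rq])
  ultimately show ?thesis by (simp add: algebra_simps)
qed

end

section \<open>The commutator of two operators\<close>

text \<open>This is the relation of the enveloping algebra that makes the bracket a commutator.\<close>

lemma DW_act_commutator:
  fixes \<rho> :: "nat \<Rightarrow> 'a::complex_lie_algebra \<Rightarrow> 'w::complex_vector_space \<Rightarrow> 'w"
  assumes "\<mu> \<in> maps_poles_in D" "\<nu> \<in> maps_poles_in D" "w \<in> tuples n W"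
  defines "r \<equiv> coset_rep (DW_rel D n W \<rho>)" and "act \<equiv> DW_act D n W \<rho>" and "p \<equiv> DW_pure D n W \<rho> w"
  shows "r (act \<mu> (act \<nu> p)) = r (act \<nu> (act \<mu> p)) + r (act (mlie \<mu> \<nu>) p)"
proof -
  let ?L = "maps_poles_in D :: (cproj \<Rightarrow> 'a) set"
  have mn: "mlie \<mu> \<nu> \<in> ?L" using assms(1,2) by (rule mlie_regular_on)
  have "gen ([] @ [\<mu>, \<nu>] @ []) - gen ([] @ [\<nu>, \<mu>] @ []) - gen ([] @ [mlie \<mu> \<nu>] @ []) \<in> uea_rel ?L"
    using assms(1,2) unfolding uea_rel_def by blast
  then have "gen [\<mu>, \<nu>] - (gen [\<nu>, \<mu>] + gen [mlie \<mu> \<nu>]) \<in> cspan (uea_rel ?L)"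
    by (simp add: diff_diff_eq cvs.span_base)
  then have "uword ?L [\<mu>, \<nu>] = qadd (uea_rel ?L) (uword ?L [\<nu>, \<mu>]) (uword ?L [mlie \<mu> \<nu>])"
    by (simp add: uword_def qadd_cls cls_eq_iff')
  moreover have "gen (qadd (uea_rel ?L) (uword ?L [\<nu>, \<mu>]) (uword ?L [mlie \<mu> \<nu>]), pure n W w)
      - gen (uword ?L [\<nu>, \<mu>], pure n W w) - gen (uword ?L [mlie \<mu> \<nu>], pure n W w) \<in> DW_rel D n W \<rho>"
    using assms(1-3) mn by (intro DW_relI uword_in_uea pure_in_tensor) auto
  ultimately have "cls (DW_rel D n W \<rho>) (gen (uword ?L [\<mu>, \<nu>], pure n W w))
      = cls (DW_rel D n W \<rho>) (gen (uword ?L [\<nu>, \<mu>], pure n W w) + gen (uword ?L [mlie \<mu> \<nu>], pure n W w))"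
    by (simp add: cls_eq_iff' diff_diff_eq cvs.span_base)
  then show ?thesis
    unfolding r_def act_def p_def DW_pure_def
    by (simp add: DW_act_gen assms(1,2) mn coset_rep_cls cls_eq_iff coset_proj_add)
qed

locale DJ_operators =
  fixes D :: "cproj set" and \<gamma> :: "real \<Rightarrow> cproj" and n :: nat and z :: "nat \<Rightarrow> cproj"
    and W :: "nat \<Rightarrow> 'w::complex_vector_space set"
    and \<rho> :: "nat \<Rightarrow> 'g::quadratic_lie_algebra \<Rightarrow> 'w \<Rightarrow> 'w"
    and J :: "(cproj \<Rightarrow> 'g) \<Rightarrow> ('g uel \<times> 'w tel \<Rightarrow>\<^sub>0 complex) set \<Rightarrow> ('g uel \<times> 'w tel \<Rightarrow>\<^sub>0 complex) set"
  assumes D: "open D" "connected D" "biholomorphic_to_disc D"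
    and psb: "positive_smooth_boundary D \<gamma>"
    and rep: "\<And>k. k < n \<Longrightarrow> lie_representation (W k) (\<rho> k)"
    and J: "is_DJ D \<gamma> n z W \<rho> J"
begin

text \<open>The maps in \<open>Lout\<close> are regular outside \<open>D\<close>, those in \<open>Lin\<close> are regular inside, and both kinds are
  regular along the boundary. Identities in the module are stated for the representing vectors \<open>r m\<close>.\<close>

abbreviation "R \<equiv> DW_rel D n W \<rho>"
abbreviation "M \<equiv> DW D n W \<rho>"
abbreviation "r \<equiv> coset_rep R"
abbreviation "act \<equiv> DW_act D n W \<rho>"
abbreviation "p \<equiv> DW_pure D n W \<rho>"
abbreviation "B \<equiv> boundary_pairing \<gamma>"
abbreviation "N \<equiv> maps_regular_on (frontier D)"
abbreviation "Lout \<equiv> maps_poles_in D"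
abbreviation "Lin \<equiv> maps_regular_on (closure D)"

definition at_pt :: "(cproj \<Rightarrow> 'g) \<Rightarrow> nat \<Rightarrow> (nat \<Rightarrow> 'w) \<Rightarrow> nat \<Rightarrow> 'w"
  where "at_pt \<nu> k w = w(k := \<rho> k (\<nu> (z k)) (w k))"

lemma module_quot: "M = quot (uea Lout \<times> tensor n W) R"
  by (simp add: DW_def)

lemma frontier_eq: "frontier D = range \<gamma>" "frontier D = closure D - D"
  using psb D(1) by (auto simp: positive_smooth_boundary_def frontier_def interior_open)

lemma outer_N: "\<nu> \<in> Lout \<Longrightarrow> \<nu> \<in> N" and inner_N: "\<nu> \<in> Lin \<Longrightarrow> \<nu> \<in> N"
  by (auto simp: maps_regular_on_def frontier_eq(2))

lemma N_mero: "\<nu> \<in> N \<Longrightarrow> \<nu> \<in> mero_maps"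
  by (simp add: maps_regular_on_def)

lemma N_split:
  assumes "\<mu> \<in> N"
  obtains \<mu>1 \<mu>2 where "\<mu>1 \<in> Lout" "\<mu>2 \<in> Lin" "\<mu> = madd \<mu>1 \<mu>2"
proof -
  obtain b where "Fin b \<in> range \<gamma>" by (rule finite_boundary_point[OF psb])
  then have b: "Fin b \<in> frontier D" by (simp add: frontier_eq(1))
  have "- frontier D \<subseteq> D \<union> - closure D" using frontier_eq(2) by blast
  from mero_maps_split[OF assms b this] that show ?thesis by auto
qed

lemma
  assumes "\<nu> \<in> N"
  shows J_qlinear: "qlinear R M (J \<nu>)"
    and J_madd: "\<mu> \<in> N \<Longrightarrow> m \<in> M \<Longrightarrow> J (madd \<mu> \<nu>) m = qadd R (J \<mu> m) (J \<nu> m)"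
    and J_mscale: "m \<in> M \<Longrightarrow> J (mscale c \<nu>) m = qscale R c (J \<nu> m)"
    and J_commutator: "\<alpha> \<in> Lout \<Longrightarrow> m \<in> M \<Longrightarrow> qdiff R (J \<nu> (act \<alpha> m)) (act \<alpha> (J \<nu> m))
      = qadd R (J (mlie \<nu> \<alpha>) m) (qscale R (B \<nu> \<alpha>) m)"
    and J_exterior: "\<nu> \<in> maps_regular_on (exterior D) \<Longrightarrow> w \<in> tuples n W \<Longrightarrow>
      J \<nu> (p w) = cls R (gen (uword Lout [\<nu>], pure n W w)
        - (\<Sum>k \<in> {k. k < n \<and> z k \<in> exterior D}. gen (uword Lout [], pure n W (at_pt \<nu> k w))))"
    and J_interior: "\<nu> \<in> maps_regular_on D \<Longrightarrow> w \<in> tuples n W \<Longrightarrow>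
      J \<nu> (p w) = cls R (\<Sum>k \<in> {k. k < n \<and> z k \<in> D}. gen (uword Lout [], pure n W (at_pt \<nu> k w)))"
  using bspec[OF J[unfolded is_DJ_def Let_def] assms]
  unfolding qlinear_def DW_pure_def at_pt_def by blast+

lemma J_closed: "\<nu> \<in> N \<Longrightarrow> m \<in> M \<Longrightarrow> J \<nu> m \<in> M"
  using J_qlinear by (simp add: qlinear_def)

lemma act_closed: "\<alpha> \<in> Lout \<Longrightarrow> m \<in> M \<Longrightarrow> act \<alpha> m \<in> M"
  by (rule DW_act_closed)

lemma act_qlinear: "\<alpha> \<in> Lout \<Longrightarrow> qlinear R M (act \<alpha>)"
  by (simp add: qlinear_def DW_act_closed DW_act_qadd DW_act_qscale)

lemma p_closed: "w \<in> tuples n W \<Longrightarrow> p w \<in> M"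
  by (rule DW_pure_closed)

lemma mlie_N: "\<mu> \<in> N \<Longrightarrow> \<nu> \<in> N \<Longrightarrow> mlie \<mu> \<nu> \<in> N"
  by (rule mlie_regular_on)

lemma at_pt_tuples: "k < n \<Longrightarrow> w \<in> tuples n W \<Longrightarrow> at_pt \<nu> k w \<in> tuples n W"
  using rep[of k] by (auto simp: at_pt_def tuples_def PiE_iff extensional_def lie_representation_def)

lemmas memI = J_closed act_closed p_closed at_pt_tuples outer_N inner_N mlie_N

lemma r_qadd: "a \<in> M \<Longrightarrow> b \<in> M \<Longrightarrow> r (qadd R a b) = r a + r b"
  and r_qdiff: "a \<in> M \<Longrightarrow> b \<in> M \<Longrightarrow> r (qdiff R a b) = r a - r b"
  and r_qscale: "a \<in> M \<Longrightarrow> r (qscale R c a) = c *\<^sub>C r a"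
  and r_inject: "a \<in> M \<Longrightarrow> b \<in> M \<Longrightarrow> r a = r b \<Longrightarrow> a = b"
  and M_qadd: "a \<in> M \<Longrightarrow> b \<in> M \<Longrightarrow> qadd R a b \<in> M"
  and M_qdiff: "a \<in> M \<Longrightarrow> b \<in> M \<Longrightarrow> qdiff R a b \<in> M"
  and M_qscale: "a \<in> M \<Longrightarrow> qscale R c a \<in> M"
  unfolding module_quot
  by (auto intro: quot_closed simp: coset_rep_simps coset_rep_inject)

lemma qlin_J: "\<nu> \<in> N \<Longrightarrow> qlinear R (quot (uea Lout \<times> tensor n W) R) (J \<nu>)"
  and qlin_act: "\<alpha> \<in> Lout \<Longrightarrow> qlinear R (quot (uea Lout \<times> tensor n W) R) (act \<alpha>)"
  using J_qlinear act_qlinear by (simp_all add: module_quot)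

lemmas J_add = qlinear_add[OF qlin_J, folded module_quot]
  and J_scale = qlinear_scale[OF qlin_J, folded module_quot]
  and J_combination = qlinear_combination[OF qlin_J, folded module_quot]
  and J_sum = qlinear_sum[OF qlin_J, folded module_quot]
  and J_diff_sum = qlinear_diff_sum[OF qlin_J, folded module_quot]
  and act_combination = qlinear_combination[OF qlin_act, folded module_quot]
  and act_sum = qlinear_sum[OF qlin_act, folded module_quot]
  and act_diff_sum = qlinear_diff_sum[OF qlin_act, folded module_quot]

lemma r_J_madd: "\<mu> \<in> N \<Longrightarrow> \<nu> \<in> N \<Longrightarrow> m \<in> M \<Longrightarrow> r (J (madd \<mu> \<nu>) m) = r (J \<mu> m) + r (J \<nu> m)"
  by (simp add: J_madd r_qadd J_closed)

lemma r_J_act: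
  assumes "\<nu> \<in> N" "\<alpha> \<in> Lout" "m \<in> M"
  shows "r (J \<nu> (act \<alpha> m)) = r (act \<alpha> (J \<nu> m)) + r (J (mlie \<nu> \<alpha>) m) + B \<nu> \<alpha> *\<^sub>C r m"
proof -
  have mem: "J \<nu> (act \<alpha> m) \<in> M" "act \<alpha> (J \<nu> m) \<in> M" "J (mlie \<nu> \<alpha>) m \<in> M"
    using assms by (auto intro: memI)
  have "r (qdiff R (J \<nu> (act \<alpha> m)) (act \<alpha> (J \<nu> m))) = r (qadd R (J (mlie \<nu> \<alpha>) m) (qscale R (B \<nu> \<alpha>) m))"
    using assms by (simp add: J_commutator)
  then have "r (J \<nu> (act \<alpha> m)) - r (act \<alpha> (J \<nu> m)) = r (J (mlie \<nu> \<alpha>) m) + B \<nu> \<alpha> *\<^sub>C r m"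
    using mem assms(3) by (simp add: r_qdiff r_qadd r_qscale M_qscale)
  then show ?thesis by (simp add: algebra_simps)
qed

lemma r_p: "r (p w) = coset_proj R (gen (uword Lout [], pure n W w))"
  and r_act_p: "\<nu> \<in> Lout \<Longrightarrow> r (act \<nu> (p w)) = coset_proj R (gen (uword Lout [\<nu>], pure n W w))"
  by (simp_all add: DW_pure_def DW_act_gen coset_rep_cls)

lemma r_J_outer:
  assumes "\<nu> \<in> Lout" "w \<in> tuples n W"
  shows "r (J \<nu> (p w)) = r (act \<nu> (p w)) - (\<Sum>k \<in> {k. k < n \<and> z k \<in> exterior D}. r (p (at_pt \<nu> k w)))"
proof -
  have "\<nu> \<in> maps_regular_on (exterior D)"
    using assms(1) closure_subset[of D] by (auto simp: maps_regular_on_def)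
  then show ?thesis
    using assms
    by (simp add: J_exterior outer_N coset_rep_cls coset_proj_diff coset_proj_sum r_p r_act_p)
qed

lemma r_J_inner:
  assumes "\<nu> \<in> Lin" "w \<in> tuples n W"
  shows "r (J \<nu> (p w)) = (\<Sum>k \<in> {k. k < n \<and> z k \<in> D}. r (p (at_pt \<nu> k w)))"
proof -
  have "\<nu> \<in> maps_regular_on D"
    using assms(1) closure_subset[of D] by (auto simp: maps_regular_on_def)
  then show ?thesis
    using assms by (simp add: J_interior inner_N coset_rep_cls coset_proj_sum r_p)
qed

lemma at_pt_commute: "j \<noteq> k \<Longrightarrow> at_pt \<mu> j (at_pt \<nu> k w) = at_pt \<nu> k (at_pt \<mu> j w)"
  by (auto simp: at_pt_def fun_upd_twist)

text \<open>In a single tensor factor this is the representation property of \<open>\<rho> k\<close>.\<close>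

lemma at_pt_bracket:
  assumes "k < n" "w \<in> tuples n W" "pre_mero \<mu>" "pre_mero \<nu>" "regular_at \<mu> (z k)" "regular_at \<nu> (z k)"
  shows "r (p (at_pt \<mu> k (at_pt \<nu> k w))) = r (p (at_pt \<nu> k (at_pt \<mu> k w))) + r (p (at_pt (mlie \<mu> \<nu>) k w))"
proof -
  let ?x = "\<mu> (z k)" and ?y = "\<nu> (z k)" and ?v = "w k"
  have v: "?v \<in> W k" using assms(1,2) by (auto simp: tuples_def)
  have lr: "csubspace (W k)" "\<And>x v. v \<in> W k \<Longrightarrow> \<rho> k x v \<in> W k"
    "\<rho> k (lie ?x ?y) ?v = \<rho> k ?x (\<rho> k ?y ?v) - \<rho> k ?y (\<rho> k ?x ?v)"
    using rep[OF assms(1)] v unfolding lie_representation_def by blast+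
  have "\<rho> k ?x (\<rho> k ?y ?v) = \<rho> k ?y (\<rho> k ?x ?v) + \<rho> k (lie ?x ?y) ?v"
    using lr(3) by simp
  then have "p (at_pt \<mu> k (at_pt \<nu> k w)) = p (w(k := \<rho> k ?y (\<rho> k ?x ?v) + \<rho> k (lie ?x ?y) ?v))"
    by (simp add: at_pt_def)
  also have "\<dots> = qadd R (p (w(k := \<rho> k ?y (\<rho> k ?x ?v)))) (p (w(k := \<rho> k (lie ?x ?y) ?v)))"
    by (rule DW_pure_add[OF assms(2,1) lr(1) lr(2)[OF lr(2)[OF v]] lr(2)[OF v]])
  also have "\<dots> = qadd R (p (at_pt \<nu> k (at_pt \<mu> k w))) (p (at_pt (mlie \<mu> \<nu>) k w))"
    using mlie_regular[OF assms(3-6)] by (simp add: at_pt_def)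
  finally show ?thesis
    using at_pt_tuples assms(1,2) by (simp add: r_qadd p_closed)
qed

text \<open>Evaluations at different points act on different tensor factors and commute; so only the diagonal
  terms differ.\<close>

lemma double_sum_bracket:
  assumes "I \<subseteq> {..<n}" "w \<in> tuples n W" "pre_mero \<mu>" "pre_mero \<nu>"
    "\<And>k. k \<in> I \<Longrightarrow> regular_at \<mu> (z k)" "\<And>k. k \<in> I \<Longrightarrow> regular_at \<nu> (z k)"
  shows "(\<Sum>k\<in>I. \<Sum>j\<in>I. r (p (at_pt \<mu> j (at_pt \<nu> k w))))
    = (\<Sum>k\<in>I. \<Sum>j\<in>I. r (p (at_pt \<nu> j (at_pt \<mu> k w)))) + (\<Sum>k\<in>I. r (p (at_pt (mlie \<mu> \<nu>) k w)))"
proof -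
  have fin: "finite I" using assms(1) finite_subset by blast
  have eq: "r (p (at_pt \<mu> j (at_pt \<nu> k w)))
      = r (p (at_pt \<nu> k (at_pt \<mu> j w))) + (if j = k then r (p (at_pt (mlie \<mu> \<nu>) k w)) else 0)" if "k \<in> I" for j k
    using at_pt_bracket[of k w \<mu> \<nu>] at_pt_commute[of j k \<mu> \<nu> w] that assms by auto
  have "(\<Sum>k\<in>I. \<Sum>j\<in>I. r (p (at_pt \<mu> j (at_pt \<nu> k w))))
      = (\<Sum>k\<in>I. (\<Sum>j\<in>I. r (p (at_pt \<nu> k (at_pt \<mu> j w)))) + r (p (at_pt (mlie \<mu> \<nu>) k w)))"
    using fin by (intro sum.cong refl) (simp add: eq sum.distrib)
  also have "\<dots> = (\<Sum>k\<in>I. \<Sum>j\<in>I. r (p (at_pt \<nu> j (at_pt \<mu> k w)))) + (\<Sum>k\<in>I. r (p (at_pt (mlie \<mu> \<nu>) k w)))"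
    unfolding sum.distrib by (subst sum.swap) simp
  finally show ?thesis .
qed

definition gap :: "(cproj \<Rightarrow> 'g) \<Rightarrow> (cproj \<Rightarrow> 'g) \<Rightarrow> ('g uel \<times> 'w tel \<Rightarrow>\<^sub>0 complex) set \<Rightarrow> ('g uel \<times> 'w tel \<Rightarrow>\<^sub>0 complex)"
  where "gap \<mu> \<nu> m = r (J \<mu> (J \<nu> m)) - r (J \<nu> (J \<mu> m)) - r (J (mlie \<mu> \<nu>) m) - B \<mu> \<nu> *\<^sub>C r m"

lemma N_range: "\<nu> \<in> N \<Longrightarrow> \<nu> \<in> maps_regular_on (range \<gamma>)"
  by (simp add: frontier_eq(1))

text \<open>The operators, the bracket and the pairing are all additive.\<close>

lemma gap_madd_left:
  assumes "\<mu>1 \<in> N" "\<mu>2 \<in> N" "\<nu> \<in> N" "m \<in> M"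
  shows "gap (madd \<mu>1 \<mu>2) \<nu> m = gap \<mu>1 \<nu> m + gap \<mu>2 \<nu> m"
proof -
  have mm: "madd \<mu>1 \<mu>2 \<in> N" using assms by (intro madd_regular_on)
  have "r (J (madd \<mu>1 \<mu>2) (J \<nu> m)) = r (J \<mu>1 (J \<nu> m)) + r (J \<mu>2 (J \<nu> m))"
    using assms J_closed by (intro r_J_madd)
  moreover have "r (J \<nu> (J (madd \<mu>1 \<mu>2) m)) = r (J \<nu> (J \<mu>1 m)) + r (J \<nu> (J \<mu>2 m))"
    using assms mm by (intro J_add r_J_madd J_closed)
  moreover have "r (J (mlie (madd \<mu>1 \<mu>2) \<nu>) m) = r (J (mlie \<mu>1 \<nu>) m) + r (J (mlie \<mu>2 \<nu>) m)"
    using assms by (simp add: mlie_madd_left N_mero r_J_madd mlie_N)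
  moreover have "B (madd \<mu>1 \<mu>2) \<nu> = B \<mu>1 \<nu> + B \<mu>2 \<nu>"
    using assms by (intro boundary_pairing_madd_left[OF psb] N_range)
  ultimately show ?thesis by (simp add: gap_def cvs.scale_left_distrib)
qed

lemma r_J_swap:
  assumes "\<mu> \<in> N" "\<nu> \<in> N" "m \<in> M"
  shows "r (J (mlie \<nu> \<mu>) m) = - r (J (mlie \<mu> \<nu>) m)"
proof -
  have "J (mlie \<nu> \<mu>) m = qscale R (- 1) (J (mlie \<mu> \<nu>) m)"
    using assms J_mscale[of "mlie \<mu> \<nu>" m "- 1"] by (simp add: mlie_swap[of \<nu> \<mu>] mlie_N)
  then show ?thesis
    using assms by (simp add: r_qscale J_closed mlie_N)
qed

lemma gap_swap:
  assumes "\<mu> \<in> N" "\<nu> \<in> N" "m \<in> M"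
  shows "gap \<nu> \<mu> m = - gap \<mu> \<nu> m"
  using assms r_J_swap[OF assms] boundary_pairing_antisym[OF psb N_range N_range, of \<mu> \<nu>] by (simp add: gap_def)

lemma gap_madd_right:
  assumes "\<mu>1 \<in> N" "\<mu>2 \<in> N" "\<nu> \<in> N" "m \<in> M"
  shows "gap \<nu> (madd \<mu>1 \<mu>2) m = gap \<nu> \<mu>1 m + gap \<nu> \<mu>2 m"
proof -
  have "gap \<nu> \<kappa> m = - gap \<kappa> \<nu> m" if "\<kappa> \<in> N" for \<kappa> by (rule gap_swap[OF that assms(3,4)])
  from this[OF assms(1)] this[OF assms(2)] this[OF madd_regular_on[OF assms(1,2)]]
  show ?thesis using gap_madd_left[OF assms] by simp
qed

text \<open>Moving \<open>\<alpha>\<close> to the left through \<open>J \<mu> (J \<nu> (\<alpha> m))\<close> produces four further terms. In the commutator, those with a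
  factor \<open>B \<nu> \<alpha>\<close> or \<open>B \<mu> \<alpha>\<close> cancel, and the remaining ones are the commutators belonging to the pairs
  \<open>([\<mu>, \<alpha>], \<nu>)\<close> and \<open>(\<mu>, [\<nu>, \<alpha>])\<close>, known by hypothesis. The Jacobi and cocycle identities combine the results.\<close>

lemma gap_act:
  assumes \<mu>: "\<mu> \<in> N" and \<nu>: "\<nu> \<in> N" and \<alpha>: "\<alpha> \<in> Lout" and m: "m \<in> M"
    and IH: "\<And>\<mu> \<nu>. \<mu> \<in> N \<Longrightarrow> \<nu> \<in> N \<Longrightarrow> gap \<mu> \<nu> m = 0"
  shows "gap \<mu> \<nu> (act \<alpha> m) = 0"
proof -
  have \<alpha>N: "\<alpha> \<in> N" by (rule outer_N[OF \<alpha>])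
  have half: "r (J \<mu> (J \<nu> (act \<alpha> m))) = r (act \<alpha> (J \<mu> (J \<nu> m))) + r (J (mlie \<mu> \<alpha>) (J \<nu> m)) + B \<mu> \<alpha> *\<^sub>C r (J \<nu> m)
      + r (J \<mu> (J (mlie \<nu> \<alpha>) m)) + B \<nu> \<alpha> *\<^sub>C r (J \<mu> m)" if "\<mu> \<in> N" "\<nu> \<in> N" for \<mu> \<nu>
  proof -
    have "r (J \<mu> (J \<nu> (act \<alpha> m))) = r (J \<mu> (act \<alpha> (J \<nu> m))) + r (J \<mu> (J (mlie \<nu> \<alpha>) m)) + B \<nu> \<alpha> *\<^sub>C r (J \<mu> m)"
      by (rule J_combination[OF _ _ _ _ _ r_J_act]) (use that \<alpha> m in \<open>auto intro: memI\<close>)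
    also have "r (J \<mu> (act \<alpha> (J \<nu> m))) = r (act \<alpha> (J \<mu> (J \<nu> m))) + r (J (mlie \<mu> \<alpha>) (J \<nu> m)) + B \<mu> \<alpha> *\<^sub>C r (J \<nu> m)"
      using that \<alpha> m by (intro r_J_act J_closed)
    finally show ?thesis by (simp add: algebra_simps)
  qed
  have comm: "r (J \<mu> (J \<nu> m)) = r (J \<nu> (J \<mu> m)) + r (J (mlie \<mu> \<nu>) m) + B \<mu> \<nu> *\<^sub>C r m"
    if "\<mu> \<in> N" "\<nu> \<in> N" for \<mu> \<nu>
    using IH[OF that] by (simp add: gap_def algebra_simps)
  have 1: "r (act \<alpha> (J \<mu> (J \<nu> m))) = r (act \<alpha> (J \<nu> (J \<mu> m))) + r (act \<alpha> (J (mlie \<mu> \<nu>) m)) + B \<mu> \<nu> *\<^sub>C r (act \<alpha> m)"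
    by (rule act_combination[OF _ _ _ _ _ comm]) (use \<mu> \<nu> \<alpha> m in \<open>auto intro: memI\<close>)
  have 2: "r (J (mlie \<mu> \<nu>) (act \<alpha> m)) = r (act \<alpha> (J (mlie \<mu> \<nu>) m))
      + (r (J (mlie \<mu> (mlie \<nu> \<alpha>)) m) + r (J (mlie (mlie \<mu> \<alpha>) \<nu>) m))
      + (B \<mu> (mlie \<nu> \<alpha>) + B (mlie \<mu> \<alpha>) \<nu>) *\<^sub>C r m"
    using r_J_act[OF mlie_N[OF \<mu> \<nu>] \<alpha> m]
    unfolding mlie_jacobi[OF N_mero[OF \<mu>] N_mero[OF \<nu>] N_mero[OF \<alpha>N]]
      boundary_pairing_cocycle[OF psb N_range[OF \<mu>] N_range[OF \<nu>] N_range[OF \<alpha>N]]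
      r_J_madd[OF mlie_N[OF \<mu> mlie_N[OF \<nu> \<alpha>N]] mlie_N[OF mlie_N[OF \<mu> \<alpha>N] \<nu>] m] .
  show ?thesis
    unfolding gap_def half[OF \<mu> \<nu>] half[OF \<nu> \<mu>] 1 2
    using comm[OF mlie_N[OF \<mu> \<alpha>N] \<nu>] comm[OF \<mu> mlie_N[OF \<nu> \<alpha>N]]
    by (simp add: cvs.scale_left_distrib)
qed

text \<open>Cauchy's theorem on the two sides of the curve.\<close>

lemma B_outer: "\<mu> \<in> Lout \<Longrightarrow> \<nu> \<in> Lout \<Longrightarrow> B \<mu> \<nu> = 0"
  using frontier_eq loop_int_poles_inside[OF psb D(1,2)]
  by (intro boundary_pairing_zeroI[OF psb, of \<mu> "- D"]) auto

lemma B_inner: "\<mu> \<in> Lin \<Longrightarrow> \<nu> \<in> Lin \<Longrightarrow> B \<mu> \<nu> = 0"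
proof (intro boundary_pairing_zeroI[OF psb, of \<mu> "closure D"])
  show "range \<gamma> \<subseteq> closure D" using frontier_eq by blast
  fix f g :: "cproj \<Rightarrow> complex"
  assume "\<And>p. p \<in> closure D \<Longrightarrow> holo_at f p" "\<And>p. p \<in> closure D \<Longrightarrow> holo_at g p"
  moreover have "D \<union> range \<gamma> = closure D" using frontier_eq closure_subset by blast
  ultimately show "loop_int \<gamma> f g = 0"
    by (intro loop_int_poles_outside[OF psb D(1,3)]) auto
qed auto

abbreviation "Ex_idx \<equiv> {k. k < n \<and> z k \<in> exterior D}"
abbreviation "In_idx \<equiv> {k. k < n \<and> z k \<in> D}"

lemma J_outer_outer:
  assumes "\<mu> \<in> Lout" "\<nu> \<in> Lout" "w \<in> tuples n W"
  shows "r (J \<mu> (J \<nu> (p w))) = r (act \<nu> (act \<mu> (p w))) + r (J (mlie \<mu> \<nu>) (p w))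
    - (\<Sum>k\<in>Ex_idx. r (act \<nu> (p (at_pt \<mu> k w)))) - (\<Sum>k\<in>Ex_idx. r (act \<mu> (p (at_pt \<nu> k w))))
    + (\<Sum>k\<in>Ex_idx. \<Sum>j\<in>Ex_idx. r (p (at_pt \<mu> j (at_pt \<nu> k w))))"
proof -
  note mem = assms J_closed act_closed p_closed at_pt_tuples outer_N
  have "r (J \<mu> (J \<nu> (p w))) = r (J \<mu> (act \<nu> (p w))) - (\<Sum>k\<in>Ex_idx. r (J \<mu> (p (at_pt \<nu> k w))))"
    by (rule J_diff_sum[OF _ _ _ _ _ r_J_outer]) (use assms in \<open>auto intro: memI\<close>)
  also have "(\<Sum>k\<in>Ex_idx. r (J \<mu> (p (at_pt \<nu> k w)))) = (\<Sum>k\<in>Ex_idx. r (act \<mu> (p (at_pt \<nu> k w))))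
      - (\<Sum>k\<in>Ex_idx. \<Sum>j\<in>Ex_idx. r (p (at_pt \<mu> j (at_pt \<nu> k w))))"
    unfolding sum_subtractf[symmetric] using mem by (intro sum.cong refl r_J_outer) auto
  also have "r (J \<mu> (act \<nu> (p w))) = r (act \<nu> (J \<mu> (p w))) + r (J (mlie \<mu> \<nu>) (p w))"
    using r_J_act[OF outer_N[OF assms(1)] assms(2) p_closed[OF assms(3)]] B_outer[OF assms(1,2)] by simp
  also have "r (act \<nu> (J \<mu> (p w))) = r (act \<nu> (act \<mu> (p w))) - (\<Sum>k\<in>Ex_idx. r (act \<nu> (p (at_pt \<mu> k w))))"
    by (rule act_diff_sum[OF _ _ _ _ _ r_J_outer]) (use assms in \<open>auto intro: memI\<close>)
  finally show ?thesis by (simp add: algebra_simps)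
qed

text \<open>Half of the terms of \<open>J_outer_outer\<close> are symmetric in \<open>\<mu>\<close> and \<open>\<nu>\<close> and cancel. What is left is \<open>J [\<mu>, \<nu>]\<close> twice,
  minus the action of the bracket, plus the evaluations of the bracket; the last two make up \<open>- J [\<mu>, \<nu>]\<close>.\<close>

lemma gap_outer_outer:
  assumes "\<mu> \<in> Lout" "\<nu> \<in> Lout" "w \<in> tuples n W"
  shows "gap \<mu> \<nu> (p w) = 0"
proof -
  have mn: "mlie \<mu> \<nu> \<in> Lout" using assms(1,2) by (rule mlie_regular_on)
  have "r (J (mlie \<nu> \<mu>) (p w)) = - r (J (mlie \<mu> \<nu>) (p w))"
    using assms by (intro r_J_swap memI)
  moreover have "(\<Sum>k\<in>Ex_idx. \<Sum>j\<in>Ex_idx. r (p (at_pt \<mu> j (at_pt \<nu> k w))))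
    = (\<Sum>k\<in>Ex_idx. \<Sum>j\<in>Ex_idx. r (p (at_pt \<nu> j (at_pt \<mu> k w)))) + (\<Sum>k\<in>Ex_idx. r (p (at_pt (mlie \<mu> \<nu>) k w)))"
    using assms closure_subset[of D]
    by (intro double_sum_bracket) (auto intro: maps_regular_on_pre_mero maps_regular_onD)
  ultimately show ?thesis
    using DW_act_commutator[OF assms, of \<rho>] r_J_outer[OF mn assms(3)] B_outer[OF assms(1,2)]
    unfolding gap_def J_outer_outer[OF assms] J_outer_outer[OF assms(2,1,3)]
    by (simp add: algebra_simps)
qed

lemma J_inner:
  assumes "\<mu> \<in> N" "\<nu> \<in> Lin" "w \<in> tuples n W"
  shows "r (J \<mu> (J \<nu> (p w))) = (\<Sum>k\<in>In_idx. r (J \<mu> (p (at_pt \<nu> k w))))"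
  by (rule J_sum[OF _ _ _ _ r_J_inner]) (use assms in \<open>auto intro: memI\<close>)

lemma gap_inner_inner:
  assumes "\<mu> \<in> Lin" "\<nu> \<in> Lin" "w \<in> tuples n W"
  shows "gap \<mu> \<nu> (p w) = 0"
proof -
  have mn: "mlie \<mu> \<nu> \<in> Lin" using assms(1,2) by (rule mlie_regular_on)
  have two: "r (J \<mu> (J \<nu> (p w))) = (\<Sum>k\<in>In_idx. \<Sum>j\<in>In_idx. r (p (at_pt \<mu> j (at_pt \<nu> k w))))"
    if "\<mu> \<in> Lin" "\<nu> \<in> Lin" for \<mu> \<nu>
    unfolding J_inner[OF inner_N[OF that(1)] that(2) assms(3)]
    using that assms(3) at_pt_tuples by (intro sum.cong refl r_J_inner) auto
  have "(\<Sum>k\<in>In_idx. \<Sum>j\<in>In_idx. r (p (at_pt \<mu> j (at_pt \<nu> k w))))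
    = (\<Sum>k\<in>In_idx. \<Sum>j\<in>In_idx. r (p (at_pt \<nu> j (at_pt \<mu> k w)))) + (\<Sum>k\<in>In_idx. r (p (at_pt (mlie \<mu> \<nu>) k w)))"
    using assms closure_subset[of D]
    by (intro double_sum_bracket) (auto intro: maps_regular_on_pre_mero maps_regular_onD)
  then show ?thesis
    unfolding gap_def two[OF assms(1,2)] two[OF assms(2,1)]
    using r_J_inner[OF mn assms(3)] B_inner[OF assms(1,2)] by simp
qed

text \<open>Here the evaluations take place at different points and commute. The bracket and the pairing come from
  moving \<open>J \<nu>\<close> past the action of \<open>\<mu>\<close>; antisymmetry turns \<open>B \<nu> \<mu>\<close> into \<open>B \<mu> \<nu>\<close>.\<close>

lemma gap_outer_inner:
  assumes "\<mu> \<in> Lout" "\<nu> \<in> Lin" "w \<in> tuples n W"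
  shows "gap \<mu> \<nu> (p w) = 0"
proof -
  note mem = assms J_closed act_closed p_closed at_pt_tuples outer_N inner_N
  have "r (J \<mu> (J \<nu> (p w))) = (\<Sum>k\<in>In_idx. r (act \<mu> (p (at_pt \<nu> k w))) - (\<Sum>j\<in>Ex_idx. r (p (at_pt \<mu> j (at_pt \<nu> k w)))))"
    unfolding J_inner[OF outer_N[OF assms(1)] assms(2,3)]
    using mem by (intro sum.cong refl r_J_outer) auto
  then have 1: "r (J \<mu> (J \<nu> (p w))) = (\<Sum>k\<in>In_idx. r (act \<mu> (p (at_pt \<nu> k w))))
      - (\<Sum>k\<in>In_idx. \<Sum>j\<in>Ex_idx. r (p (at_pt \<mu> j (at_pt \<nu> k w))))"
    by (simp add: sum_subtractf)
  have "r (J \<nu> (J \<mu> (p w))) = r (J \<nu> (act \<mu> (p w))) - (\<Sum>j\<in>Ex_idx. r (J \<nu> (p (at_pt \<mu> j w))))"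
    by (rule J_diff_sum[OF _ _ _ _ _ r_J_outer]) (use assms in \<open>auto intro: memI\<close>)
  also have "(\<Sum>j\<in>Ex_idx. r (J \<nu> (p (at_pt \<mu> j w)))) = (\<Sum>j\<in>Ex_idx. \<Sum>k\<in>In_idx. r (p (at_pt \<nu> k (at_pt \<mu> j w))))"
    using mem by (intro sum.cong refl r_J_inner) auto
  also have "\<dots> = (\<Sum>j\<in>Ex_idx. \<Sum>k\<in>In_idx. r (p (at_pt \<mu> j (at_pt \<nu> k w))))"
    using closure_subset[of D] by (intro sum.cong refl arg_cong[of _ _ "\<lambda>v. r (p v)"] at_pt_commute) auto
  also have "\<dots> = (\<Sum>k\<in>In_idx. \<Sum>j\<in>Ex_idx. r (p (at_pt \<mu> j (at_pt \<nu> k w))))"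
    by (rule sum.swap)
  also have "r (J \<nu> (act \<mu> (p w))) = r (act \<mu> (J \<nu> (p w))) + r (J (mlie \<nu> \<mu>) (p w)) + B \<nu> \<mu> *\<^sub>C r (p w)"
    using mem by (intro r_J_act) auto
  also have "r (act \<mu> (J \<nu> (p w))) = (\<Sum>k\<in>In_idx. r (act \<mu> (p (at_pt \<nu> k w))))"
    by (rule act_sum[OF _ _ _ _ r_J_inner]) (use assms in \<open>auto intro: memI\<close>)
  finally have 2: "r (J \<mu> (J \<nu> (p w))) - r (J \<nu> (J \<mu> (p w))) = - r (J (mlie \<nu> \<mu>) (p w)) - B \<nu> \<mu> *\<^sub>C r (p w)"
    unfolding 1 by simp
  have "r (J (mlie \<nu> \<mu>) (p w)) = - r (J (mlie \<mu> \<nu>) (p w))"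
    using assms by (intro r_J_swap memI)
  moreover have "B \<nu> \<mu> = - B \<mu> \<nu>"
    using assms by (intro boundary_pairing_antisym[OF psb] N_range memI)
  ultimately show ?thesis using 2 by (simp add: gap_def)
qed

lemma gap_pure:
  assumes "\<mu> \<in> N" "\<nu> \<in> N" "w \<in> tuples n W"
  shows "gap \<mu> \<nu> (p w) = 0"
proof -
  obtain \<mu>1 \<mu>2 where \<mu>: "\<mu>1 \<in> Lout" "\<mu>2 \<in> Lin" "\<mu> = madd \<mu>1 \<mu>2" using N_split[OF assms(1)] .
  obtain \<nu>1 \<nu>2 where \<nu>: "\<nu>1 \<in> Lout" "\<nu>2 \<in> Lin" "\<nu> = madd \<nu>1 \<nu>2" using N_split[OF assms(2)] .
  note N = outer_N[OF \<mu>(1)] inner_N[OF \<mu>(2)] outer_N[OF \<nu>(1)] inner_N[OF \<nu>(2)]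
  note pw = p_closed[OF assms(3)]
  have "gap \<mu> \<nu> (p w) = gap \<mu>1 \<nu>1 (p w) + gap \<mu>1 \<nu>2 (p w) + (gap \<mu>2 \<nu>1 (p w) + gap \<mu>2 \<nu>2 (p w))"
    using assms(1,2) N pw unfolding \<mu>(3) \<nu>(3)
    by (simp add: gap_madd_left gap_madd_right)
  also have "gap \<mu>2 \<nu>1 (p w) = - gap \<nu>1 \<mu>2 (p w)" by (rule gap_swap[OF N(3,2) pw])
  finally show ?thesis
    using \<mu> \<nu> assms(3) by (simp add: gap_outer_outer gap_inner_inner gap_outer_inner)
qed

lemma gap_zero:
  assumes "m \<in> M" "\<mu> \<in> N" "\<nu> \<in> N"
  shows "gap \<mu> \<nu> m = 0"
  using assms
proof (induction m arbitrary: \<mu> \<nu> rule: DW_induct)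
  case zero
  have z: "cls R 0 \<in> M" "r (cls R 0) = 0"
    by (auto simp: module_quot cls_zero_in_quot coset_rep_cls coset_proj_zero)
  have null: "r (J \<kappa> m) = 0" if "\<kappa> \<in> N" "m \<in> M" "r m = 0" for \<kappa> m
    using J_scale[OF that(1,2) z(1), of 0] that(3) by simp
  show ?case
    using zero z by (simp add: gap_def null memI)
next
  case (pure w)
  then show ?case by (intro gap_pure)
next
  case (act \<alpha> m)
  then show ?case by (intro gap_act) auto
next
  case (add m m')
  have J1: "r (J \<kappa> (qadd R m m')) = r (J \<kappa> m) + r (J \<kappa> m')" if "\<kappa> \<in> N" for \<kappa>
    using add that by (intro J_add r_qadd M_qadd)
  have J2: "r (J \<kappa>' (J \<kappa> (qadd R m m'))) = r (J \<kappa>' (J \<kappa> m)) + r (J \<kappa>' (J \<kappa> m'))"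
    if "\<kappa> \<in> N" "\<kappa>' \<in> N" for \<kappa> \<kappa>'
    using add that by (intro J_add J1 M_qadd J_closed)
  have "gap \<mu> \<nu> (qadd R m m') = gap \<mu> \<nu> m + gap \<mu> \<nu> m'"
    using add.hyps add.prems by (simp add: gap_def J1 J2 mlie_N r_qadd cvs.scale_right_distrib)
  then show ?case using add by simp
next
  case (scale c m)
  have J1: "r (J \<kappa> (qscale R c m)) = c *\<^sub>C r (J \<kappa> m)" if "\<kappa> \<in> N" for \<kappa>
    using scale that by (intro J_scale r_qscale M_qscale)
  have J2: "r (J \<kappa>' (J \<kappa> (qscale R c m))) = c *\<^sub>C r (J \<kappa>' (J \<kappa> m))"
    if "\<kappa> \<in> N" "\<kappa>' \<in> N" for \<kappa> \<kappa>'
    using scale that by (intro J_scale J1 M_qscale J_closed)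
  have "gap \<mu> \<nu> (qscale R c m) = c *\<^sub>C gap \<mu> \<nu> m"
    using scale.hyps scale.prems
    by (simp add: gap_def J1 J2 mlie_N r_qscale cvs.scale_right_diff_distrib cvs.scale_scale mult.commute)
  then show ?case using scale by simp
qed

lemma DJ_defect_eq:
  assumes "\<mu> \<in> N" "\<nu> \<in> N" "m \<in> M"
  shows "DJ_defect R J \<mu> \<nu> m = qscale R (B \<mu> \<nu>) m"
proof (rule r_inject)
  have mem: "J \<mu> (J \<nu> m) \<in> M" "J \<nu> (J \<mu> m) \<in> M" "J (mlie \<mu> \<nu>) m \<in> M"
    using assms by (auto intro: memI)
  then show "DJ_defect R J \<mu> \<nu> m \<in> M" by (simp add: DJ_defect_def M_qdiff)
  show "qscale R (B \<mu> \<nu>) m \<in> M" using assms(3) by (rule M_qscale)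
  show "r (DJ_defect R J \<mu> \<nu> m) = r (qscale R (B \<mu> \<nu>) m)"
    using gap_zero[OF assms(3,1,2)] mem assms(3)
    by (simp add: DJ_defect_def r_qdiff M_qdiff r_qscale gap_def)
qed

end

theorem proposition12p2:
  fixes D :: "cproj set"
    and \<gamma> :: "real \<Rightarrow> cproj"
    and n :: nat
    and z :: "nat \<Rightarrow> cproj"
    and W :: "nat \<Rightarrow> 'w::complex_vector_space set"
    and \<rho> :: "nat \<Rightarrow> 'g::quadratic_lie_algebra \<Rightarrow> 'w \<Rightarrow> 'w"
    and J :: "(cproj \<Rightarrow> 'g) \<Rightarrow> ('g uel \<times> 'w tel \<Rightarrow>\<^sub>0 complex) set \<Rightarrow> ('g uel \<times> 'w tel \<Rightarrow>\<^sub>0 complex) set"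
    and \<mu> \<nu> :: "cproj \<Rightarrow> 'g"
  assumes "open D" and "connected D" and "biholomorphic_to_disc D"
    and "positive_smooth_boundary D \<gamma>"
    and "inj_on z {..<n}" and "\<And>k. k < n \<Longrightarrow> z k \<notin> frontier D"
    and "\<And>k. k < n \<Longrightarrow> lie_representation (W k) (\<rho> k)"
    and "is_DJ D \<gamma> n z W \<rho> J"
    and "\<mu> \<in> maps_regular_on (frontier D)" and "\<nu> \<in> maps_regular_on (frontier D)"
  shows "(\<mu> \<in> maps_regular_on (exterior D) \<and> \<nu> \<in> maps_regular_on (exterior D)
          \<or> \<mu> \<in> maps_regular_on D \<and> \<nu> \<in> maps_regular_on D
          \<longrightarrow> (\<forall>m \<in> DW D n W \<rho>.
                DJ_defect (DW_rel D n W \<rho>) J \<mu> \<nu> m = cls (DW_rel D n W \<rho>) 0))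
       \<and> (\<forall>m \<in> DW D n W \<rho>. DJ_defect (DW_rel D n W \<rho>) J \<mu> \<nu> m
            = qscale (DW_rel D n W \<rho>) (boundary_pairing \<gamma> \<mu> \<nu>) m)"
proof (intro conjI impI)
  interpret DJ_operators D \<gamma> n z W \<rho> J
    using assms(1-4,7,8) by unfold_locales
  have general: "\<forall>m \<in> M. DJ_defect R J \<mu> \<nu> m = qscale R (B \<mu> \<nu>) m"
    using DJ_defect_eq assms(9,10) by blast
  then show "\<forall>m \<in> M. DJ_defect R J \<mu> \<nu> m = qscale R (B \<mu> \<nu>) m" .
  assume "\<mu> \<in> maps_regular_on (exterior D) \<and> \<nu> \<in> maps_regular_on (exterior D)
    \<or> \<mu> \<in> maps_regular_on D \<and> \<nu> \<in> maps_regular_on D"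
  moreover have "\<kappa> \<in> Lout" if "\<kappa> \<in> maps_regular_on (exterior D)" "\<kappa> \<in> N" for \<kappa> :: "cproj \<Rightarrow> 'g"
    using that frontier_eq(2) by (force simp: maps_regular_on_def)
  moreover have "\<kappa> \<in> Lin" if "\<kappa> \<in> maps_regular_on D" "\<kappa> \<in> N" for \<kappa> :: "cproj \<Rightarrow> 'g"
    using that frontier_eq(2) by (force simp: maps_regular_on_def)
  ultimately have "\<mu> \<in> Lout \<and> \<nu> \<in> Lout \<or> \<mu> \<in> Lin \<and> \<nu> \<in> Lin"
    using assms(9,10) by blast
  then have "B \<mu> \<nu> = 0" using B_outer B_inner by blast
  moreover have "qscale R 0 m = cls R 0" if "m \<in> M" for m
    using that by (auto simp: module_quot elim!: quot_cases simp: qscale_cls)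
  ultimately show "\<forall>m \<in> M. DJ_defect R J \<mu> \<nu> m = cls R 0"
    using general by simp
qed

end
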